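(* Let $X$ be a random measure with values in $\mathcal{M}(R,M)$, and let $X_1,\dots,X_n$ be an i.i.d. sample drawn from $X$. Let $k\ge2$ and assume that $\mathbb{E}(X)$ is supported by more than $k$ points and satisfies a margin condition with radius $r_0>0$. Denote $R_0=\frac{Br_0}{16\sqrt2R}$ and $\kappa_0=R_0/R$. There exist positive constants $c,C$ such that the following holds. Suppose that the sample is divided into equally sized mini-batches $(B_1,\dots,B_T)$, each of length $ckM^2\log(n)/(\kappa_0p_{min})^2$ (up to rounding), and let $\mathbf{c}^{(T)}$ denote the output of the mini-batch (Mac-Queen) algorithm started from the initial codebook $\mathbf{c}^{(0)}$. Then, provided that $\mathbf{c}^{(0)}\in\mathcal{B}(\mathcal{C}_{opt},R_0)$, $$\mathbb{E}\left(F(\mathbf{c}^{(T)})-F^*\right)\le\mathbb{E}(X)(\mathbb{R}^d)\left(Ck^2M^3R^2\frac{\log n}{n\,\kappa_0^2\,p_{min}^3}\right).$$ Moreover, in the sample point case (where $X=\delta_{X^{(1)}}$ almost surely for an $\mathbb{R}^d$-valued random variable $X^{(1)}$), the same result holds with the centroid update $$c_j^{(t+1)}=c_j^{(t)}-\frac{\int(c_j^{(t)}-u)\mathbf{1}_{W_j(\mathbf{c}^{(t)})}(u)\,\bar X_{B_{t+1}}(du)}{(t+1)\,\bar X_{B_{t+1}}(W_j(\mathbf{c}^{(t)}))},$$ that is, without splitting the batches.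
   Context: $\mathcal{M}(R,M)$ is the set of (nonnegative) Borel measures on the closed Euclidean ball $\mathcal{B}(0,R)\subset\mathbb{R}^d$ of total mass at most $M$. The mean measure is $\mathbb{E}(X)(A)=\mathbb{E}(X(A))$ for Borel $A$. For a codebook $\mathbf{c}=(c_1,\dots,c_k)\in(\mathbb{R}^d)^k$ (with Euclidean norm on $(\mathbb{R}^d)^k$), let $W_j(\mathbf{c})=\{x: \forall i<j\ \|x-c_j\|<\|x-c_i\|,\ \forall i>j\ \|x-c_j\|\le\|x-c_i\|\}$ and $N(\mathbf{c})=\{x:\exists i<j,\ x\in W_i(\mathbf{c}),\ \|x-c_i\|=\|x-c_j\|\}$. The distortion is $F(\mathbf{c})=\int\min_{1\le j\le k}\|u-c_j\|^2\,\mathbb{E}(X)(du)$; $\mathcal{C}_{opt}$ is its (nonempty) set of minimizers and $F^*$ its minimum. Put $B=\inf_{\mathbf{c}^*\in\mathcal{C}_{opt},\,i\ne j}\|c_i^*-c_j^*\|$ and $p_{min}=\inf_{\mathbf{c}^*\in\mathcal{C}_{opt},\,1\le j\le k}\mathbb{E}(X)(W_j(\mathbf{c}^* ))$ (both positive when $\mathbb{E}(X)$ is supported by more than $k$ points). For a subset $A$ of a Euclidean space, $\mathcal{B}(A,t)=\bigcup_{u\in A}\mathcal{B}(u,t)$. Margin condition: $\mathbb{E}(X)$ satisfies a margin condition with radius $r_0>0$ if for all $0\le t\le r_0$, $\sup_{\mathbf{c}^*\in\mathcal{C}_{opt}}\mathbb{E}(X)(\mathcal{B}(N(\mathbf{c}^*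 ),t))\le\frac{Bp_{min}}{128R^2}t$. Mini-batch (Mac-Queen) algorithm: the sample $X_1,\dots,X_n$ is partitioned into mini-batches $B_1,\dots,B_T$, and each $B_t$ is divided into two halves $B_t^{(1)},B_t^{(2)}$. For a batch $S$, $\bar X_S=\frac1{|S|}\sum_{X_i\in S}X_i$. Starting from $\mathbf{c}^{(0)}$, for $t=0,\dots,T-1$ and $j=1,\dots,k$, $$c_j^{(t+1)}=\pi_{\mathcal{B}(0,R)}\left(c_j^{(t)}-\frac{\int(c_j^{(t)}-u)\mathbf{1}_{W_j(\mathbf{c}^{(t)})}(u)\,\bar X_{B_{t+1}^{(2)}}(du)}{(t+1)\,\bar X_{B_{t+1}^{(1)}}(W_j(\mathbf{c}^{(t)}))}\right),$$ where $\pi_{\mathcal{B}(0,R)}$ is the Euclidean projection (equivalently, the whole codebook is projected onto $\mathcal{B}(0,R)^k$). If the denominator vanishes, $c_j$ is left unchanged. *)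

theory Defs
  imports "HOL-Probability.Probability"
begin

text \<open>
  The dimension d is a natural number, not a type: the constants of the theorem must not depend
  on d, and an existential over constants cannot stand in front of a quantifier over types.
  A point of d-dimensional Euclidean space is an extensional function on {1..d}, a codebook is an
  extensional function from {1..k} to such points.
\<close>

type_synonym pt = "nat \<Rightarrow> real"
type_synonym codebook = "nat \<Rightarrow> pt"

definition euc :: "nat \<Rightarrow> pt measure" where
  "euc d = Pi\<^sub>M {1..d} (\<lambda>_. borel)"

definition origin :: "nat \<Rightarrow> pt" where
  "origin d = (\<lambda>i\<in>{1..d}. 0)"

definition edist :: "nat \<Rightarrow> pt \<Rightarrow> pt \<Rightarrow> real" where
  "edist d x y = L2_set (\<lambda>i. x i - y i) {1..d}"

definition eball :: "nat \<Rightarrow> pt \<Rightarrow> real \<Rightarrow> pt set" where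
  "eball d x r = {y \<in> space (euc d). edist d x y \<le> r}"

text \<open>Same form as the library's \<open>closest_point\<close>.\<close>

definition eproj :: "nat \<Rightarrow> pt set \<Rightarrow> pt \<Rightarrow> pt" where
  "eproj d S x = (SOME y. y \<in> S \<and> (\<forall>z\<in>S. edist d x y \<le> edist d x z))"

definition codebooks :: "nat \<Rightarrow> nat \<Rightarrow> codebook set" where
  "codebooks d k = {1..k} \<rightarrow>\<^sub>E space (euc d)"

definition cdist :: "nat \<Rightarrow> nat \<Rightarrow> codebook \<Rightarrow> codebook \<Rightarrow> real" where
  "cdist d k c c' = L2_set (\<lambda>j. edist d (c j) (c' j)) {1..k}"


subsection \<open>Random measures\<close>

text \<open>
  Measures on the closed ball are measures on the whole space that do not charge the complement
  of the ball. The sigma-algebra is generated by the evaluation maps, as in \<open>subprob_algebra\<close>.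
\<close>

definition ball_measures :: "nat \<Rightarrow> real \<Rightarrow> real \<Rightarrow> pt measure measure" where
  "ball_measures d R M =
    (SUP A\<in>sets (euc d).
      vimage_algebra
        {\<mu>. sets \<mu> = sets (euc d) \<and>
            emeasure \<mu> (space \<mu> - eball d (origin d) R) = 0 \<and>
            emeasure \<mu> (space \<mu>) \<le> ennreal M}
        (\<lambda>\<mu>. emeasure \<mu> A) borel)"

definition mean_measure :: "nat \<Rightarrow> 'w measure \<Rightarrow> ('w \<Rightarrow> pt measure) \<Rightarrow> pt measure" where
  "mean_measure d P X =
    measure_of (space (euc d)) (sets (euc d)) (\<lambda>A. \<integral>\<^sup>+ \<omega>. emeasure (X \<omega>) A \<partial>P)"

lemma space_ball_measures:
  "space (ball_measures d R M) =
    {\<mu>. sets \<mu> = sets (euc d) \<and>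
        emeasure \<mu> (space \<mu> - eball d (origin d) R) = 0 \<and>
        emeasure \<mu> (space \<mu>) \<le> ennreal M}"
  unfolding ball_measures_def by (subst space_Sup_eq_UN) auto

lemma measurable_emeasure_ball_measures:
  assumes "A \<in> sets (euc d)"
  shows "(\<lambda>\<mu>. emeasure \<mu> A) \<in> borel_measurable (ball_measures d R M)"
  unfolding ball_measures_def
  by (rule measurable_Sup1[where f = "\<lambda>\<mu>. emeasure \<mu> A"])
     (use assms in \<open>auto intro!: measurable_vimage_algebra1\<close>)

lemma emeasure_mean_measure:
  assumes X: "X \<in> P \<rightarrow>\<^sub>M ball_measures d R M" and A: "A \<in> sets (euc d)"
  shows "emeasure (mean_measure d P X) A = (\<integral>\<^sup>+ \<omega>. emeasure (X \<omega>) A \<partial>P)"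
proof (rule emeasure_measure_of[OF mean_measure_def _ _ _])
  show "sets (euc d) \<subseteq> Pow (space (euc d))" by (rule sets.space_closed)
  show "A \<in> sets (mean_measure d P X)"
    using A by (simp add: mean_measure_def)
  show "positive (sets (mean_measure d P X)) (\<lambda>A. \<integral>\<^sup>+ \<omega>. emeasure (X \<omega>) A \<partial>P)"
    by (simp add: positive_def)
  show "countably_additive (sets (mean_measure d P X)) (\<lambda>A. \<integral>\<^sup>+ \<omega>. emeasure (X \<omega>) A \<partial>P)"
  proof (rule countably_additiveI)
    fix F :: "nat \<Rightarrow> pt set"
    assume "range F \<subseteq> sets (mean_measure d P X)" and disj: "disjoint_family F"
    then have F: "range F \<subseteq> sets (euc d)" by (simp add: mean_measure_def)
    then have meas: "(\<lambda>\<omega>. emeasure (X \<omega>) (F i)) \<in> borel_measurable P" for i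
      using measurable_compose[OF X measurable_emeasure_ball_measures[of "F i"]] by blast
    have "(\<Sum>i. \<integral>\<^sup>+ \<omega>. emeasure (X \<omega>) (F i) \<partial>P) = (\<integral>\<^sup>+ \<omega>. (\<Sum>i. emeasure (X \<omega>) (F i)) \<partial>P)"
      using meas by (intro nn_integral_suminf[symmetric]) auto
    also have "\<dots> = (\<integral>\<^sup>+ \<omega>. emeasure (X \<omega>) (\<Union>i. F i) \<partial>P)"
    proof (rule nn_integral_cong)
      fix \<omega> assume "\<omega> \<in> space P"
      then have "sets (X \<omega>) = sets (euc d)"
        using measurable_space[OF X] by (simp add: space_ball_measures)
      then show "(\<Sum>i. emeasure (X \<omega>) (F i)) = emeasure (X \<omega>) (\<Union>i. F i)"
        using F disj by (intro suminf_emeasure) auto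
    qed
    finally show "(\<Sum>i. \<integral>\<^sup>+ \<omega>. emeasure (X \<omega>) (F i) \<partial>P) = (\<integral>\<^sup>+ \<omega>. emeasure (X \<omega>) (\<Union>i. F i) \<partial>P)" .
  qed
qed

definition iid_sample ::
    "'w measure \<Rightarrow> 'a measure \<Rightarrow> ('w \<Rightarrow> 'a) \<Rightarrow> nat \<Rightarrow> (nat \<Rightarrow> 'w \<Rightarrow> 'a) \<Rightarrow> bool" where
  "iid_sample P N X n Xs \<longleftrightarrow>
    prob_space.indep_vars P (\<lambda>_. N) Xs {1..n} \<and>
    (\<forall>i\<in>{1..n}. distr P N (Xs i) = distr P N X)"

definition sample_point :: "nat \<Rightarrow> 'w measure \<Rightarrow> ('w \<Rightarrow> pt measure) \<Rightarrow> bool" where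
  "sample_point d P X \<longleftrightarrow>
    (\<exists>Y. Y \<in> P \<rightarrow>\<^sub>M euc d \<and> (AE \<omega> in P. X \<omega> = return (euc d) (Y \<omega>)))"

definition supp :: "nat \<Rightarrow> pt measure \<Rightarrow> pt set" where
  "supp d \<mu> = {x \<in> space (euc d). \<forall>r>0. 0 < emeasure \<mu> (eball d x r)}"

definition supported_by_more_than :: "nat \<Rightarrow> pt measure \<Rightarrow> nat \<Rightarrow> bool" where
  "supported_by_more_than d \<mu> k \<longleftrightarrow> infinite (supp d \<mu>) \<or> k < card (supp d \<mu>)"


subsection \<open>Quantization\<close>

definition cell :: "nat \<Rightarrow> nat \<Rightarrow> codebook \<Rightarrow> nat \<Rightarrow> pt set" where
  "cell d k c j =
    {x \<in> space (euc d).
      (\<forall>i\<in>{1..k}. i < j \<longrightarrow> edist d x (c j) < edist d x (c i)) \<and>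
      (\<forall>i\<in>{1..k}. j < i \<longrightarrow> edist d x (c j) \<le> edist d x (c i))}"

definition cell_boundary :: "nat \<Rightarrow> nat \<Rightarrow> codebook \<Rightarrow> pt set" where
  "cell_boundary d k c =
    {x. \<exists>i\<in>{1..k}. \<exists>j\<in>{1..k}. i < j \<and> x \<in> cell d k c i \<and> edist d x (c i) = edist d x (c j)}"

definition distortion :: "nat \<Rightarrow> nat \<Rightarrow> pt measure \<Rightarrow> codebook \<Rightarrow> real" where
  "distortion d k \<mu> c = (\<integral>u. (MIN j\<in>{1..k}. (edist d u (c j))\<^sup>2) \<partial>\<mu>)"

definition opt_codebooks :: "nat \<Rightarrow> nat \<Rightarrow> pt measure \<Rightarrow> codebook set" where
  "opt_codebooks d k \<mu> =
    {c \<in> codebooks d k. \<forall>c'\<in>codebooks d k. distortion d k \<mu> c \<le> distortion d k \<mu> c'}"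

definition opt_distortion :: "nat \<Rightarrow> nat \<Rightarrow> pt measure \<Rightarrow> real" where
  "opt_distortion d k \<mu> = (INF c\<in>codebooks d k. distortion d k \<mu> c)"

definition min_sep :: "nat \<Rightarrow> nat \<Rightarrow> pt measure \<Rightarrow> real" where
  "min_sep d k \<mu> =
    Inf {edist d (c i) (c j) | c i j.
      c \<in> opt_codebooks d k \<mu> \<and> i \<in> {1..k} \<and> j \<in> {1..k} \<and> i \<noteq> j}"

definition p_min :: "nat \<Rightarrow> nat \<Rightarrow> pt measure \<Rightarrow> real" where
  "p_min d k \<mu> =
    Inf {measure \<mu> (cell d k c j) | c j. c \<in> opt_codebooks d k \<mu> \<and> j \<in> {1..k}}"

definition margin_condition :: "nat \<Rightarrow> nat \<Rightarrow> real \<Rightarrow> pt measure \<Rightarrow> real \<Rightarrow> bool" where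
  "margin_condition d k R \<mu> r0 \<longleftrightarrow>
    (\<forall>t. 0 \<le> t \<and> t \<le> r0 \<longrightarrow>
      (SUP c\<in>opt_codebooks d k \<mu>. emeasure \<mu> (\<Union>u\<in>cell_boundary d k c. eball d u t))
        \<le> ennreal (min_sep d k \<mu> * p_min d k \<mu> / (128 * R\<^sup>2) * t))"

definition near_opt :: "nat \<Rightarrow> nat \<Rightarrow> pt measure \<Rightarrow> real \<Rightarrow> codebook set" where
  "near_opt d k \<mu> r =
    (\<Union>c\<in>opt_codebooks d k \<mu>. {c' \<in> codebooks d k. cdist d k c c' \<le> r})"


subsection \<open>The mini-batch algorithm\<close>

definition batch_mean :: "nat \<Rightarrow> (nat \<Rightarrow> pt measure) \<Rightarrow> nat set \<Rightarrow> pt measure" where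
  "batch_mean d xs S =
    measure_of (space (euc d)) (sets (euc d))
      (\<lambda>A. ennreal (1 / real (card S)) * (\<Sum>i\<in>S. emeasure (xs i) A))"

lemma emeasure_batch_mean:
  assumes "\<And>i. i \<in> S \<Longrightarrow> sets (xs i) = sets (euc d)" and A: "A \<in> sets (euc d)"
  shows "emeasure (batch_mean d xs S) A =
    ennreal (1 / real (card S)) * (\<Sum>i\<in>S. emeasure (xs i) A)"
proof (rule emeasure_measure_of[OF batch_mean_def])
  let ?m = "\<lambda>A. ennreal (1 / real (card S)) * (\<Sum>i\<in>S. emeasure (xs i) A)"
  show "sets (euc d) \<subseteq> Pow (space (euc d))" by (rule sets.space_closed)
  show "A \<in> sets (batch_mean d xs S)"
    using A by (simp add: batch_mean_def)
  show "positive (sets (batch_mean d xs S)) ?m"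
    by (simp add: positive_def)
  show "countably_additive (sets (batch_mean d xs S)) ?m"
  proof (rule countably_additiveI)
    fix F :: "nat \<Rightarrow> pt set"
    assume "range F \<subseteq> sets (batch_mean d xs S)" and disj: "disjoint_family F"
    then have F: "range F \<subseteq> sets (euc d)" by (simp add: batch_mean_def)
    have "(\<Sum>n. \<Sum>i\<in>S. emeasure (xs i) (F n)) = (\<Sum>i\<in>S. \<Sum>n. emeasure (xs i) (F n))"
      by (rule suminf_sum) auto
    also have "\<dots> = (\<Sum>i\<in>S. emeasure (xs i) (\<Union>n. F n))"
      using assms(1) F disj by (intro sum.cong refl suminf_emeasure) auto
    finally show "(\<Sum>n. ?m (F n)) = ?m (\<Union>n. F n)"
      by simp
  qed
qed

text \<open>
  The unprojected update of the j-th code point, with numerator batch \<open>S2\<close> and denominator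
  batch \<open>S1\<close>.
\<close>

definition raw_update ::
    "nat \<Rightarrow> nat \<Rightarrow> (nat \<Rightarrow> pt measure) \<Rightarrow> nat set \<Rightarrow> nat set \<Rightarrow> nat \<Rightarrow> codebook \<Rightarrow> nat \<Rightarrow> pt" where
  "raw_update d k xs S1 S2 t c j =
    (\<lambda>i\<in>{1..d}. c j i -
      (\<integral>u. (c j i - u i) * indicator (cell d k c j) u \<partial>batch_mean d xs S2) /
      (real (t + 1) * measure (batch_mean d xs S1) (cell d k c j)))"

primrec minibatch ::
    "nat \<Rightarrow> nat \<Rightarrow> real \<Rightarrow> (nat \<Rightarrow> pt measure) \<Rightarrow> (nat \<Rightarrow> nat set) \<Rightarrow> (nat \<Rightarrow> nat set) \<Rightarrow> codebook
      \<Rightarrow> nat \<Rightarrow> codebook" where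
  "minibatch d k R xs B1 B2 c0 0 = c0"
| "minibatch d k R xs B1 B2 c0 (Suc t) =
    (let c = minibatch d k R xs B1 B2 c0 t in
      (\<lambda>j\<in>{1..k}.
        if measure (batch_mean d xs (B1 (Suc t))) (cell d k c j) = 0 then c j
        else eproj d (eball d (origin d) R)
               (raw_update d k xs (B1 (Suc t)) (B2 (Suc t)) t c j)))"

primrec minibatch_centroid ::
    "nat \<Rightarrow> nat \<Rightarrow> (nat \<Rightarrow> pt measure) \<Rightarrow> (nat \<Rightarrow> nat set) \<Rightarrow> codebook \<Rightarrow> nat \<Rightarrow> codebook" where
  "minibatch_centroid d k xs B c0 0 = c0"
| "minibatch_centroid d k xs B c0 (Suc t) =
    (let c = minibatch_centroid d k xs B c0 t in
      (\<lambda>j\<in>{1..k}.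
        if measure (batch_mean d xs (B (Suc t))) (cell d k c j) = 0 then c j
        else raw_update d k xs (B (Suc t)) (B (Suc t)) t c j))"

text \<open>
  Cutting {1..n} into \<open>T\<close> batches of common size \<open>m\<close>; when \<open>m\<close> does not divide \<open>n\<close>,
  fewer than \<open>m\<close> indices are left over.
\<close>

definition batches :: "nat \<Rightarrow> nat \<Rightarrow> nat \<Rightarrow> (nat \<Rightarrow> nat set) \<Rightarrow> bool" where
  "batches n m T B \<longleftrightarrow>
    disjoint_family_on B {1..T} \<and>
    (\<forall>t\<in>{1..T}. B t \<subseteq> {1..n} \<and> card (B t) = m) \<and>
    card ({1..n} - (\<Union>t\<in>{1..T}. B t)) < m"

text \<open>A batch of odd size is split into parts whose sizes differ by one.\<close>

definition halves :: "nat set \<Rightarrow> nat set \<Rightarrow> nat set \<Rightarrow> bool" where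
  "halves S S1 S2 \<longleftrightarrow>
    S1 \<union> S2 = S \<and> S1 \<inter> S2 = {} \<and> card S1 \<le> card S2 + 1 \<and> card S2 \<le> card S1 + 1"

end

theory Submission
  imports Defs
begin

text \<open>
  Let \<open>c*\<close> be an optimal codebook within \<open>R0\<close> of the starting point.
  The proof follows the squared distance from the current codebook to \<open>c*\<close>; since
  \<open>c*\<close> consists of centroids, the excess distortion of a codebook is at most the
  total mass of the mean measure times this squared distance (\<open>excess_le\<close>).

  Positivity of \<open>min_sep\<close> and \<open>p_min\<close> comes with an explicit bound:
  handing the points of one optimal cell to another code point frees a code point, which can
  then be placed at a support point far from all the others, and the gain is bounded below
  uniformly over optimal codebooks (\<open>ex_reassignment_gain\<close>). The margin condition
  becomes usable once the neighbourhood of the cell boundaries is described by finitely many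
  inequalities (\<open>Union_eball_cell_boundary\<close>): a point that changes cells when
  \<open>c*\<close> is moved to a codebook \<open>c\<close> at distance \<open>\<Delta> \<le>
  R0\<close> lies in a tube of width proportional to \<open>\<Delta>\<close>, so the cell means
  of \<open>c\<close> are within \<open>\<Delta> / 7\<close> of \<open>c*\<close>
  (\<open>cell_mean_near_opt\<close>).

  The update with step \<open>s = 1 / (t + 1)\<close> therefore is the contraction \<open>v
  \<mapsto> (1 - s) v\<close> of the error \<open>v\<close>, perturbed by the displacement of
  the cell means, by the ratio of the two estimates of a cell mass, and by noise
  (\<open>perturbed_contraction\<close>). A vector-valued concentration inequality whose
  constants do not depend on the dimension (\<open>L2_set_mean_concentration\<close>), applied
  to a batch of the prescribed length, makes the last two small outside an event of probability
  \<open>6 / n\<^sup>3\<close>; outside that event the codebook stays in the ball of radius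
  \<open>R0\<close> around \<open>c*\<close>. The noise is centred even after restriction to the
  event that the estimated masses in the denominators are good (\<open>noise_centered\<close>):
  with split batches because numerator and denominator are independent, and for point masses
  because, once an observation is known to fall into a cell, its contribution to all masses is
  known. Hence the mean squared error satisfies \<open>a (t + 1) \<le> (1 - 3 / (2 (t + 1))) a t
  + V / (t + 1)\<^sup>2\<close>, which forces \<open>a t \<le> 2 V / t\<close>
  (\<open>averaged_recursion\<close>). With \<open>n / m\<close> batches of length
  \<open>m\<close> this is the claimed rate.
\<close>

section \<open>Euclidean norms of finite families\<close>

lemma power2_L2_set: "(L2_set f A)\<^sup>2 = (\<Sum>i\<in>A. (f i)\<^sup>2)"
  by (simp add: L2_set_def sum_nonneg)

lemma abs_sum_mult_le_L2_set: "\<bar>\<Sum>i\<in>A. f i * g i\<bar> \<le> L2_set f A * L2_set g A"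
proof -
  have "\<bar>\<Sum>i\<in>A. f i * g i\<bar> \<le> (\<Sum>i\<in>A. \<bar>f i * g i\<bar>)" by (rule sum_abs)
  also have "\<dots> \<le> L2_set f A * L2_set g A"
    using L2_set_mult_ineq[of f g A] by (simp add: abs_mult)
  finally show ?thesis .
qed

lemma L2_set_cmult: "L2_set (\<lambda>i. r * f i) A = \<bar>r\<bar> * L2_set f A"
  by (simp add: L2_set_def power_mult_distrib flip: sum_distrib_left) (simp add: real_sqrt_mult)

lemma L2_set_uminus: "L2_set (\<lambda>i. - f i) A = L2_set f A"
  by (simp add: L2_set_def)

lemma L2_set_Sigma: "finite A \<Longrightarrow> finite B \<Longrightarrow>
    L2_set (\<lambda>j. L2_set (f j) B) A = L2_set (\<lambda>(j, l). f j l) (A \<times> B)"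
  by (simp add: L2_set_def sum_nonneg sum.cartesian_product case_prod_beta)

lemma L2_set_diff_triangle: "L2_set (\<lambda>i. f i - g i) A \<le> L2_set f A + L2_set g A"
  using L2_set_triangle_ineq[of f "\<lambda>i. - g i" A] by (simp add: L2_set_uminus)

lemma L2_set_add_sq:
  "(L2_set (\<lambda>i. f i + g i) A)\<^sup>2 = (L2_set f A)\<^sup>2 + 2 * (\<Sum>i\<in>A. f i * g i) + (L2_set g A)\<^sup>2"
  by (simp add: power2_L2_set power2_sum sum.distrib sum_distrib_left mult.assoc algebra_simps)

lemma L2_set_abs: "L2_set (\<lambda>i. \<bar>f i\<bar>) A = L2_set f A"
  by (simp add: L2_set_def)

text \<open>
  Minkowski's inequality for integrals, from Cauchy--Schwarz: the squared norm of the vector of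
  integrals is the integral of its inner product with the integrand. Bounding vectors of
  integrals in one piece, and not coordinate by coordinate, keeps all later constants free of
  the dimension.
\<close>

lemma L2_set_integral_le:
  assumes L: "finite L" and f: "\<And>l. l \<in> L \<Longrightarrow> integrable N (f l)" and w: "integrable N w"
    and le: "AE u in N. L2_set (\<lambda>l. f l u) L \<le> w u"
  shows "L2_set (\<lambda>l. \<integral>u. f l u \<partial>N) L \<le> (\<integral>u. w u \<partial>N)"
proof -
  define q where "q = (\<lambda>l. \<integral>u. f l u \<partial>N)"
  have "(L2_set q L)\<^sup>2 = (\<Sum>l\<in>L. q l * (\<integral>u. f l u \<partial>N))"
    unfolding power2_L2_set by (simp add: q_def power2_eq_square)
  also have "\<dots> = (\<integral>u. (\<Sum>l\<in>L. q l * f l u) \<partial>N)"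
    using f by (subst Bochner_Integration.integral_sum) auto
  also have "\<dots> \<le> (\<integral>u. L2_set q L * w u \<partial>N)"
  proof (rule integral_mono_AE)
    show "AE u in N. (\<Sum>l\<in>L. q l * f l u) \<le> L2_set q L * w u"
      using le
    proof eventually_elim
      case (elim u)
      have "(\<Sum>l\<in>L. q l * f l u) \<le> L2_set q L * L2_set (\<lambda>l. f l u) L"
        using abs_sum_mult_le_L2_set[of q "\<lambda>l. f l u" L] by simp
      also have "\<dots> \<le> L2_set q L * w u" using elim by (intro mult_left_mono) auto
      finally show ?case .
    qed
  qed (use f w in auto)
  also have "\<dots> = L2_set q L * (\<integral>u. w u \<partial>N)" by simp
  finally have "L2_set q L * L2_set q L \<le> L2_set q L * (\<integral>u. w u \<partial>N)" by (simp add: power2_eq_square)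
  moreover have "0 \<le> (\<integral>u. w u \<partial>N)"
    by (rule integral_nonneg_AE) (use le in eventually_elim, meson L2_set_nonneg order_trans)
  ultimately have "L2_set q L \<le> (\<integral>u. w u \<partial>N)"
    by (cases "L2_set q L = 0") (auto simp: mult_le_cancel_left_pos less_le)
  then show ?thesis by (simp add: q_def)
qed

section \<open>Concentration of averages, free of the dimension\<close>

lemma cosh_eq_suminf_sq: "(\<lambda>n. (x\<^sup>2) ^ n / fact (2 * n)) sums cosh (x::real)"
proof -
  have "(\<lambda>n. if even n then x ^ n /\<^sub>R fact n else 0) sums cosh x"
    by (rule cosh_converges)
  then have "(\<lambda>n. (if even (2 * n) then x ^ (2 * n) /\<^sub>R fact (2 * n) else 0)) sums cosh x"
    by (subst sums_mono_reindex[where g = "\<lambda>n. 2 * n"])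
       (auto simp: strict_mono_def elim!: evenE)
  then show ?thesis
    by (simp add: divide_inverse mult.commute flip: power_mult)
qed

text \<open>
  The power series of \<open>cosh (sqrt y)\<close> in \<open>y\<close> has nonnegative
  coefficients, so this function is convex on the half line.
\<close>

lemma cosh_sq_convex:
  fixes w p q x :: real
  assumes w: "0 \<le> w" "w \<le> 1" and x: "x\<^sup>2 = w * p\<^sup>2 + (1 - w) * q\<^sup>2"
  shows "cosh x \<le> w * cosh p + (1 - w) * cosh q"
proof (rule sums_le[OF _ cosh_eq_suminf_sq[of x]])
  show "(\<lambda>n. w * ((p\<^sup>2) ^ n / fact (2 * n)) + (1 - w) * ((q\<^sup>2) ^ n / fact (2 * n)))
      sums (w * cosh p + (1 - w) * cosh q)"
    by (intro sums_add sums_mult cosh_eq_suminf_sq)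
  fix n
  have "convex_on {0..} (\<lambda>y::real. y ^ n)"
    by (cases "even n") (auto intro: convex_power_odd convex_on_subset[OF convex_power_even])
  from convex_onD[OF this, of w "q\<^sup>2" "p\<^sup>2"] w
  have "(x\<^sup>2) ^ n \<le> w * (p\<^sup>2) ^ n + (1 - w) * (q\<^sup>2) ^ n"
    unfolding x by (simp add: algebra_simps)
  then show "(x\<^sup>2) ^ n / fact (2 * n) \<le> w * ((p\<^sup>2) ^ n / fact (2 * n)) + (1 - w) * ((q\<^sup>2) ^ n / fact (2 * n))"
    by (simp add: divide_right_mono flip: add_divide_distrib)
qed

lemma exp_minus_le_exp_sq:
  fixes b :: real assumes "0 \<le> b" shows "exp b - b \<le> exp (b\<^sup>2)"
proof (cases "b \<le> 1")
  case True
  have "exp b \<le> 1 + b + b\<^sup>2" using True assms by (rule exp_bound[rotated])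
  moreover have "1 + b\<^sup>2 \<le> exp (b\<^sup>2)" by (rule exp_ge_add_one_self)
  ultimately show ?thesis by linarith
next
  case False
  then have "b \<le> b\<^sup>2" by (simp add: power2_eq_square)
  then show ?thesis using assms by (smt (verit) exp_le_cancel_iff)
qed

lemma sinh_ge_self: "0 \<le> (b::real) \<Longrightarrow> b \<le> sinh b"
proof -
  assume b: "0 \<le> b"
  have "(\<lambda>x. sinh x - x) 0 \<le> (\<lambda>x. sinh x - x) b"
  proof (rule DERIV_nonneg_imp_nondecreasing[OF b])
    fix x :: real
    show "\<exists>y. ((\<lambda>x. sinh x - x) has_real_derivative y) (at x) \<and> 0 \<le> y"
      by (intro exI[of _ "cosh x - 1"] conjI) (auto intro!: derivative_eq_intros cosh_real_ge_1)
  qed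
  then show ?thesis by simp
qed

text \<open>
  With \<open>a = |s|\<close> and \<open>b = |x|\<close>, the square \<open>|s +
  x|\<^sup>2\<close> is affine in the cosine of the angle between \<open>s\<close> and
  \<open>x\<close>, and convexity of \<open>cosh (sqrt y)\<close> interpolates between the
  values \<open>cosh (a + b)\<close> and \<open>cosh (a - b)\<close> at the cosines
  \<open>1\<close> and \<open>-1\<close>. The summand that is left besides \<open>cosh a * exp
  (\<beta>\<^sup>2)\<close> is linear in \<open>x\<close>, so it vanishes in the mean when
  \<open>x\<close> is centred.
\<close>

lemma cosh_L2_set_add_le:
  assumes "L2_set x L \<le> \<beta>"
  shows "cosh (L2_set (\<lambda>l. s l + x l) L) \<le>
     cosh (L2_set s L) * exp (\<beta>\<^sup>2) + sinh (L2_set s L) / L2_set s L * (\<Sum>l\<in>L. s l * x l)"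
proof -
  define a where "a = L2_set s L"
  define b where "b = L2_set x L"
  define i where "i = (\<Sum>l\<in>L. s l * x l)"
  have a0: "0 \<le> a" and b0: "0 \<le> b" by (auto simp: a_def b_def)
  have ib: "\<bar>i\<bar> \<le> a * b"
    unfolding i_def a_def b_def by (rule abs_sum_mult_le_L2_set)
  have n2: "(L2_set (\<lambda>l. s l + x l) L)\<^sup>2 = a\<^sup>2 + 2 * i + b\<^sup>2"
    by (simp add: L2_set_add_sq a_def b_def i_def)
  have *: "cosh (L2_set (\<lambda>l. s l + x l) L) \<le> cosh a * cosh b + i * (sinh a / a) * (sinh b / b)"
  proof (cases "a = 0 \<or> b = 0")
    case True
    then have "i = 0" using ib by auto
    then have "(L2_set (\<lambda>l. s l + x l) L)\<^sup>2 = (a + b)\<^sup>2"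
      unfolding n2 using True by auto
    then have "L2_set (\<lambda>l. s l + x l) L = a + b"
      using a0 b0 by (subst (asm) power2_eq_iff_nonneg) auto
    then show ?thesis using True \<open>i = 0\<close> by auto
  next
    case False
    then have ab: "0 < a" "0 < b" using a0 b0 by auto
    \<comment> \<open>The cosine of the angle between \<open>s\<close> and
      \<open>x\<close>.\<close>
    define \<theta> where "\<theta> = i / (a * b)"
    have i: "i = \<theta> * (a * b)" using ab by (simp add: \<theta>_def)
    have th: "-1 \<le> \<theta>" "\<theta> \<le> 1"
      using ib ab by (auto simp: \<theta>_def divide_simps abs_le_iff)
    have "cosh (L2_set (\<lambda>l. s l + x l) L) \<le>
        (1 + \<theta>) / 2 * cosh (a + b) + (1 - (1 + \<theta>) / 2) * cosh (a - b)"
      using th n2 unfolding i by (intro cosh_sq_convex) (auto simp: field_simps power2_eq_square)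
    also have "\<dots> = cosh a * cosh b + \<theta> * (sinh a * sinh b)"
      by (simp add: cosh_add cosh_diff field_simps)
    also have "\<theta> * (sinh a * sinh b) = i * (sinh a / a) * (sinh b / b)"
      using ab by (simp add: i)
    finally show ?thesis .
  qed
  have "i * (sinh a / a) * (sinh b / b) \<le> sinh a / a * i + sinh a * (sinh b - b)"
  proof (cases "a = 0 \<or> b = 0")
    case True
    then have "i = 0" using ib by auto
    then show ?thesis using True by auto
  next
    case False
    then have ab: "0 < a" "0 < b" using a0 b0 by auto
    have "0 \<le> sinh b / b - 1" using sinh_ge_self[OF b0] ab by simp
    then have "(sinh a / a) * (sinh b / b - 1) * i \<le> (sinh a / a) * (sinh b / b - 1) * (a * b)"
      using ib ab by (intro mult_left_mono) auto
    also have "\<dots> = sinh a * (sinh b - b)" using ab by (simp add: field_simps)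
    finally show ?thesis by (simp add: algebra_simps)
  qed
  also have "sinh a * (sinh b - b) \<le> cosh a * (sinh b - b)"
    using sinh_ge_self[OF b0] by (intro mult_right_mono less_imp_le[OF sinh_less_cosh_real]) auto
  finally have "cosh (L2_set (\<lambda>l. s l + x l) L) \<le> cosh a * (cosh b + sinh b - b) + sinh a / a * i"
    using * by (simp add: algebra_simps)
  also have "cosh b + sinh b - b = exp b - b" by (simp add: cosh_plus_sinh)
  also have "\<dots> \<le> exp (\<beta>\<^sup>2)"
  proof -
    have "b\<^sup>2 \<le> \<beta>\<^sup>2" using assms b0 by (intro power_mono) (auto simp: b_def)
    then show ?thesis using exp_minus_le_exp_sq[OF b0] by (smt (verit) exp_le_cancel_iff)
  qed
  finally show ?thesis by (simp add: a_def i_def)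
qed

lemma nn_integral_cosh_L2_set_add_le:
  assumes "prob_space \<nu>" and L: "finite L"
    and meas: "\<And>l. l \<in> L \<Longrightarrow> f l \<in> borel_measurable \<nu>"
    and bd: "\<And>x. x \<in> space \<nu> \<Longrightarrow> L2_set (\<lambda>l. f l x) L \<le> \<beta>"
    and mean: "\<And>l. l \<in> L \<Longrightarrow> (\<integral>x. f l x \<partial>\<nu>) = 0"
  shows "(\<integral>\<^sup>+ x. ennreal (cosh (L2_set (\<lambda>l. s l + f l x) L)) \<partial>\<nu>)
      \<le> ennreal (cosh (L2_set s L) * exp (\<beta>\<^sup>2))"
proof -
  interpret prob_space \<nu> by fact
  define r where "r = sinh (L2_set s L) / L2_set s L"
  define h where "h = (\<lambda>x. cosh (L2_set s L) * exp (\<beta>\<^sup>2) + r * (\<Sum>l\<in>L. s l * f l x))"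
  have int: "integrable \<nu> (f l)" if l: "l \<in> L" for l
  proof (rule integrable_const_bound[where B = \<beta>])
    show "AE x in \<nu>. norm (f l x) \<le> \<beta>"
    proof (rule AE_I2)
      fix x assume "x \<in> space \<nu>"
      have "\<bar>f l x\<bar> \<le> L2_set (\<lambda>l. \<bar>f l x\<bar>) L" using l L by (intro member_le_L2_set)
      also have "\<dots> = L2_set (\<lambda>l. f l x) L" by (simp add: L2_set_def)
      finally show "norm (f l x) \<le> \<beta>" using bd[OF \<open>x \<in> space \<nu>\<close>] by simp
    qed
  qed (use meas l in auto)
  have h: "cosh (L2_set (\<lambda>l. s l + f l x) L) \<le> h x" if "x \<in> space \<nu>" for x
    using cosh_L2_set_add_le[OF bd[OF that], of s] by (simp add: h_def r_def)
  have inth: "integrable \<nu> h" unfolding h_def using int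
    by (intro Bochner_Integration.integrable_add integrable_mult_right Bochner_Integration.integrable_sum) auto
  have "(\<integral>\<^sup>+ x. ennreal (cosh (L2_set (\<lambda>l. s l + f l x) L)) \<partial>\<nu>) \<le> (\<integral>\<^sup>+ x. ennreal (h x) \<partial>\<nu>)"
    using h by (intro nn_integral_mono ennreal_leI)
  also have "\<dots> = ennreal (\<integral>x. h x \<partial>\<nu>)"
    using h cosh_real_ge_1 by (intro nn_integral_eq_integral inth AE_I2) (meson order_trans zero_le_one)
  also have "(\<integral>x. h x \<partial>\<nu>) = cosh (L2_set s L) * exp (\<beta>\<^sup>2)"
    unfolding h_def using int mean by (simp add: prob_space)
  finally show ?thesis .
qed

text \<open>
  Each further independent summand multiplies the bound by \<open>exp (\<beta>\<^sup>2)\<close>;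
  the dimension of the vectors never enters.
\<close>

lemma nn_integral_cosh_sum_le:
  assumes \<nu>: "prob_space \<nu>" and L: "finite L"
    and meas: "\<And>l. l \<in> L \<Longrightarrow> f l \<in> borel_measurable \<nu>"
    and bd: "\<And>x. x \<in> space \<nu> \<Longrightarrow> L2_set (\<lambda>l. f l x) L \<le> \<beta>"
    and mean: "\<And>l. l \<in> L \<Longrightarrow> (\<integral>x. f l x \<partial>\<nu>) = 0"
    and S: "finite S"
  shows "(\<integral>\<^sup>+ y. ennreal (cosh (L2_set (\<lambda>l. \<Sum>i\<in>S. f l (y i)) L)) \<partial>Pi\<^sub>M S (\<lambda>_. \<nu>))
      \<le> ennreal (exp (\<beta>\<^sup>2 * real (card S)))"
  using S
proof induction
  case empty
  interpret P: prob_space "Pi\<^sub>M {} (\<lambda>_::'i. \<nu>)" by (rule prob_space_PiM) (rule \<nu>)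
  show ?case by (simp add: L2_set_0' P.emeasure_space_1)
next
  case (insert i S)
  interpret \<nu>: prob_space \<nu> by fact
  interpret product_sigma_finite "\<lambda>_. \<nu>" by standard
  note [measurable] = meas
  have m: "(\<lambda>y. ennreal (cosh (L2_set (\<lambda>l. \<Sum>i\<in>S'. f l (y i)) L))) \<in> borel_measurable (Pi\<^sub>M S' (\<lambda>_. \<nu>))" for S'
    unfolding L2_set_def cosh_def
    by (intro measurable_compose[OF _ measurable_ennreal]) measurable
  have "(\<integral>\<^sup>+ y. ennreal (cosh (L2_set (\<lambda>l. \<Sum>i\<in>insert i S. f l (y i)) L)) \<partial>Pi\<^sub>M (insert i S) (\<lambda>_. \<nu>)) =
     (\<integral>\<^sup>+ x. (\<integral>\<^sup>+ y. ennreal (cosh (L2_set (\<lambda>l. \<Sum>j\<in>insert i S. f l ((x(i := y)) j)) L)) \<partial>\<nu>) \<partial>Pi\<^sub>M S (\<lambda>_. \<nu>))"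
    by (rule product_nn_integral_insert[OF insert(1,2) m])
  also have "\<dots> = (\<integral>\<^sup>+ x. (\<integral>\<^sup>+ y. ennreal (cosh (L2_set (\<lambda>l. (\<Sum>j\<in>S. f l (x j)) + f l y) L)) \<partial>\<nu>) \<partial>Pi\<^sub>M S (\<lambda>_. \<nu>))"
  proof (intro nn_integral_cong)
    fix x y
    have "(\<Sum>j\<in>S. f l ((x(i := y)) j)) = (\<Sum>j\<in>S. f l (x j))" for l
      using insert by (intro sum.cong) auto
    then show "ennreal (cosh (L2_set (\<lambda>l. \<Sum>j\<in>insert i S. f l ((x(i := y)) j)) L)) =
      ennreal (cosh (L2_set (\<lambda>l. (\<Sum>j\<in>S. f l (x j)) + f l y) L))"
      using insert by (simp add: add.commute)
  qed
  also have "\<dots> \<le> (\<integral>\<^sup>+ x. ennreal (cosh (L2_set (\<lambda>l. (\<Sum>j\<in>S. f l (x j))) L)) * ennreal (exp (\<beta>\<^sup>2)) \<partial>Pi\<^sub>M S (\<lambda>_. \<nu>))"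
    using nn_integral_cosh_L2_set_add_le[OF \<nu> L meas bd mean]
    by (intro nn_integral_mono) (simp add: ennreal_mult')
  also have "\<dots> = (\<integral>\<^sup>+ x. ennreal (cosh (L2_set (\<lambda>l. (\<Sum>j\<in>S. f l (x j))) L)) \<partial>Pi\<^sub>M S (\<lambda>_. \<nu>)) * ennreal (exp (\<beta>\<^sup>2))"
    using m by (intro nn_integral_multc) auto
  also have "\<dots> \<le> ennreal (exp (\<beta>\<^sup>2 * real (card S))) * ennreal (exp (\<beta>\<^sup>2))"
    by (intro mult_right_mono insert.IH) auto
  also have "\<dots> = ennreal (exp (\<beta>\<^sup>2 * real (card (insert i S))))"
    using insert by (simp add: ennreal_mult'[symmetric] exp_add[symmetric] algebra_simps)
  finally show ?case .
qed

text \<open>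
  Chernoff's method with \<open>cosh\<close> of the norm in the role of the exponential moment.
\<close>

lemma L2_set_mean_concentration:
  assumes \<nu>: "prob_space \<nu>" and L: "finite L"
    and meas: "\<And>l. l \<in> L \<Longrightarrow> f l \<in> borel_measurable \<nu>"
    and bd: "\<And>x. x \<in> space \<nu> \<Longrightarrow> L2_set (\<lambda>l. f l x) L \<le> \<beta>"
    and mean: "\<And>l. l \<in> L \<Longrightarrow> (\<integral>x. f l x \<partial>\<nu>) = 0"
    and J: "finite J" and S: "S \<subseteq> J" "S \<noteq> {}" and \<epsilon>: "0 < \<epsilon>" and \<beta>: "0 < \<beta>"
  shows "measure (Pi\<^sub>M J (\<lambda>_. \<nu>))
      {y \<in> space (Pi\<^sub>M J (\<lambda>_. \<nu>)). \<epsilon> \<le> L2_set (\<lambda>l. (\<Sum>i\<in>S. f l (y i)) / real (card S)) L}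
    \<le> 2 * exp (- \<epsilon>\<^sup>2 * real (card S) / (4 * \<beta>\<^sup>2))"
proof -
  interpret \<nu>: prob_space \<nu> by fact
  interpret product_prob_space "\<lambda>_. \<nu>" J by standard
  define N where "N = real (card S)"
  have finS: "finite S" using S J finite_subset by blast
  have N: "0 < N" using S finS by (simp add: N_def card_gt_0_iff)
  \<comment> \<open>This scale minimises \<open>(\<tau> * \<beta>)\<^sup>2 * N - \<epsilon> * N *
    \<tau>\<close>.\<close>
  define \<tau> where "\<tau> = \<epsilon> / (2 * \<beta>\<^sup>2)"
  have lam: "0 < \<tau>" using \<epsilon> \<beta> by (simp add: \<tau>_def)
  note [measurable] = meas
  define Z where "Z = (\<lambda>y. L2_set (\<lambda>l. (\<Sum>i\<in>S. \<tau> * f l (y i))) L)"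
  have Zm[measurable]: "Z \<in> borel_measurable (Pi\<^sub>M S (\<lambda>_. \<nu>))"
    unfolding Z_def L2_set_def by measurable
  have rest[measurable]: "(\<lambda>y. restrict y S) \<in> Pi\<^sub>M J (\<lambda>_. \<nu>) \<rightarrow>\<^sub>M Pi\<^sub>M S (\<lambda>_. \<nu>)"
    by (rule measurable_restrict_subset[OF S(1)])
  have Zr: "Z (restrict y S) = Z y" for y unfolding Z_def by simp
  have distr: "distr (Pi\<^sub>M J (\<lambda>_. \<nu>)) (Pi\<^sub>M S (\<lambda>_. \<nu>)) (\<lambda>y. restrict y S) = Pi\<^sub>M S (\<lambda>_. \<nu>)"
    by (rule distr_PiM_restrict_finite[OF finS S(1)])
  have eq: "L2_set (\<lambda>l. (\<Sum>i\<in>S. f l (y i)) / N) L = Z y / (N * \<tau>)" for y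
  proof -
    have "Z y = L2_set (\<lambda>l. (N * \<tau>) * ((\<Sum>i\<in>S. f l (y i)) / N)) L"
      unfolding Z_def using N by (simp flip: sum_distrib_left)
    also have "\<dots> = N * \<tau> * L2_set (\<lambda>l. (\<Sum>i\<in>S. f l (y i)) / N) L"
      using N lam by (subst L2_set_cmult) simp
    finally show ?thesis using N lam by simp
  qed
  have "ennreal (measure (Pi\<^sub>M J (\<lambda>_. \<nu>)) {y \<in> space (Pi\<^sub>M J (\<lambda>_. \<nu>)). \<epsilon> \<le> L2_set (\<lambda>l. (\<Sum>i\<in>S. f l (y i)) / N) L})
      = emeasure (Pi\<^sub>M J (\<lambda>_. \<nu>)) {y \<in> space (Pi\<^sub>M J (\<lambda>_. \<nu>)). \<epsilon> \<le> L2_set (\<lambda>l. (\<Sum>i\<in>S. f l (y i)) / N) L}"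
    by (rule P.emeasure_eq_measure[symmetric])
  also have "\<dots> \<le> emeasure (Pi\<^sub>M J (\<lambda>_. \<nu>)) {y \<in> space (Pi\<^sub>M J (\<lambda>_. \<nu>)).
      1 \<le> ennreal (2 * exp (- (\<epsilon> * N * \<tau>))) * ennreal (cosh (Z (restrict y S)))}"
  proof (rule emeasure_mono)
    show "{y \<in> space (Pi\<^sub>M J (\<lambda>_. \<nu>)). 1 \<le> ennreal (2 * exp (- (\<epsilon> * N * \<tau>))) * ennreal (cosh (Z (restrict y S)))}
      \<in> sets (Pi\<^sub>M J (\<lambda>_. \<nu>))" unfolding cosh_def by measurable
    show "{y \<in> space (Pi\<^sub>M J (\<lambda>_. \<nu>)). \<epsilon> \<le> L2_set (\<lambda>l. (\<Sum>i\<in>S. f l (y i)) / N) L}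
      \<subseteq> {y \<in> space (Pi\<^sub>M J (\<lambda>_. \<nu>)). 1 \<le> ennreal (2 * exp (- (\<epsilon> * N * \<tau>))) * ennreal (cosh (Z (restrict y S)))}"
    proof safe
      fix y assume "\<epsilon> \<le> L2_set (\<lambda>l. (\<Sum>i\<in>S. f l (y i)) / N) L"
      then have "\<epsilon> * N * \<tau> \<le> Z y" unfolding eq using N lam by (simp add: field_simps)
      then have "exp (\<epsilon> * N * \<tau>) \<le> 2 * cosh (Z y)"
        using exp_gt_zero[of "- Z y"] by (simp add: cosh_def) (smt (verit) exp_le_cancel_iff exp_gt_zero)
      then have "1 \<le> 2 * exp (- (\<epsilon> * N * \<tau>)) * cosh (Z y)"
        by (simp add: exp_minus field_simps)
      then show "1 \<le> ennreal (2 * exp (- (\<epsilon> * N * \<tau>))) * ennreal (cosh (Z (restrict y S)))"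
        unfolding Zr by (simp add: ennreal_mult'[symmetric])
    qed
  qed
  also have "\<dots> \<le> ennreal (2 * exp (- (\<epsilon> * N * \<tau>))) * (\<integral>\<^sup>+ y. ennreal (cosh (Z (restrict y S))) \<partial>Pi\<^sub>M J (\<lambda>_. \<nu>))"
    by (rule order_trans[OF nn_integral_Markov_inequality[where A = "space (Pi\<^sub>M J (\<lambda>_. \<nu>))"]])
       (auto simp: cosh_def intro!: mult_left_mono nn_integral_mono split: split_indicator)
  also have "(\<integral>\<^sup>+ y. ennreal (cosh (Z (restrict y S))) \<partial>Pi\<^sub>M J (\<lambda>_. \<nu>)) =
      (\<integral>\<^sup>+ y. ennreal (cosh (Z y)) \<partial>distr (Pi\<^sub>M J (\<lambda>_. \<nu>)) (Pi\<^sub>M S (\<lambda>_. \<nu>)) (\<lambda>y. restrict y S))"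
    by (subst nn_integral_distr) (auto simp: cosh_def)
  also have "\<dots> \<le> ennreal (exp ((\<tau> * \<beta>)\<^sup>2 * N))"
    unfolding distr Z_def N_def
  proof (rule nn_integral_cosh_sum_le[OF \<nu> L _ _ _ finS])
    fix x assume "x \<in> space \<nu>"
    then show "L2_set (\<lambda>l. \<tau> * f l x) L \<le> \<tau> * \<beta>"
      using bd lam by (simp add: L2_set_cmult)
  qed (use mean in auto)
  also have "ennreal (2 * exp (- (\<epsilon> * N * \<tau>))) * ennreal (exp ((\<tau> * \<beta>)\<^sup>2 * N)) =
      ennreal (2 * exp ((\<tau> * \<beta>)\<^sup>2 * N - \<epsilon> * N * \<tau>))"
    by (simp add: ennreal_mult'[symmetric] exp_diff exp_minus field_simps)
  also have "(\<tau> * \<beta>)\<^sup>2 * N - \<epsilon> * N * \<tau> = - \<epsilon>\<^sup>2 * N / (4 * \<beta>\<^sup>2)"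
    using \<beta> by (simp add: \<tau>_def power2_eq_square field_simps)
  finally show ?thesis by (simp add: N_def mult_left_mono)
qed

section \<open>Points, projection onto the ball, and cells\<close>

lemma edist_nonneg [simp]: "0 \<le> edist d x y"
  by (simp add: edist_def)

lemma edist_commute: "edist d x y = edist d y x"
  unfolding edist_def L2_set_def by (simp add: power2_commute)

lemma edist_triangle: "edist d x z \<le> edist d x y + edist d y z"
  using L2_set_triangle_ineq[of "\<lambda>i. x i - y i" "\<lambda>i. y i - z i" "{1..d}"] by (simp add: edist_def)

lemma edist_refl [simp]: "edist d x x = 0"
  by (simp add: edist_def L2_set_0')

lemma space_euc: "space (euc d) = {1..d} \<rightarrow>\<^sub>E UNIV"
  by (simp add: euc_def space_PiM)

lemma space_euc_nonempty: "origin d \<in> space (euc d)"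
  by (auto simp: space_euc origin_def)

lemma edist_eq_0_iff: "x \<in> space (euc d) \<Longrightarrow> y \<in> space (euc d) \<Longrightarrow> edist d x y = 0 \<longleftrightarrow> x = y"
  using PiE_ext[of x "{1..d}" "\<lambda>_. UNIV" y] by (auto simp: edist_def L2_set_eq_0_iff space_euc)

lemma edist_origin: "edist d x (origin d) = L2_set x {1..d}"
  unfolding edist_def by (rule L2_set_cong) (auto simp: origin_def)

lemma eball_origin: "x \<in> eball d (origin d) R \<longleftrightarrow> x \<in> space (euc d) \<and> L2_set x {1..d} \<le> R"
  by (simp add: eball_def edist_commute[of d "origin d"] edist_origin)

lemma edist_le_of_ball: "L2_set x {1..d} \<le> r \<Longrightarrow> L2_set y {1..d} \<le> r' \<Longrightarrow> edist d x y \<le> r + r'"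
  unfolding edist_def using L2_set_diff_triangle[of x y "{1..d}"] by linarith

lemma edist_sq_diff_le:
  "(edist d x b)\<^sup>2 - (edist d x a)\<^sup>2 \<le> edist d a b * (edist d x a + edist d x b)"
proof -
  have "(edist d x b)\<^sup>2 - (edist d x a)\<^sup>2 = (edist d x b - edist d x a) * (edist d x a + edist d x b)"
    by (simp add: power2_eq_square algebra_simps)
  also have "\<dots> \<le> edist d a b * (edist d x a + edist d x b)"
    using edist_triangle[of d x b a] by (intro mult_right_mono) auto
  finally show ?thesis .
qed

text \<open>
  At the projection of an outer point the angle towards any point of the ball is not acute. This
  single inequality yields that the radial point is a nearest one, that it is the only one, and
  that projecting does not increase the distance to points of the ball.
\<close>

lemma eproj_eball_obtuse:
  assumes x: "x \<in> space (euc d)" and R: "0 \<le> R" "R < L2_set x {1..d}" and z: "z \<in> eball d (origin d) R"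
  defines "y \<equiv> (\<lambda>i\<in>{1..d}. R / L2_set x {1..d} * x i)"
  shows "(edist d x z)\<^sup>2 \<ge> (edist d x y)\<^sup>2 + (edist d y z)\<^sup>2"
proof -
  define N where "N = L2_set x {1..d}"
  define r where "r = R / N"
  have N: "0 < N" using R by (simp add: N_def)
  have r: "0 \<le> r" "r \<le> 1" using R N by (auto simp: r_def N_def)
  have xz: "(edist d x z)\<^sup>2 = (L2_set (\<lambda>i. (1 - r) * x i + (r * x i - z i)) {1..d})\<^sup>2"
    unfolding edist_def by (simp add: algebra_simps)
  have xy: "edist d x y = L2_set (\<lambda>i. (1 - r) * x i) {1..d}"
    unfolding edist_def y_def by (rule L2_set_cong) (auto simp: r_def N_def algebra_simps)
  have yz: "edist d y z = L2_set (\<lambda>i. r * x i - z i) {1..d}"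
    unfolding edist_def y_def by (rule L2_set_cong) (auto simp: r_def N_def algebra_simps)
  have "(\<Sum>i\<in>{1..d}. x i * z i) \<le> N * R"
  proof -
    have "(\<Sum>i\<in>{1..d}. x i * z i) \<le> N * L2_set z {1..d}"
      using abs_sum_mult_le_L2_set[of x z "{1..d}"] by (simp add: N_def)
    also have "\<dots> \<le> N * R" using z N by (intro mult_left_mono) (auto simp: eball_origin)
    finally show ?thesis .
  qed
  moreover have "(\<Sum>i\<in>{1..d}. (1 - r) * x i * (r * x i - z i)) =
      (1 - r) * (r * N\<^sup>2 - (\<Sum>i\<in>{1..d}. x i * z i))"
    unfolding N_def power2_L2_set
    by (simp add: sum_distrib_left sum_subtractf[symmetric] power2_eq_square algebra_simps)
  moreover have "r * N\<^sup>2 = N * R" using N by (simp add: r_def power2_eq_square)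
  ultimately have "0 \<le> (\<Sum>i\<in>{1..d}. (1 - r) * x i * (r * x i - z i))"
    using r by simp
  then show ?thesis unfolding xz xy yz L2_set_add_sq by simp
qed

lemma le_of_sum_sq_le:
  fixes a b x :: real
  assumes "a\<^sup>2 + b\<^sup>2 \<le> x\<^sup>2" "0 \<le> x"
  shows "a \<le> x" "b \<le> x"
proof -
  have "a\<^sup>2 \<le> x\<^sup>2" "b\<^sup>2 \<le> x\<^sup>2" using assms zero_le_power2[of a] zero_le_power2[of b] by linarith+
  then show "a \<le> x" "b \<le> x" using assms(2) power2_le_imp_le by blast+
qed

text \<open>
  The projection is defined by choice; because the nearest point is unique it has this explicit
  form, from which measurability can be read off.
\<close>

lemma eproj_eball:
  assumes x: "x \<in> space (euc d)" and R: "0 \<le> R"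
  shows "eproj d (eball d (origin d) R) x =
    (if L2_set x {1..d} \<le> R then x else (\<lambda>i\<in>{1..d}. R / L2_set x {1..d} * x i))" (is "_ = ?y")
proof -
  have N: "0 < L2_set x {1..d}" if "\<not> L2_set x {1..d} \<le> R" using that R by auto
  have y: "?y \<in> eball d (origin d) R"
  proof (cases "L2_set x {1..d} \<le> R")
    case False
    have "L2_set (\<lambda>i\<in>{1..d}. R / L2_set x {1..d} * x i) {1..d} = L2_set (\<lambda>i. R / L2_set x {1..d} * x i) {1..d}"
      by (rule L2_set_cong) auto
    also have "\<dots> = R" using N[OF False] R by (subst L2_set_cmult) simp
    finally show ?thesis using False by (auto simp: eball_origin space_euc)
  qed (use x in \<open>auto simp: eball_origin\<close>)
  have le: "(edist d x z)\<^sup>2 \<ge> (edist d x ?y)\<^sup>2 + (edist d ?y z)\<^sup>2" if "z \<in> eball d (origin d) R" for z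
    using eproj_eball_obtuse[OF x R _ that] by auto
  have min: "edist d x ?y \<le> edist d x z" if "z \<in> eball d (origin d) R" for z
    by (rule le_of_sum_sq_le(1)[OF le[OF that] edist_nonneg])
  show ?thesis unfolding eproj_def
  proof (rule some_equality)
    show "?y \<in> eball d (origin d) R \<and> (\<forall>z\<in>eball d (origin d) R. edist d x ?y \<le> edist d x z)"
      using y min by auto
    fix z assume z: "z \<in> eball d (origin d) R \<and> (\<forall>z'\<in>eball d (origin d) R. edist d x z \<le> edist d x z')"
    then have "edist d x z \<le> edist d x ?y" using y by blast
    then have "(edist d x z)\<^sup>2 \<le> (edist d x ?y)\<^sup>2" by (intro power_mono) auto
    with le[of z] z have "(edist d ?y z)\<^sup>2 \<le> 0" by linarith
    then have "edist d ?y z = 0" by simp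
    then show "z = ?y" using y z by (subst (asm) edist_eq_0_iff) (auto simp: eball_def)
  qed
qed

lemma eproj_eball_in:
  assumes x: "x \<in> space (euc d)" and R: "0 \<le> R"
  shows "eproj d (eball d (origin d) R) x \<in> eball d (origin d) R"
proof (cases "L2_set x {1..d} \<le> R")
  case False
  have "L2_set (\<lambda>i\<in>{1..d}. R / L2_set x {1..d} * x i) {1..d} = L2_set (\<lambda>i. R / L2_set x {1..d} * x i) {1..d}"
    by (rule L2_set_cong) auto
  also have "\<dots> = R" using False R by (subst L2_set_cmult) (auto simp del: L2_set_nonneg)
  finally show ?thesis using False unfolding eproj_eball[OF assms] by (auto simp: eball_origin space_euc)
qed (use x in \<open>auto simp: eball_origin eproj_eball[OF assms]\<close>)

lemma edist_eproj_eball_le: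
  assumes x: "x \<in> space (euc d)" and R: "0 \<le> R" and z: "z \<in> eball d (origin d) R"
  shows "edist d (eproj d (eball d (origin d) R) x) z \<le> edist d x z"
proof (cases "L2_set x {1..d} \<le> R")
  case False
  then show ?thesis
    using le_of_sum_sq_le(2)[OF eproj_eball_obtuse[OF x R _ z] edist_nonneg]
    by (simp add: eproj_eball[OF x R])
qed (simp add: eproj_eball[OF x R])

lemma measurable_euc_component [measurable (raw)]:
  assumes "f \<in> N \<rightarrow>\<^sub>M euc d" "i \<in> {1..d}"
  shows "(\<lambda>w. f w i) \<in> borel_measurable N"
  using measurable_compose[OF assms(1)[unfolded euc_def] measurable_component_singleton[OF assms(2)]] by simp

lemma measurable_eucI:
  assumes "\<And>w. w \<in> space N \<Longrightarrow> f w \<in> space (euc d)" "\<And>i. i \<in> {1..d} \<Longrightarrow> (\<lambda>w. f w i) \<in> borel_measurable N"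
  shows "f \<in> N \<rightarrow>\<^sub>M euc d"
  unfolding euc_def
  by (rule measurable_PiM_single') (use assms in \<open>auto simp: space_euc Pi_iff PiE_def\<close>)

lemma borel_measurable_edist [measurable (raw)]:
  assumes [measurable]: "f \<in> N \<rightarrow>\<^sub>M euc d" "g \<in> N \<rightarrow>\<^sub>M euc d"
  shows "(\<lambda>w. edist d (f w) (g w)) \<in> borel_measurable N"
  unfolding edist_def L2_set_def by measurable

lemma measurable_eproj_eball:
  assumes "0 \<le> R"
  shows "eproj d (eball d (origin d) R) \<in> euc d \<rightarrow>\<^sub>M euc d"
proof (rule measurable_eucI)
  fix x assume "x \<in> space (euc d)"
  from eproj_eball_in[OF this assms] show "eproj d (eball d (origin d) R) x \<in> space (euc d)"
    by (simp add: eball_def)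
next
  fix i assume i: "i \<in> {1..d}"
  have "(\<lambda>x. if L2_set x {1..d} \<le> R then x i else R / L2_set x {1..d} * x i) \<in> borel_measurable (euc d)"
    unfolding L2_set_def using i by measurable
  then show "(\<lambda>x. eproj d (eball d (origin d) R) x i) \<in> borel_measurable (euc d)"
    by (rule measurable_cong[THEN iffD1, rotated]) (use i in \<open>simp add: eproj_eball[OF _ assms]\<close>)
qed

lemma sets_eball: "x \<in> space (euc d) \<Longrightarrow> eball d x r \<in> sets (euc d)"
  unfolding eball_def by measurable

abbreviation code_space :: "nat \<Rightarrow> nat \<Rightarrow> codebook measure" where
  "code_space d k \<equiv> Pi\<^sub>M {1..k} (\<lambda>_. euc d)"

lemma space_code_space: "space (code_space d k) = codebooks d k"
  by (simp add: space_PiM codebooks_def)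

lemma measurable_pred_cell [measurable (raw)]:
  assumes [measurable]: "f \<in> N \<rightarrow>\<^sub>M code_space d k" "g \<in> N \<rightarrow>\<^sub>M euc d" and j: "j \<in> {1..k}"
  shows "Measurable.pred N (\<lambda>w. g w \<in> cell d k (f w) j)"
proof -
  have "Measurable.pred N (\<lambda>w. (\<forall>i\<in>{1..k}. i < j \<longrightarrow> edist d (g w) (f w j) < edist d (g w) (f w i)) \<and>
      (\<forall>i\<in>{1..k}. j < i \<longrightarrow> edist d (g w) (f w j) \<le> edist d (g w) (f w i)))"
    using j by measurable
  then show ?thesis
    by (rule measurable_cong[THEN iffD1, rotated])
       (use measurable_space[OF assms(2)] in \<open>simp add: cell_def\<close>)
qed

lemma sets_cell:
  assumes "c \<in> codebooks d k" "j \<in> {1..k}"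
  shows "cell d k c j \<in> sets (euc d)"
proof -
  have "Measurable.pred (euc d) (\<lambda>x. x \<in> cell d k c j)"
    by (rule measurable_pred_cell) (use assms in \<open>simp_all add: space_code_space flip: One_nat_def\<close>)
  then have "{x \<in> space (euc d). x \<in> cell d k c j} \<in> sets (euc d)"
    by (simp add: pred_def)
  also have "{x \<in> space (euc d). x \<in> cell d k c j} = cell d k c j" by (auto simp: cell_def)
  finally show ?thesis .
qed

lemma cellD:
  assumes "x \<in> cell d k c j" "i \<in> {1..k}"
  shows "i < j \<Longrightarrow> edist d x (c j) < edist d x (c i)" "j < i \<Longrightarrow> edist d x (c j) \<le> edist d x (c i)"
  using assms unfolding cell_def by blast+

lemma cell_dist_le: "x \<in> cell d k c j \<Longrightarrow> i \<in> {1..k} \<Longrightarrow> edist d x (c j) \<le> edist d x (c i)"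
  using cellD[of x d k c j i] by (cases i j rule: linorder_cases) auto

lemma cell_unique:
  assumes "x \<in> cell d k c i" "x \<in> cell d k c j" "i \<in> {1..k}" "j \<in> {1..k}"
  shows "i = j"
proof (cases i j rule: linorder_cases)
  case less
  then show ?thesis using cellD(1)[OF assms(2,3)] cell_dist_le[OF assms(1,4)] by linarith
next
  case greater
  then show ?thesis using cellD(1)[OF assms(1,4)] cell_dist_le[OF assms(2,3)] by linarith
qed

lemma cell_exists:
  assumes "x \<in> space (euc d)" "1 \<le> k"
  obtains j where "j \<in> {1..k}" "x \<in> cell d k c j"
proof -
  define m where "m = Min ((\<lambda>j. edist d x (c j)) ` {1..k})"
  have ne: "(\<lambda>j. edist d x (c j)) ` {1..k} \<noteq> {}" using assms by auto
  have "m \<in> (\<lambda>j. edist d x (c j)) ` {1..k}" unfolding m_def by (rule Min_in) (use ne in auto)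
  then have ex: "\<exists>j. j \<in> {1..k} \<and> edist d x (c j) = m" by auto
  define j where "j = (LEAST j. j \<in> {1..k} \<and> edist d x (c j) = m)"
  have j: "j \<in> {1..k}" "edist d x (c j) = m" using LeastI_ex[OF ex] by (auto simp: j_def)
  have le: "m \<le> edist d x (c i)" if "i \<in> {1..k}" for i unfolding m_def using that by simp
  have "m \<noteq> edist d x (c i)" if "i \<in> {1..k}" "i < j" for i
    using not_less_Least[of i "\<lambda>j. j \<in> {1..k} \<and> edist d x (c j) = m"] that by (auto simp: j_def)
  then have "x \<in> cell d k c j" unfolding cell_def using assms(1) j(2) le
    by (auto simp: less_le)
  with j that show ?thesis by blast
qed

lemma Min_sq_cell:
  assumes "x \<in> cell d k c j" "j \<in> {1..k}"
  shows "(MIN i\<in>{1..k}. (edist d x (c i))\<^sup>2) = (edist d x (c j))\<^sup>2"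
proof (rule Min_eqI)
  show "(edist d x (c j))\<^sup>2 \<in> (\<lambda>i. (edist d x (c i))\<^sup>2) ` {1..k}" using assms by auto
qed (use cell_dist_le[OF assms(1)] in \<open>auto intro!: power_mono\<close>)

lemma Min_sq_le: fixes k :: nat shows "j \<in> {1..k} \<Longrightarrow> (MIN i\<in>{1..k}. (edist d x (c i))\<^sup>2) \<le> (edist d x (c j))\<^sup>2"
  by (rule Min_le) auto

section \<open>Mixtures and measurable families of measures on a ball\<close>

lemma ball_measuresD:
  assumes "x \<in> space (ball_measures d R M)"
  shows "sets x = sets (euc d)" "space x = space (euc d)" "finite_measure x"
    "AE u in x. u \<in> eball d (origin d) R" "emeasure x (space x) \<le> ennreal M"
    "0 \<le> M \<Longrightarrow> measure x A \<le> M"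
proof -
  show s: "sets x = sets (euc d)" using assms by (simp add: space_ball_measures)
  then show sp: "space x = space (euc d)" by (rule sets_eq_imp_space_eq)
  show le: "emeasure x (space x) \<le> ennreal M" using assms by (simp add: space_ball_measures)
  show fin: "finite_measure x" using le by (intro finite_measureI) (auto simp: top_unique)
  show "AE u in x. u \<in> eball d (origin d) R"
  proof (rule AE_I[where N = "space x - eball d (origin d) R"])
    show "emeasure x (space x - eball d (origin d) R) = 0" using assms by (simp add: space_ball_measures)
    show "space x - eball d (origin d) R \<in> sets x"
      unfolding s sp using sets_eball[OF space_euc_nonempty] by auto
  qed auto
  show "measure x A \<le> M" if "0 \<le> M"
  proof -
    interpret finite_measure x by fact
    have "measure x A \<le> measure x (space x)" by (rule bounded_measure)
    also have "\<dots> \<le> M" using le that by (simp add: emeasure_eq_measure)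
    finally show ?thesis .
  qed
qed

lemma integrable_ball_measures:
  fixes f :: "pt \<Rightarrow> real"
  assumes x: "x \<in> space (ball_measures d R M)" and [measurable]: "f \<in> borel_measurable (euc d)"
    and f: "\<And>u. u \<in> eball d (origin d) R \<Longrightarrow> \<bar>f u\<bar> \<le> b"
  shows "integrable x f"
proof -
  note x = ball_measuresD[OF x]
  interpret finite_measure x by fact
  show ?thesis
    by (rule integrable_const_bound[where B = b])
       (use x(4) f in \<open>auto simp: measurable_cong_sets[OF x(1) refl]\<close>)
qed

text \<open>
  The mean measure and the batch means are both mixtures and are specified by their values on
  sets only. Monotone approximation by simple functions carries the mixture formula over to
  integrals.
\<close>

lemma nn_integral_mixture:
  assumes N: "sets N = sets E" "\<And>A. A \<in> sets E \<Longrightarrow> emeasure N A = (\<integral>\<^sup>+ w. emeasure (K w) A \<partial>Q)"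
    and K: "\<And>w. w \<in> space Q \<Longrightarrow> sets (K w) = sets E"
    and m: "\<And>A. A \<in> sets E \<Longrightarrow> (\<lambda>w. emeasure (K w) A) \<in> borel_measurable Q"
    and f: "f \<in> borel_measurable E"
  shows "(\<lambda>w. \<integral>\<^sup>+ u. f u \<partial>K w) \<in> borel_measurable Q \<and>
    (\<integral>\<^sup>+ u. f u \<partial>N) = (\<integral>\<^sup>+ w. (\<integral>\<^sup>+ u. f u \<partial>K w) \<partial>Q)"
  using f
proof (induction rule: borel_measurable_induct)
  case (cong f g)
  have "(\<integral>\<^sup>+ u. f u \<partial>K w) = (\<integral>\<^sup>+ u. g u \<partial>K w)" if "w \<in> space Q" for w
    using cong(3) sets_eq_imp_space_eq[OF K[OF that]] by (intro nn_integral_cong) auto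
  moreover have "(\<integral>\<^sup>+ u. f u \<partial>N) = (\<integral>\<^sup>+ u. g u \<partial>N)"
    using cong(3) sets_eq_imp_space_eq[OF N(1)] by (intro nn_integral_cong) auto
  ultimately show ?case using cong(4) by (simp cong: measurable_cong nn_integral_cong)
next
  case (set A)
  then have "(\<integral>\<^sup>+ u. indicator A u \<partial>K w) = emeasure (K w) A" if "w \<in> space Q" for w
    using K[OF that] by simp
  moreover have "(\<integral>\<^sup>+ u. indicator A u \<partial>N) = emeasure N A" using set N by simp
  ultimately show ?case using m[OF set] N(2)[OF set] by (simp cong: measurable_cong nn_integral_cong)
next
  case (mult f c)
  have "(\<integral>\<^sup>+ u. c * f u \<partial>K w) = c * (\<integral>\<^sup>+ u. f u \<partial>K w)" if "w \<in> space Q" for w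
    using mult(2) by (intro nn_integral_cmult) (simp add: measurable_cong_sets[OF K[OF that] refl])
  moreover have "(\<integral>\<^sup>+ u. c * f u \<partial>N) = c * (\<integral>\<^sup>+ u. f u \<partial>N)"
    using mult(2) by (intro nn_integral_cmult) (simp add: measurable_cong_sets[OF N(1) refl])
  ultimately show ?case using mult(4) by (simp add: nn_integral_cmult borel_measurable_times_ennreal cong: measurable_cong nn_integral_cong)
next
  case (add g f)
  have "(\<integral>\<^sup>+ u. f u + g u \<partial>K w) = (\<integral>\<^sup>+ u. f u \<partial>K w) + (\<integral>\<^sup>+ u. g u \<partial>K w)" if "w \<in> space Q" for w
    using add.hyps by (intro nn_integral_add) (simp_all add: measurable_cong_sets[OF K[OF that] refl])
  moreover have "(\<integral>\<^sup>+ u. f u + g u \<partial>N) = (\<integral>\<^sup>+ u. f u \<partial>N) + (\<integral>\<^sup>+ u. g u \<partial>N)"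
    using add.hyps by (intro nn_integral_add) (simp_all add: measurable_cong_sets[OF N(1) refl])
  ultimately show ?case using add.IH
    by (simp add: nn_integral_add borel_measurable_add cong: measurable_cong nn_integral_cong)
next
  case (seq U)
  have U: "U i \<in> borel_measurable (K w)" if "w \<in> space Q" for w i
    using seq(1)[of i] by (simp add: measurable_cong_sets[OF K[OF that] refl])
  have "(\<integral>\<^sup>+ u. (SUP i. U i) u \<partial>K w) = (SUP i. \<integral>\<^sup>+ u. U i u \<partial>K w)" if "w \<in> space Q" for w
    unfolding SUP_apply using U[OF that] seq by (intro nn_integral_monotone_convergence_SUP) auto
  moreover have "(\<integral>\<^sup>+ u. (SUP i. U i) u \<partial>N) = (SUP i. \<integral>\<^sup>+ u. U i u \<partial>N)"
    unfolding SUP_apply using seq.hyps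
    by (intro nn_integral_monotone_convergence_SUP) (auto simp: measurable_cong_sets[OF N(1) refl])
  moreover have "(\<integral>\<^sup>+ w. (SUP i. \<integral>\<^sup>+ u. U i u \<partial>K w) \<partial>Q) = (SUP i. \<integral>\<^sup>+ w. (\<integral>\<^sup>+ u. U i u \<partial>K w) \<partial>Q)"
    using seq by (intro nn_integral_monotone_convergence_SUP)
      (auto simp: incseq_def le_fun_def intro!: nn_integral_mono)
  moreover have "(\<lambda>w. SUP i. \<integral>\<^sup>+ u. U i u \<partial>K w) \<in> borel_measurable Q"
    using seq.IH by (intro borel_measurable_SUP) auto
  ultimately show ?case using seq.IH by (simp cong: measurable_cong nn_integral_cong)
qed

lemma integral_mixture:
  fixes f :: "pt \<Rightarrow> real"
  assumes N: "sets N = sets (euc d)" "\<And>A. A \<in> sets (euc d) \<Longrightarrow> emeasure N A = (\<integral>\<^sup>+ w. emeasure (K w) A \<partial>Q)"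
    and K: "\<And>w. w \<in> space Q \<Longrightarrow> K w \<in> space (ball_measures d R M)"
    and m: "\<And>A. A \<in> sets (euc d) \<Longrightarrow> (\<lambda>w. emeasure (K w) A) \<in> borel_measurable Q"
    and Q: "finite_measure Q" and M: "0 \<le> M"
    and f[measurable]: "f \<in> borel_measurable (euc d)" and b: "\<And>u. u \<in> eball d (origin d) R \<Longrightarrow> \<bar>f u\<bar> \<le> b"
  shows "integrable N f" "integrable Q (\<lambda>w. \<integral>u. f u \<partial>K w)" "(\<integral>u. f u \<partial>N) = (\<integral>w. (\<integral>u. f u \<partial>K w) \<partial>Q)"
proof -
  interpret Q: finite_measure Q by fact
  have mix0: "(\<lambda>w. \<integral>\<^sup>+ u. h u \<partial>K w) \<in> borel_measurable Q \<and>
      (\<integral>\<^sup>+ u. h u \<partial>N) = (\<integral>\<^sup>+ w. (\<integral>\<^sup>+ u. h u \<partial>K w) \<partial>Q)"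
    if "h \<in> borel_measurable (euc d)" for h
    by (rule nn_integral_mixture[OF N ball_measuresD(1)[OF K] m that])
  note mix = conjunct1[OF mix0] conjunct2[OF mix0]
  have *: "integrable N g \<and> integrable Q (\<lambda>w. \<integral>u. g u \<partial>K w) \<and> (\<integral>u. g u \<partial>N) = (\<integral>w. (\<integral>u. g u \<partial>K w) \<partial>Q)"
    if gmeas[measurable]: "g \<in> borel_measurable (euc d)" and g0: "\<And>u. 0 \<le> g u"
      and gb: "\<And>u. u \<in> eball d (origin d) R \<Longrightarrow> \<bar>g u\<bar> \<le> b'" for g :: "pt \<Rightarrow> real" and b'
  proof -
    have gN: "g \<in> borel_measurable N" by (simp add: measurable_cong_sets[OF N(1) refl])
    have gm: "(\<lambda>u. ennreal (g u)) \<in> borel_measurable (euc d)" by measurable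
    have mixg: "(\<lambda>w. \<integral>\<^sup>+ u. ennreal (g u) \<partial>K w) \<in> borel_measurable Q"
      "(\<integral>\<^sup>+ u. ennreal (g u) \<partial>N) = (\<integral>\<^sup>+ w. (\<integral>\<^sup>+ u. ennreal (g u) \<partial>K w) \<partial>Q)"
      by (rule mix[OF gm])+
    have int: "integrable (K w) g" if "w \<in> space Q" for w
      by (rule integrable_ball_measures[OF K[OF that] gmeas gb])
    have eq: "(\<integral>\<^sup>+ u. ennreal (g u) \<partial>K w) = ennreal (\<integral>u. g u \<partial>K w)" if "w \<in> space Q" for w
      using int[OF that] g0 by (intro nn_integral_eq_integral) auto
    have meas: "(\<lambda>w. \<integral>u. g u \<partial>K w) \<in> borel_measurable Q"
    proof -
      have "(\<lambda>w. enn2real (\<integral>\<^sup>+ u. ennreal (g u) \<partial>K w)) \<in> borel_measurable Q" using mixg(1) by measurable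
      then show ?thesis
        by (rule measurable_cong[THEN iffD1, rotated]) (use eq g0 in \<open>simp add: integral_nonneg\<close>)
    qed
    have bd: "\<bar>\<integral>u. g u \<partial>K w\<bar> \<le> \<bar>b'\<bar> * M" if w: "w \<in> space Q" for w
    proof -
      interpret Kw: finite_measure "K w" by (rule ball_measuresD[OF K[OF w]])
      have "(\<integral>u. g u \<partial>K w) \<le> (\<integral>u. \<bar>b'\<bar> \<partial>K w)"
      proof (rule integral_mono_AE[OF int[OF w]])
        show "AE u in K w. g u \<le> \<bar>b'\<bar>" using ball_measuresD(4)[OF K[OF w]] by eventually_elim (use gb in force)
      qed auto
      also have "\<dots> = \<bar>b'\<bar> * measure (K w) (space (K w))" by simp
      also have "\<dots> \<le> \<bar>b'\<bar> * M" using ball_measuresD(6)[OF K[OF w] M] by (intro mult_left_mono) auto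
      finally show ?thesis using g0 by (simp add: integral_nonneg)
    qed
    have intQ: "integrable Q (\<lambda>w. \<integral>u. g u \<partial>K w)"
      by (rule Q.integrable_const_bound[where B = "\<bar>b'\<bar> * M"]) (use bd meas in auto)
    have "(\<integral>\<^sup>+ u. ennreal (g u) \<partial>N) = (\<integral>\<^sup>+ w. ennreal (\<integral>u. g u \<partial>K w) \<partial>Q)"
      unfolding mixg(2) by (rule nn_integral_cong) (rule eq)
    also have "\<dots> = ennreal (\<integral>w. (\<integral>u. g u \<partial>K w) \<partial>Q)"
      using g0 by (intro nn_integral_eq_integral intQ) (simp add: integral_nonneg)
    finally have e: "(\<integral>\<^sup>+ u. ennreal (g u) \<partial>N) = ennreal (\<integral>w. (\<integral>u. g u \<partial>K w) \<partial>Q)" .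
    have "integrable N g" using g0 e gN by (intro integrableI_nonneg) auto
    moreover have "(\<integral>u. g u \<partial>N) = (\<integral>w. (\<integral>u. g u \<partial>K w) \<partial>Q)"
      using e g0 gN by (subst integral_eq_nn_integral) (auto intro!: enn2real_ennreal integral_nonneg)
    ultimately show ?thesis using intQ by blast
  qed
  have p: "integrable N (\<lambda>u. max 0 (f u)) \<and> integrable Q (\<lambda>w. \<integral>u. max 0 (f u) \<partial>K w) \<and> (\<integral>u. max 0 (f u) \<partial>N) = (\<integral>w. (\<integral>u. max 0 (f u) \<partial>K w) \<partial>Q)"
    by (rule *[where b' = "max 0 b"]) (use b in force)+
  have n: "integrable N (\<lambda>u. max 0 (- f u)) \<and> integrable Q (\<lambda>w. \<integral>u. max 0 (- f u) \<partial>K w) \<and> (\<integral>u. max 0 (- f u) \<partial>N) = (\<integral>w. (\<integral>u. max 0 (- f u) \<partial>K w) \<partial>Q)"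
    by (rule *[where b' = "max 0 b"]) (use b in force)+
  have f_eq: "f = (\<lambda>u. max 0 (f u) - max 0 (- f u))" by (auto simp: max_def)
  show "integrable N f" by (subst f_eq) (use p n in auto)
  have K_eq: "(\<integral>u. f u \<partial>K w) = (\<integral>u. max 0 (f u) \<partial>K w) - (\<integral>u. max 0 (- f u) \<partial>K w)" if w: "w \<in> space Q" for w
  proof -
    have "integrable (K w) (\<lambda>u. max 0 (f u))" "integrable (K w) (\<lambda>u. max 0 (- f u))"
      by (rule integrable_ball_measures[OF K[OF w], where b = "max 0 b"]; use b in force)+
    then show ?thesis by (subst f_eq) (rule Bochner_Integration.integral_diff)
  qed
  have "integrable Q (\<lambda>w. (\<integral>u. max 0 (f u) \<partial>K w) - (\<integral>u. max 0 (- f u) \<partial>K w))" using p n by auto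
  then show "integrable Q (\<lambda>w. \<integral>u. f u \<partial>K w)"
    by (rule Bochner_Integration.integrable_cong[THEN iffD1, OF refl, rotated]) (simp add: K_eq)
  have "(\<integral>u. f u \<partial>N) = (\<integral>u. max 0 (f u) \<partial>N) - (\<integral>u. max 0 (- f u) \<partial>N)"
    by (subst f_eq) (use p n in auto)
  also have "\<dots> = (\<integral>w. (\<integral>u. max 0 (f u) \<partial>K w) - (\<integral>u. max 0 (- f u) \<partial>K w) \<partial>Q)"
    using p n by simp
  also have "\<dots> = (\<integral>w. (\<integral>u. f u \<partial>K w) \<partial>Q)"
    by (rule Bochner_Integration.integral_cong) (simp_all add: K_eq)
  finally show "(\<integral>u. f u \<partial>N) = (\<integral>w. (\<integral>u. f u \<partial>K w) \<partial>Q)" .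
qed

lemma sets_batch_mean [simp]: "sets (batch_mean d xs S) = sets (euc d)"
  by (simp add: batch_mean_def)

lemma integral_batch_mean:
  fixes f :: "pt \<Rightarrow> real"
  assumes S: "finite S" "S \<noteq> {}" and xs: "\<And>i. i \<in> S \<Longrightarrow> xs i \<in> space (ball_measures d R M)" and M: "0 \<le> M"
    and f: "f \<in> borel_measurable (euc d)" "\<And>u. u \<in> eball d (origin d) R \<Longrightarrow> \<bar>f u\<bar> \<le> b"
  shows "(\<integral>u. f u \<partial>batch_mean d xs S) = (\<Sum>i\<in>S. \<integral>u. f u \<partial>xs i) / real (card S)"
proof -
  have "(\<integral>u. f u \<partial>batch_mean d xs S) = (\<integral>i. (\<integral>u. f u \<partial>xs i) \<partial>uniform_count_measure S)"
  proof (rule integral_mixture(3)[OF _ _ _ _ _ M f])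
    fix A assume A: "A \<in> sets (euc d)"
    have c: "inverse (ennreal (real (card S))) = ennreal (1 / real (card S))"
      using S by (subst inverse_ennreal) (auto simp: card_gt_0_iff inverse_eq_divide)
    have "(\<integral>\<^sup>+ i. emeasure (xs i) A \<partial>uniform_count_measure S) = (\<Sum>i\<in>S. ennreal (1 / real (card S)) * emeasure (xs i) A)"
      using S by (simp add: uniform_count_measure_def nn_integral_point_measure_finite)
    then show "emeasure (batch_mean d xs S) A = (\<integral>\<^sup>+ i. emeasure (xs i) A \<partial>uniform_count_measure S)"
      using emeasure_batch_mean[of S xs d A] ball_measuresD(1)[OF xs] A by (simp add: sum_distrib_left)
  qed (use S xs in \<open>auto simp: space_uniform_count_measure measurable_def sets_uniform_count_measure
      intro!: prob_space.finite_measure prob_space_uniform_count_measure\<close>)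
  also have "\<dots> = (\<Sum>i\<in>S. \<integral>u. f u \<partial>xs i) / real (card S)"
    using S by (simp add: uniform_count_measure_def lebesgue_integral_point_measure_finite sum_divide_distrib)
  finally show ?thesis .
qed

lemma measure_batch_mean:
  assumes S: "finite S" "S \<noteq> {}" and xs: "\<And>i. i \<in> S \<Longrightarrow> xs i \<in> space (ball_measures d R M)" and M: "0 \<le> M"
    and A: "A \<in> sets (euc d)"
  shows "measure (batch_mean d xs S) A = (\<Sum>i\<in>S. measure (xs i) A) / real (card S)"
proof -
  have "measure (batch_mean d xs S) A = (\<integral>u. indicator A u \<partial>batch_mean d xs S)"
    using A sets.sets_into_space[OF A] sets_eq_imp_space_eq[OF sets_batch_mean, of d xs S] by (simp add: Int_absorb2)
  also have "\<dots> = (\<Sum>i\<in>S. \<integral>u. indicator A u \<partial>xs i) / real (card S)"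
    by (rule integral_batch_mean[OF S xs M, where b = 1]) (use A in \<open>auto simp: indicator_def\<close>)
  also have "(\<Sum>i\<in>S. \<integral>u. indicator A u \<partial>xs i) = (\<Sum>i\<in>S. measure (xs i) A)"
    using sets.sets_into_space[OF A] ball_measuresD(1,2)[OF xs] A by (intro sum.cong) (auto simp: Int_absorb2)
  finally show ?thesis .
qed

text \<open>
  Dividing by \<open>M\<close> turns the measures into subprobabilities, so that facts about
  kernels in the Giry monad apply.
\<close>

lemma scale_ball_measures_subprob:
  assumes K: "K \<in> Z \<rightarrow>\<^sub>M ball_measures d R M" and M: "0 < M"
  shows "(\<lambda>z. scale_measure (ennreal (1 / M)) (K z)) \<in> Z \<rightarrow>\<^sub>M subprob_algebra (euc d)"
proof (rule measurable_subprob_algebra)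
  fix z assume "z \<in> space Z"
  then have z: "K z \<in> space (ball_measures d R M)" by (rule measurable_space[OF K])
  show "sets (scale_measure (ennreal (1 / M)) (K z)) = sets (euc d)" using ball_measuresD(1)[OF z] by simp
  show "subprob_space (scale_measure (ennreal (1 / M)) (K z))"
  proof
    have "ennreal (1 / M) * emeasure (K z) (space (K z)) \<le> ennreal (1 / M) * ennreal M"
      by (intro mult_left_mono ball_measuresD(5)[OF z]) auto
    also have "\<dots> = 1" using M by (simp add: ennreal_mult[symmetric])
    finally show "emeasure (scale_measure (ennreal (1 / M)) (K z)) (space (scale_measure (ennreal (1 / M)) (K z))) \<le> 1"
      by (simp add: space_scale_measure)
    show "space (scale_measure (ennreal (1 / M)) (K z)) \<noteq> {}"
      using space_euc_nonempty ball_measuresD(2)[OF z] by (auto simp: space_scale_measure)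
  qed
next
  fix A assume "A \<in> sets (euc d)"
  then have "(\<lambda>z. emeasure (K z) A) \<in> borel_measurable Z"
    using measurable_compose[OF K measurable_emeasure_ball_measures] by blast
  then show "(\<lambda>z. emeasure (scale_measure (ennreal (1 / M)) (K z)) A) \<in> borel_measurable Z"
    by simp
qed

text \<open>
  Joint measurability is needed because the integrand of an update involves the cells of a
  codebook that is itself random, being computed from earlier batches.
\<close>

lemma borel_measurable_integral_ball_measures:
  fixes f :: "'z \<Rightarrow> pt \<Rightarrow> real"
  assumes K: "K \<in> Z \<rightarrow>\<^sub>M ball_measures d R M" and M: "0 < M"
    and f[measurable]: "(\<lambda>(z, u). f z u) \<in> borel_measurable (Z \<Otimes>\<^sub>M euc d)"
    and b: "\<And>z u. z \<in> space Z \<Longrightarrow> u \<in> eball d (origin d) R \<Longrightarrow> \<bar>f z u\<bar> \<le> b z"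
  shows "(\<lambda>z. \<integral>u. f z u \<partial>K z) \<in> borel_measurable Z"
proof -
  have *: "(\<lambda>z. \<integral>\<^sup>+ u. g z u \<partial>K z) \<in> borel_measurable Z"
    if [measurable]: "(\<lambda>(z, u). g z u) \<in> borel_measurable (Z \<Otimes>\<^sub>M euc d)" for g :: "'z \<Rightarrow> pt \<Rightarrow> ennreal"
  proof -
    have "(\<lambda>z. ennreal M * (\<integral>\<^sup>+ u. g z u \<partial>scale_measure (ennreal (1 / M)) (K z))) \<in> borel_measurable Z"
      using nn_integral_measurable_subprob_algebra2[OF that scale_ball_measures_subprob[OF K M]] by measurable
    moreover have "ennreal M * (\<integral>\<^sup>+ u. g z u \<partial>scale_measure (ennreal (1 / M)) (K z)) = (\<integral>\<^sup>+ u. g z u \<partial>K z)"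
      if z: "z \<in> space Z" for z
    proof -
      have "g z \<in> borel_measurable (K z)"
        unfolding measurable_cong_sets[OF ball_measuresD(1)[OF measurable_space[OF K z]] refl]
        using z by measurable
      then show ?thesis using M
        by (simp add: nn_integral_scale_measure mult.assoc[symmetric] ennreal_mult[symmetric])
    qed
    ultimately show ?thesis by (simp cong: measurable_cong)
  qed
  have "(\<lambda>z. enn2real (\<integral>\<^sup>+ u. ennreal (f z u) \<partial>K z) - enn2real (\<integral>\<^sup>+ u. ennreal (- f z u) \<partial>K z)) \<in> borel_measurable Z"
    by (intro borel_measurable_diff borel_measurable_enn2real *) measurable
  then show ?thesis
  proof (rule measurable_cong[THEN iffD1, rotated])
    fix z assume z: "z \<in> space Z"
    have "integrable (K z) (f z)"
      by (rule integrable_ball_measures[OF measurable_space[OF K z] _ b[OF z]]) (use z in measurable)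
    then show "enn2real (\<integral>\<^sup>+ u. ennreal (f z u) \<partial>K z) - enn2real (\<integral>\<^sup>+ u. ennreal (- f z u) \<partial>K z) = (\<integral>u. f z u \<partial>K z)"
      by (rule real_lebesgue_integral_def[symmetric])
  qed
qed

section \<open>Functions bounded on the ball\<close>

text \<open>
  Such functions are integrable for every finite measure that lives on the ball, and they form
  an algebra; this settles all integrability questions about coordinates, cells and distances at
  once.
\<close>

definition ball_bounded :: "nat \<Rightarrow> real \<Rightarrow> (pt \<Rightarrow> real) \<Rightarrow> bool" where
  "ball_bounded d R f \<longleftrightarrow>
    f \<in> borel_measurable (euc d) \<and> (\<exists>b. \<forall>u\<in>eball d (origin d) R. \<bar>f u\<bar> \<le> b)"

lemma ball_bounded_const: "ball_bounded d R (\<lambda>_. a)"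
  by (auto simp: ball_bounded_def)

lemma ball_bounded_indicator: "A \<in> sets (euc d) \<Longrightarrow> ball_bounded d R (indicator A)"
  by (auto simp: ball_bounded_def intro!: exI[of _ 1] split: split_indicator)

lemma ball_bounded_coord: "l \<in> {1..d} \<Longrightarrow> ball_bounded d R (\<lambda>u. u l)"
proof -
  assume l: "l \<in> {1..d}"
  have "\<bar>u l\<bar> \<le> R" if "u \<in> eball d (origin d) R" for u
  proof -
    have "\<bar>u l\<bar> \<le> L2_set (\<lambda>l. \<bar>u l\<bar>) {1..d}" using l by (intro member_le_L2_set) auto
    also have "\<dots> = L2_set u {1..d}" by (simp add: L2_set_def)
    also have "\<dots> \<le> R" using that by (simp add: eball_origin)
    finally show ?thesis .
  qed
  then show ?thesis unfolding ball_bounded_def using l by (auto intro!: exI[of _ R] measurable_euc_component)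
qed

lemma ball_bounded_add: "ball_bounded d R f \<Longrightarrow> ball_bounded d R g \<Longrightarrow> ball_bounded d R (\<lambda>u. f u + g u)"
proof -
  assume "ball_bounded d R f" "ball_bounded d R g"
  then obtain a b where m: "f \<in> borel_measurable (euc d)" "g \<in> borel_measurable (euc d)"
    and "\<forall>u\<in>eball d (origin d) R. \<bar>f u\<bar> \<le> a" "\<forall>u\<in>eball d (origin d) R. \<bar>g u\<bar> \<le> b"
    unfolding ball_bounded_def by blast
  then have "\<forall>u\<in>eball d (origin d) R. \<bar>f u + g u\<bar> \<le> a + b"
    by (auto intro: order_trans[OF abs_triangle_ineq add_mono])
  with m show ?thesis unfolding ball_bounded_def by auto
qed

lemma ball_bounded_mult: "ball_bounded d R f \<Longrightarrow> ball_bounded d R g \<Longrightarrow> ball_bounded d R (\<lambda>u. f u * g u)"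
proof -
  assume "ball_bounded d R f" "ball_bounded d R g"
  then obtain a b where m: "f \<in> borel_measurable (euc d)" "g \<in> borel_measurable (euc d)"
    and "\<forall>u\<in>eball d (origin d) R. \<bar>f u\<bar> \<le> a" "\<forall>u\<in>eball d (origin d) R. \<bar>g u\<bar> \<le> b"
    unfolding ball_bounded_def by blast
  then have "\<forall>u\<in>eball d (origin d) R. \<bar>f u * g u\<bar> \<le> \<bar>a\<bar> * \<bar>b\<bar>"
    unfolding abs_mult by (intro ballI mult_mono) force+
  with m show ?thesis unfolding ball_bounded_def by auto
qed

lemma ball_bounded_diff: "ball_bounded d R f \<Longrightarrow> ball_bounded d R g \<Longrightarrow> ball_bounded d R (\<lambda>u. f u - g u)"
  using ball_bounded_add[OF _ ball_bounded_mult[OF ball_bounded_const[of d R "-1"]], of f g] by simp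

lemma ball_bounded_edist: "a \<in> space (euc d) \<Longrightarrow> ball_bounded d R (\<lambda>u. edist d u a)"
  unfolding ball_bounded_def
  by (intro conjI exI[of _ "R + L2_set a {1..d}"])
     (auto simp: eball_origin intro!: edist_le_of_ball)

lemma ball_bounded_power2: "ball_bounded d R f \<Longrightarrow> ball_bounded d R (\<lambda>u. (f u)\<^sup>2)"
  unfolding power2_eq_square by (rule ball_bounded_mult)

lemma ball_bounded_sum: "(\<And>i. i \<in> A \<Longrightarrow> ball_bounded d R (f i)) \<Longrightarrow> ball_bounded d R (\<lambda>u. \<Sum>i\<in>A. f i u)"
  by (induction A rule: infinite_finite_induct) (auto intro: ball_bounded_const ball_bounded_add)

lemmas ball_bounded_intros = ball_bounded_const ball_bounded_indicator ball_bounded_coord ball_bounded_add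
  ball_bounded_mult ball_bounded_diff ball_bounded_edist ball_bounded_power2 ball_bounded_sum

lemma ball_bounded_measurable: "ball_bounded d R f \<Longrightarrow> f \<in> borel_measurable (euc d)"
  by (simp add: ball_bounded_def)

lemma codebooks_point: "c \<in> codebooks d k \<Longrightarrow> j \<in> {1..k} \<Longrightarrow> c j \<in> space (euc d)"
  by (auto simp: codebooks_def)

lemma codebooks_update: "c \<in> codebooks d k \<Longrightarrow> j \<in> {1..k} \<Longrightarrow> a \<in> space (euc d) \<Longrightarrow> c(j := a) \<in> codebooks d k"
  by (auto simp: codebooks_def PiE_def extensional_def)

section \<open>Tubes around cell boundaries\<close>

lemma edist_sq_affine:
  "(edist d x a)\<^sup>2 - (edist d x b)\<^sup>2 =
    (edist d u a)\<^sup>2 - (edist d u b)\<^sup>2 + 2 * (\<Sum>l\<in>{1..d}. (b l - a l) * (x l - u l))"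
  unfolding edist_def power2_L2_set
  by (simp add: sum_subtractf[symmetric] sum.distrib[symmetric] sum_distrib_left power2_eq_square algebra_simps)

lemma abs_sum_mult_le_edist:
  "\<bar>\<Sum>l\<in>{1..d}. (b l - a l) * (x l - u l)\<bar> \<le> edist d b a * edist d x u"
  unfolding edist_def by (rule abs_sum_mult_le_L2_set)

text \<open>
  For \<open>x\<close> in cell \<open>i\<close>, the left side of the inequality is \<open>2 *
  edist d (c i) (c j)\<close> times the distance from \<open>x\<close> to the bisecting
  hyperplane of \<open>c i\<close> and \<open>c j\<close>.
\<close>

definition tube :: "nat \<Rightarrow> nat \<Rightarrow> codebook \<Rightarrow> real \<Rightarrow> pt set" where
  "tube d k c t = {x \<in> space (euc d). \<exists>i\<in>{1..k}. \<exists>j\<in>{1..k}. i \<noteq> j \<and> x \<in> cell d k c i \<and>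
      (edist d x (c j))\<^sup>2 - (edist d x (c i))\<^sup>2 \<le> 2 * t * edist d (c i) (c j)}"

lemma sets_tube:
  assumes c: "c \<in> codebooks d k"
  shows "tube d k c t \<in> sets (euc d)"
proof -
  have "tube d k c t = (\<Union>i\<in>{1..k}. \<Union>j\<in>{1..k} - {i}. cell d k c i \<inter> {x \<in> space (euc d).
      (edist d x (c j))\<^sup>2 - (edist d x (c i))\<^sup>2 \<le> 2 * t * edist d (c i) (c j)})"
    (is "_ = ?U")
  proof (intro equalityI subsetI)
    fix x assume "x \<in> ?U"
    then obtain i j where "i \<in> {1..k}" "j \<in> {1..k}" "i \<noteq> j" "x \<in> cell d k c i" "x \<in> space (euc d)"
      "(edist d x (c j))\<^sup>2 - (edist d x (c i))\<^sup>2 \<le> 2 * t * edist d (c i) (c j)" by blast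
    then show "x \<in> tube d k c t" unfolding tube_def by (intro CollectI conjI bexI[of _ i] bexI[of _ j])
  qed (auto simp: tube_def)
  also have "\<dots> \<in> sets (euc d)"
  proof (intro sets.finite_UN sets.Int sets_cell[OF c])
    fix i j assume "i \<in> {1..k}" "j \<in> {1..k} - {i}"
    then have [simp]: "c i \<in> space (euc d)" "c j \<in> space (euc d)" using codebooks_point[OF c] by auto
    show "{x \<in> space (euc d). (edist d x (c j))\<^sup>2 - (edist d x (c i))\<^sup>2 \<le> 2 * t * edist d (c i) (c j)} \<in> sets (euc d)"
      by measurable
  qed auto
  finally show ?thesis .
qed

text \<open>
  A point within \<open>t\<close> of a tie is within \<open>t\<close> of a bisector of its own
  cell, as the difference of squared distances changes at rate at most \<open>2 * edist d (c i)
  (c j)\<close>. Conversely, moving a point of cell \<open>i\<close> perpendicularly onto the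
  nearest of the bisectors of \<open>c i\<close> crosses no other bisector of \<open>c
  i\<close>, so the end point is a tie between two nearest code points. The right side is
  visibly measurable, so the margin condition bounds the measure of a genuine event.
\<close>

lemma Union_eball_cell_boundary:
  assumes c: "c \<in> codebooks d k" and k: "2 \<le> k" and t: "0 \<le> t"
    and sep: "\<And>i j. i \<in> {1..k} \<Longrightarrow> j \<in> {1..k} \<Longrightarrow> i \<noteq> j \<Longrightarrow> 0 < edist d (c i) (c j)"
  shows "(\<Union>u\<in>cell_boundary d k c. eball d u t) = tube d k c t"
proof (intro equalityI subsetI)
  fix x assume "x \<in> (\<Union>u\<in>cell_boundary d k c. eball d u t)"
  then obtain u where u: "u \<in> cell_boundary d k c" and x: "x \<in> space (euc d)" "edist d u x \<le> t"
    by (auto simp: eball_def)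
  from u obtain i0 j0 where ij: "i0 \<in> {1..k}" "j0 \<in> {1..k}" "i0 < j0" "u \<in> cell d k c i0"
    "edist d u (c i0) = edist d u (c j0)" by (auto simp: cell_boundary_def)
  obtain i where i: "i \<in> {1..k}" "x \<in> cell d k c i" using cell_exists[OF x(1), of k] k by auto
  define a where "a = (if i = i0 then j0 else i0)"
  have a: "a \<in> {1..k}" "a \<noteq> i" using ij by (auto simp: a_def)
  have "edist d u (c a) \<le> edist d u (c i)"
    using cell_dist_le[OF ij(4) i(1)] ij(5) by (simp add: a_def)
  then have "(edist d u (c a))\<^sup>2 \<le> (edist d u (c i))\<^sup>2" by (intro power_mono) auto
  moreover have "(\<Sum>l\<in>{1..d}. (c i l - c a l) * (x l - u l)) \<le> edist d (c i) (c a) * edist d x u"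
    using abs_sum_mult_le_edist[where b = "c i" and a = "c a" and x = x and u = u and d = d] by linarith
  moreover have "edist d (c i) (c a) * edist d x u \<le> edist d (c i) (c a) * t"
    using x(2) by (intro mult_left_mono) (auto simp: edist_commute)
  ultimately have "(edist d x (c a))\<^sup>2 - (edist d x (c i))\<^sup>2 \<le> 2 * t * edist d (c i) (c a)"
    using edist_sq_affine[of d x "c a" "c i" u] by (simp only: mult.commute[of "2 * t"])
  then show "x \<in> tube d k c t" unfolding tube_def using x i a
    by (intro CollectI conjI bexI[of _ i] bexI[of _ a]) auto
next
  fix x assume "x \<in> tube d k c t"
  then obtain i j where x: "x \<in> space (euc d)" and ij: "i \<in> {1..k}" "j \<in> {1..k}" "i \<noteq> j"
    "x \<in> cell d k c i" "(edist d x (c j))\<^sup>2 - (edist d x (c i))\<^sup>2 \<le> 2 * t * edist d (c i) (c j)"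
    by (auto simp: tube_def)
  define e where "e = (\<lambda>a. edist d (c i) (c a))"
  \<comment> \<open>The distance from \<open>x\<close> to the bisector of \<open>c i\<close> and
    \<open>c a\<close>.\<close>
  define h where "h = (\<lambda>a. ((edist d x (c a))\<^sup>2 - (edist d x (c i))\<^sup>2) / (2 * e a))"
  have e: "0 < e a" if "a \<in> {1..k} - {i}" for a using sep[of i a] ij that by (auto simp: e_def)
  define l where "l = arg_min_on h ({1..k} - {i})"
  have ne: "{1..k} - {i} \<noteq> {}" using ij by auto
  have l: "l \<in> {1..k} - {i}" unfolding l_def by (rule arg_min_if_finite(1)[OF _ ne]) simp
  have min: "h l \<le> h a" if "a \<in> {1..k} - {i}" for a
    unfolding l_def by (rule arg_min_least[OF _ ne that]) simp
  have el: "0 < e l" using e[OF l] .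
  have h0: "0 \<le> h l"
    unfolding h_def using l cell_dist_le[OF ij(4), of l] el
    by (intro divide_nonneg_pos) (auto intro!: power_mono)
  have "h j \<le> t" using ij(2,3,5) e[of j] by (auto simp: h_def e_def divide_simps mult_ac)
  then have ht: "h l \<le> t" using min[of j] ij by auto
  define y where "y = (\<lambda>m\<in>{1..d}. x m + h l * ((c l m - c i m) / e l))"
  have y: "y \<in> space (euc d)" by (auto simp: y_def space_euc)
  have yx: "edist d y x = h l"
  proof -
    have "edist d y x = L2_set (\<lambda>m. (h l / e l) * (c l m - c i m)) {1..d}"
      unfolding edist_def by (rule L2_set_cong) (auto simp: y_def)
    also have "\<dots> = (h l / e l) * edist d (c l) (c i)"
      unfolding edist_def using h0 el by (subst L2_set_cmult) auto
    also have "\<dots> = h l" using el by (simp add: e_def edist_commute)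
    finally show ?thesis .
  qed
  have ha: "(edist d x (c a))\<^sup>2 - (edist d x (c i))\<^sup>2 = 2 * (e a * h a)" if "a \<in> {1..k} - {i}" for a
    using e[OF that] by (simp add: h_def)
  have ge: "edist d y (c i) \<le> edist d y (c a)" if a: "a \<in> {1..k}" for a
  proof (cases "a = i")
    case False
    then have a: "a \<in> {1..k} - {i}" using a by auto
    have "- (e a * h l) \<le> (\<Sum>m\<in>{1..d}. (c i m - c a m) * (y m - x m))"
      using abs_sum_mult_le_edist[where b = "c i" and a = "c a" and x = y and u = x and d = d] yx
      by (simp add: e_def)
    moreover have "e a * h l \<le> e a * h a" using min[OF a] e[OF a] by simp
    ultimately have "(edist d y (c i))\<^sup>2 \<le> (edist d y (c a))\<^sup>2"
      using edist_sq_affine[of d y "c a" "c i" x] ha[OF a] by linarith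
    then show ?thesis by (rule power2_le_imp_le) simp
  qed simp
  have tie: "edist d y (c l) = edist d y (c i)"
  proof -
    have "(\<Sum>m\<in>{1..d}. (c i m - c l m) * (y m - x m)) = (\<Sum>m\<in>{1..d}. - (h l / e l) * (c i m - c l m)\<^sup>2)"
      by (rule sum.cong) (use el in \<open>auto simp: y_def power2_eq_square field_simps\<close>)
    also have "\<dots> = - (h l / e l) * (e l)\<^sup>2"
      unfolding e_def edist_def power2_L2_set by (simp add: sum_distrib_left)
    also have "\<dots> = - (h l * e l)" using el by (simp add: power2_eq_square)
    finally have "(edist d y (c l))\<^sup>2 = (edist d y (c i))\<^sup>2"
      using edist_sq_affine[of d y "c l" "c i" x] ha[OF l] by simp
    then show ?thesis by (subst (asm) power2_eq_iff_nonneg) auto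
  qed
  obtain b where b: "b \<in> {1..k}" "y \<in> cell d k c b" using cell_exists[OF y, of k] k by auto
  have by_eq: "edist d y (c b) = edist d y (c i)"
    using ge[OF b(1)] cell_dist_le[OF b(2) ij(1)] by simp
  define a where "a = (if b = i then l else i)"
  have a: "a \<in> {1..k}" "a \<noteq> b" "edist d y (c b) = edist d y (c a)"
    using ij l by_eq tie by (auto simp: a_def)
  have "\<not> a < b" using cellD(1)[OF b(2) a(1)] a(3) by auto
  then have "b < a" using a(2) by simp
  then have "y \<in> cell_boundary d k c" unfolding cell_boundary_def using a b
    by (intro CollectI bexI[of _ b] bexI[of _ a] conjI)
  moreover have "x \<in> eball d y t" using x yx ht by (simp add: eball_def)
  ultimately show "x \<in> (\<Union>u\<in>cell_boundary d k c. eball d u t)" by blast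
qed

section \<open>Optimal codebooks\<close>

locale ball_distribution =
  fixes d k :: nat and R :: real and \<mu> :: "pt measure"
  assumes sets_\<mu>: "sets \<mu> = sets (euc d)"
    and finite_\<mu>: "finite_measure \<mu>"
    and AE_ball: "AE u in \<mu>. u \<in> eball d (origin d) R"
    and k_ge_2: "2 \<le> k"
    and supp_\<mu>: "supported_by_more_than d \<mu> k"
begin

sublocale finite_measure \<mu> by (rule finite_\<mu>)

lemma space_\<mu>: "space \<mu> = space (euc d)"
  by (rule sets_eq_imp_space_eq[OF sets_\<mu>])

lemma integrable_ball_bounded: "ball_bounded d R f \<Longrightarrow> integrable \<mu> f"
proof -
  assume "ball_bounded d R f"
  then obtain b where m: "f \<in> borel_measurable (euc d)" and b: "\<And>u. u \<in> eball d (origin d) R \<Longrightarrow> \<bar>f u\<bar> \<le> b"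
    by (auto simp: ball_bounded_def)
  show "integrable \<mu> f"
    by (rule integrable_const_bound[where B = b])
       (use AE_ball b m in \<open>auto simp: measurable_cong_sets[OF sets_\<mu> refl]\<close>)
qed

lemma integral_indicator_eq: "A \<in> sets (euc d) \<Longrightarrow> (\<integral>u. indicator A u \<partial>\<mu>) = measure \<mu> A"
  using sets.sets_into_space[of A \<mu>] by (simp add: sets_\<mu> Int_absorb2)

definition err :: "codebook \<Rightarrow> pt \<Rightarrow> real" where
  "err c u = (MIN j\<in>{1..k}. (edist d u (c j))\<^sup>2)"

lemma distortion_err: "distortion d k \<mu> c = (\<integral>u. err c u \<partial>\<mu>)"
  by (simp add: distortion_def err_def)

lemma err_cell: "u \<in> cell d k c j \<Longrightarrow> j \<in> {1..k} \<Longrightarrow> err c u = (edist d u (c j))\<^sup>2"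
  unfolding err_def by (rule Min_sq_cell)

lemma err_le: "j \<in> {1..k} \<Longrightarrow> err c u \<le> (edist d u (c j))\<^sup>2"
  unfolding err_def by (rule Min_sq_le)

lemma ex_cell: "u \<in> space (euc d) \<Longrightarrow> (\<And>j. j \<in> {1..k} \<Longrightarrow> u \<in> cell d k c j \<Longrightarrow> thesis) \<Longrightarrow> thesis"
  using cell_exists[of u d k c] k_ge_2 by auto

lemma sum_indicator_cell:
  fixes g :: "nat \<Rightarrow> real"
  assumes "u \<in> cell d k c j" "j \<in> {1..k}"
  shows "(\<Sum>i\<in>{1..k}. indicator (cell d k c i) u * g i) = g j"
proof -
  have "(\<Sum>i\<in>{1..k}. indicator (cell d k c i) u * g i) = (\<Sum>i\<in>{1..k}. if i = j then g j else 0)"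
  proof (rule sum.cong[OF refl])
    fix i assume i: "i \<in> {1..k}"
    show "indicator (cell d k c i) u * g i = (if i = j then g j else 0)"
      using cell_unique[OF assms(1) _ assms(2) i] assms(1) by (cases "u \<in> cell d k c i") auto
  qed
  then show ?thesis using assms by simp
qed

lemma err_eq_sum:
  assumes "u \<in> space (euc d)"
  shows "err c u = (\<Sum>i\<in>{1..k}. indicator (cell d k c i) u * (edist d u (c i))\<^sup>2)"
proof -
  obtain j where j: "j \<in> {1..k}" "u \<in> cell d k c j" using ex_cell[OF assms] by blast
  show ?thesis using err_cell[OF j(2,1)] sum_indicator_cell[OF j(2,1)] by simp
qed

lemma ball_bounded_err:
  assumes c: "c \<in> codebooks d k"
  shows "ball_bounded d R (err c)"
proof -
  have *: "ball_bounded d R (\<lambda>u. \<Sum>i\<in>{1..k}. indicator (cell d k c i) u * (edist d u (c i))\<^sup>2)" (is "ball_bounded _ _ ?s")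
    using codebooks_point[OF c] sets_cell[OF c] by (intro ball_bounded_intros) auto
  have "err c \<in> borel_measurable (euc d)"
    by (rule measurable_cong[THEN iffD1, OF _ ball_bounded_measurable[OF *]]) (simp add: err_eq_sum)
  moreover have "\<bar>err c u\<bar> = \<bar>?s u\<bar>" if "u \<in> eball d (origin d) R" for u
    using that by (subst err_eq_sum) (auto simp: eball_def)
  ultimately show ?thesis using * unfolding ball_bounded_def by auto
qed

lemma distortion_le:
  assumes c: "c \<in> codebooks d k" and g: "ball_bounded d R g"
    and le: "\<And>u. u \<in> eball d (origin d) R \<Longrightarrow> err c u \<le> g u"
  shows "distortion d k \<mu> c \<le> (\<integral>u. g u \<partial>\<mu>)"
  unfolding distortion_err
  by (rule integral_mono_AE[OF integrable_ball_bounded[OF ball_bounded_err[OF c]] integrable_ball_bounded[OF g]])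
     (use AE_ball le in auto)

lemma opt_codebooksD: "c \<in> opt_codebooks d k \<mu> \<Longrightarrow> c \<in> codebooks d k"
  "c \<in> opt_codebooks d k \<mu> \<Longrightarrow> c' \<in> codebooks d k \<Longrightarrow> distortion d k \<mu> c \<le> distortion d k \<mu> c'"
  by (auto simp: opt_codebooks_def)

text \<open>
  The form in which competitors are compared with an optimal codebook: a pointwise bound on their
  additional error is all that has to be supplied.
\<close>

lemma optD_err:
  assumes c: "c \<in> opt_codebooks d k \<mu>" and c': "c' \<in> codebooks d k" and g: "ball_bounded d R g"
    and le: "\<And>u. u \<in> eball d (origin d) R \<Longrightarrow> err c' u \<le> err c u + g u"
  shows "0 \<le> (\<integral>u. g u \<partial>\<mu>)"
proof -
  have "distortion d k \<mu> c \<le> distortion d k \<mu> c'" by (rule opt_codebooksD(2)[OF c c'])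
  also have "\<dots> \<le> (\<integral>u. err c u + g u \<partial>\<mu>)"
    by (rule distortion_le[OF c' ball_bounded_add[OF ball_bounded_err[OF opt_codebooksD(1)[OF c]] g] le])
  also have "\<dots> = distortion d k \<mu> c + (\<integral>u. g u \<partial>\<mu>)"
    unfolding distortion_err
    by (rule Bochner_Integration.integral_add)
       (auto intro!: integrable_ball_bounded ball_bounded_err opt_codebooksD(1)[OF c] g)
  finally show ?thesis by simp
qed

lemma ex_separated_support:
  obtains U \<delta> q where "finite U" "card U = k + 1" "U \<subseteq> space (euc d)" "0 < \<delta>" "0 < q"
    "\<And>x y. x \<in> U \<Longrightarrow> y \<in> U \<Longrightarrow> x \<noteq> y \<Longrightarrow> 4 * \<delta> \<le> edist d x y"
    "\<And>x. x \<in> U \<Longrightarrow> q \<le> measure \<mu> (eball d x (\<delta> / 2))"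
proof -
  obtain U where U: "U \<subseteq> supp d \<mu>" "finite U" "card U = k + 1"
  proof (cases "infinite (supp d \<mu>)")
    case True
    then obtain B where "finite B" "card B = k + 1" "B \<subseteq> supp d \<mu>"
      using infinite_arbitrarily_large[OF True, of "k + 1"] by auto
    then show ?thesis by (intro that)
  next
    case False
    then have "k + 1 \<le> card (supp d \<mu>)" using supp_\<mu> by (auto simp: supported_by_more_than_def)
    then obtain B where "B \<subseteq> supp d \<mu>" "card B = k + 1" "finite B"
      by (rule obtain_subset_with_card_n)
    then show ?thesis by (intro that)
  qed
  have Usp: "U \<subseteq> space (euc d)" using U(1) by (auto simp: supp_def)
  \<comment> \<open>The \<open>k + 1\<close> support points are separated by \<open>4 *
    \<delta>\<close>, and balls of radius \<open>\<delta> / 2\<close> have mass at least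
    \<open>q\<close>.\<close>
  define D where "D = (\<lambda>(x, y). edist d x y) ` {(x, y) \<in> U \<times> U. x \<noteq> y}"
  have finD: "finite D" unfolding D_def
    by (rule finite_imageI, rule finite_subset[of _ "U \<times> U"]) (use U in auto)
  have "\<not> (\<forall>x\<in>U. \<forall>y\<in>U. x = y)" using U(2,3) k_ge_2 by (simp flip: card_le_Suc0_iff_eq)
  then have neD: "D \<noteq> {}" unfolding D_def by auto
  have posD: "0 < z" if "z \<in> D" for z
  proof -
    from that obtain x y where "x \<in> U" "y \<in> U" "x \<noteq> y" "z = edist d x y" by (auto simp: D_def)
    moreover from this have "edist d x y \<noteq> 0" using Usp by (subst edist_eq_0_iff) auto
    ultimately show ?thesis using edist_nonneg[of d x y] by linarith
  qed
  define \<delta> where "\<delta> = Min D / 4"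
  have \<delta>: "0 < \<delta>" unfolding \<delta>_def using posD[OF Min_in[OF finD neD]] by simp
  have sep: "4 * \<delta> \<le> edist d x y" if "x \<in> U" "y \<in> U" "x \<noteq> y" for x y
    unfolding \<delta>_def using Min_le[OF finD, of "edist d x y"] that by (force simp: D_def)
  define q where "q = Min ((\<lambda>x. measure \<mu> (eball d x (\<delta> / 2))) ` U)"
  have neU: "U \<noteq> {}" using U(3) by auto
  have "0 < q" unfolding q_def
  proof (subst Min_gr_iff)
    show "\<forall>z\<in>(\<lambda>x. measure \<mu> (eball d x (\<delta> / 2))) ` U. 0 < z"
    proof safe
      fix x assume "x \<in> U"
      then have "0 < emeasure \<mu> (eball d x (\<delta> / 2))" using U(1) \<delta> by (auto simp: supp_def)
      then show "0 < measure \<mu> (eball d x (\<delta> / 2))" by (simp add: emeasure_eq_measure)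
    qed
  qed (use U neU in auto)
  moreover have "q \<le> measure \<mu> (eball d x (\<delta> / 2))" if "x \<in> U" for x
    unfolding q_def using U that by (intro Min_le) auto
  ultimately show ?thesis using that[OF U(2,3) Usp \<delta> _ sep] by blast
qed

text \<open>
  Pigeonhole principle: a code point is within \<open>2 * \<delta>\<close> of at most one of the
  \<open>k + 1\<close> separated points.
\<close>

lemma ex_far_point:
  assumes U: "finite U" "card U = k + 1" and sep: "\<And>x y. x \<in> U \<Longrightarrow> y \<in> U \<Longrightarrow> x \<noteq> y \<Longrightarrow> 4 * \<delta> \<le> edist d x y"
  shows "\<exists>x\<in>U. \<forall>i\<in>{1..k}. 2 * \<delta> \<le> edist d x (c i)"
proof (rule ccontr)
  assume "\<not> (\<exists>x\<in>U. \<forall>i\<in>{1..k}. 2 * \<delta> \<le> edist d x (c i))"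
  then have "\<forall>x\<in>U. \<exists>i\<in>{1..k}. edist d x (c i) < 2 * \<delta>" by (force simp: not_le)
  then obtain f where f: "\<And>x. x \<in> U \<Longrightarrow> f x \<in> {1..k}" "\<And>x. x \<in> U \<Longrightarrow> edist d x (c (f x)) < 2 * \<delta>"
    by metis
  have "inj_on f U"
  proof (rule inj_onI, rule ccontr)
    fix x y assume xy: "x \<in> U" "y \<in> U" "f x = f y" "x \<noteq> y"
    have "edist d x y \<le> edist d x (c (f x)) + edist d y (c (f x))"
      using edist_triangle[of d x y "c (f x)"] by (simp add: edist_commute)
    then show False using f(2)[OF xy(1)] f(2)[OF xy(2)] sep[OF xy(1,2,4)] xy(3) by simp
  qed
  then have "card U \<le> card {1..k}" using f(1) by (intro card_inj_on_le) auto
  then show False using U by simp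
qed

text \<open>
  If cell \<open>j\<close> is served by \<open>c i\<close> instead of \<open>c j\<close>, the
  code point \<open>c j\<close> becomes free and may be placed at a support point far from all
  the others, which saves at least \<open>2 * \<delta>\<^sup>2 * q\<close>. By optimality the
  reassignment must cost at least as much. The bound is uniform over all optimal codebooks, and
  so are the positive lower bounds on cell masses and separations that follow from it.
\<close>

lemma ex_reassignment_gain:
  "\<exists>g>0. \<forall>c\<in>opt_codebooks d k \<mu>. \<forall>i\<in>{1..k}. \<forall>j\<in>{1..k}. i \<noteq> j \<longrightarrow>
    g \<le> (\<integral>u. indicator (cell d k c j) u * ((edist d u (c i))\<^sup>2 - (edist d u (c j))\<^sup>2) \<partial>\<mu>)"
proof -
  obtain U \<delta> q where U: "finite U" "card U = k + 1" "U \<subseteq> space (euc d)" "0 < \<delta>" "0 < q"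
    "\<And>x y. x \<in> U \<Longrightarrow> y \<in> U \<Longrightarrow> x \<noteq> y \<Longrightarrow> 4 * \<delta> \<le> edist d x y"
    "\<And>x. x \<in> U \<Longrightarrow> q \<le> measure \<mu> (eball d x (\<delta> / 2))"
    using ex_separated_support by blast
  show ?thesis
  proof (intro exI[of _ "2 * \<delta>\<^sup>2 * q"] conjI ballI impI)
    show "0 < 2 * \<delta>\<^sup>2 * q" using U by simp
    fix c i j assume c: "c \<in> opt_codebooks d k \<mu>" and ij: "i \<in> {1..k}" "j \<in> {1..k}" "i \<noteq> j"
    note cc = opt_codebooksD(1)[OF c]
    obtain x where x: "x \<in> U" "\<And>l. l \<in> {1..k} \<Longrightarrow> 2 * \<delta> \<le> edist d x (c l)"
      using ex_far_point[OF U(1,2,6)] by blast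
    then have xs: "x \<in> space (euc d)" using U by blast
    have c': "c(j := x) \<in> codebooks d k" by (rule codebooks_update[OF cc ij(2) xs])
    define h where "h = (\<lambda>u. indicator (cell d k c j) u * ((edist d u (c i))\<^sup>2 - (edist d u (c j))\<^sup>2))"
    define b :: "pt \<Rightarrow> real" where "b = indicator (eball d x (\<delta> / 2))"
    have h: "ball_bounded d R h" unfolding h_def
      using codebooks_point[OF cc] sets_cell[OF cc] ij by (intro ball_bounded_intros) auto
    have b: "ball_bounded d R b" unfolding b_def by (intro ball_bounded_intros sets_eball xs)
    have "0 \<le> (\<integral>u. h u - 2 * \<delta>\<^sup>2 * b u \<partial>\<mu>)"
    proof (rule optD_err[OF c c'])
      show "ball_bounded d R (\<lambda>u. h u - 2 * \<delta>\<^sup>2 * b u)" using h b by (intro ball_bounded_intros)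
      fix u assume "u \<in> eball d (origin d) R"
      then have u: "u \<in> space (euc d)" by (simp add: eball_def)
      obtain a where a: "a \<in> {1..k}" "u \<in> cell d k c a" using ex_cell[OF u] by blast
      \<comment> \<open>The code point that serves \<open>u\<close> when cell \<open>j\<close> is
        handed to \<open>c i\<close>.\<close>
      define l where "l = (if a = j then i else a)"
      have l: "l \<in> {1..k}" "l \<noteq> j" using ij a by (auto simp: l_def)
      have "err c u + h u = (edist d u (c l))\<^sup>2"
        using err_cell[OF a(2,1)] cell_unique[OF a(2) _ a(1) ij(2)] a
        by (auto simp: h_def l_def indicator_def)
      moreover have "err (c(j := x)) u \<le> (edist d u (c l))\<^sup>2 - 2 * \<delta>\<^sup>2 * b u"
      proof (cases "u \<in> eball d x (\<delta> / 2)")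
        case True
        then have ux: "edist d u x \<le> \<delta> / 2" by (simp add: eball_def edist_commute)
        then have "err (c(j := x)) u \<le> (\<delta> / 2)\<^sup>2"
          by (intro order_trans[OF err_le[OF ij(2)]]) (auto intro!: power_mono)
        moreover have "2 * \<delta> \<le> edist d x u + edist d u (c l)"
          using x(2)[OF l(1)] edist_triangle[of d x "c l" u] by linarith
        then have "3 / 2 * \<delta> \<le> edist d u (c l)" using ux by (simp add: edist_commute)
        then have "(3 / 2 * \<delta>)\<^sup>2 \<le> (edist d u (c l))\<^sup>2" using U(4) by (intro power_mono) auto
        ultimately show ?thesis using True by (simp add: b_def power2_eq_square)
      next
        case False
        then show ?thesis using err_le[OF l(1), of "c(j := x)" u] l(2) by (simp add: b_def)
      qed
      ultimately show "err (c(j := x)) u \<le> err c u + (h u - 2 * \<delta>\<^sup>2 * b u)" by linarith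
    qed
    also have "\<dots> = (\<integral>u. h u \<partial>\<mu>) - (\<integral>u. 2 * \<delta>\<^sup>2 * b u \<partial>\<mu>)"
      by (intro Bochner_Integration.integral_diff integrable_ball_bounded h ball_bounded_mult b ball_bounded_const)
    also have "(\<integral>u. 2 * \<delta>\<^sup>2 * b u \<partial>\<mu>) = 2 * \<delta>\<^sup>2 * measure \<mu> (eball d x (\<delta> / 2))"
      unfolding b_def using integral_indicator_eq[OF sets_eball[OF xs]] by simp
    finally show "2 * \<delta>\<^sup>2 * q \<le> (\<integral>u. indicator (cell d k c j) u * ((edist d u (c i))\<^sup>2 - (edist d u (c j))\<^sup>2) \<partial>\<mu>)"
      using mult_left_mono[OF U(7)[OF x(1)], of "2 * \<delta>\<^sup>2"] by (simp add: h_def)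
  qed
qed

text \<open>
  Only the mass and the first moment of \<open>A\<close> enter. If \<open>b\<close> is the mean
  over \<open>A\<close>, the right side is the mass of \<open>A\<close> times the squared
  distance of \<open>a\<close> and \<open>b\<close>.
\<close>

lemma integral_sq_diff:
  assumes A: "A \<in> sets (euc d)" and a: "a \<in> space (euc d)" and b: "b \<in> space (euc d)"
  shows "(\<integral>u. indicator A u * ((edist d u a)\<^sup>2 - (edist d u b)\<^sup>2) \<partial>\<mu>) =
    (\<Sum>l\<in>{1..d}. (b l - a l) * (2 * (\<integral>u. indicator A u * u l \<partial>\<mu>) - (a l + b l) * measure \<mu> A))"
proof -
  have "(\<integral>u. indicator A u * ((edist d u a)\<^sup>2 - (edist d u b)\<^sup>2) \<partial>\<mu>) =
    (\<integral>u. (\<Sum>l\<in>{1..d}. (b l - a l) * (2 * (indicator A u * u l) - (a l + b l) * indicator A u)) \<partial>\<mu>)"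
  proof (rule Bochner_Integration.integral_cong[OF refl])
    fix u
    have "(edist d u a)\<^sup>2 - (edist d u b)\<^sup>2 = (\<Sum>l\<in>{1..d}. (b l - a l) * (2 * u l - (a l + b l)))"
      unfolding edist_def power2_L2_set
      by (simp add: sum_subtractf[symmetric] power2_eq_square algebra_simps)
    then show "indicator A u * ((edist d u a)\<^sup>2 - (edist d u b)\<^sup>2) =
      (\<Sum>l\<in>{1..d}. (b l - a l) * (2 * (indicator A u * u l) - (a l + b l) * indicator A u))"
      by (cases "u \<in> A") auto
  qed
  also have "\<dots> = (\<Sum>l\<in>{1..d}. (\<integral>u. (b l - a l) * (2 * (indicator A u * u l) - (a l + b l) * indicator A u) \<partial>\<mu>))"
    by (intro Bochner_Integration.integral_sum integrable_ball_bounded ball_bounded_intros A) auto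
  also have "\<dots> = (\<Sum>l\<in>{1..d}. (b l - a l) * (2 * (\<integral>u. indicator A u * u l \<partial>\<mu>) - (a l + b l) * measure \<mu> A))"
  proof (rule sum.cong[OF refl])
    fix l assume l: "l \<in> {1..d}"
    have "(\<integral>u. 2 * (indicator A u * u l) - (a l + b l) * indicator A u \<partial>\<mu>) =
      (\<integral>u. 2 * (indicator A u * u l) \<partial>\<mu>) - (\<integral>u. (a l + b l) * indicator A u \<partial>\<mu>)"
      by (intro Bochner_Integration.integral_diff integrable_ball_bounded ball_bounded_intros A l)
    then show "(\<integral>u. (b l - a l) * (2 * (indicator A u * u l) - (a l + b l) * indicator A u) \<partial>\<mu>) =
      (b l - a l) * (2 * (\<integral>u. indicator A u * u l \<partial>\<mu>) - (a l + b l) * measure \<mu> A)"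
      using integral_indicator_eq[OF A] by simp
  qed
  finally show ?thesis .
qed

definition cell_moment :: "codebook \<Rightarrow> nat \<Rightarrow> nat \<Rightarrow> real" where
  "cell_moment c j l = (\<integral>u. indicator (cell d k c j) u * u l \<partial>\<mu>)"

definition cell_mean :: "codebook \<Rightarrow> nat \<Rightarrow> pt" where
  "cell_mean c j = (\<lambda>l\<in>{1..d}. cell_moment c j l / measure \<mu> (cell d k c j))"

lemma opt_mass_pos:
  assumes c: "c \<in> opt_codebooks d k \<mu>" and j: "j \<in> {1..k}"
  shows "0 < measure \<mu> (cell d k c j)"
proof (rule ccontr)
  assume "\<not> 0 < measure \<mu> (cell d k c j)"
  then have 0: "emeasure \<mu> (cell d k c j) = 0"
    using measure_nonneg[of \<mu> "cell d k c j"] by (simp add: emeasure_eq_measure)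
  obtain i where i: "i \<in> {1..k}" "i \<noteq> j"
    using j k_ge_2 by (cases "j = 1") (auto intro: that[of 1] that[of 2])
  have "AE u in \<mu>. u \<notin> cell d k c j"
    by (rule AE_not_in) (use 0 sets_cell[OF opt_codebooksD(1)[OF c] j] in \<open>auto simp: null_sets_def sets_\<mu>\<close>)
  then have "(\<integral>u. indicator (cell d k c j) u * ((edist d u (c i))\<^sup>2 - (edist d u (c j))\<^sup>2) \<partial>\<mu>) = 0"
    by (intro integral_eq_zero_AE) auto
  then show False using ex_reassignment_gain c i j by force
qed

lemma cell_mean_mult: "0 < measure \<mu> (cell d k c j) \<Longrightarrow> l \<in> {1..d} \<Longrightarrow>
    cell_moment c j l = measure \<mu> (cell d k c j) * cell_mean c j l"
  by (simp add: cell_mean_def)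

text \<open>
  Moving the code point to the mean of its cell lowers the distortion by the mass of the cell
  times the squared distance moved.
\<close>

lemma opt_centroid:
  assumes c: "c \<in> opt_codebooks d k \<mu>" and j: "j \<in> {1..k}"
  shows "c j = cell_mean c j"
proof -
  note cc = opt_codebooksD(1)[OF c]
  define p where "p = measure \<mu> (cell d k c j)"
  have p: "0 < p" unfolding p_def by (rule opt_mass_pos[OF c j])
  define m where "m = cell_mean c j"
  have m: "m \<in> space (euc d)" by (simp add: m_def cell_mean_def space_euc)
  have "0 \<le> (\<integral>u. indicator (cell d k c j) u * ((edist d u m)\<^sup>2 - (edist d u (c j))\<^sup>2) \<partial>\<mu>)"
  proof (rule optD_err[OF c codebooks_update[OF cc j m]])
    show "ball_bounded d R (\<lambda>u. indicator (cell d k c j) u * ((edist d u m)\<^sup>2 - (edist d u (c j))\<^sup>2))"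
      by (intro ball_bounded_intros sets_cell[OF cc j] m codebooks_point[OF cc j])
    fix u assume "u \<in> eball d (origin d) R"
    then have u: "u \<in> space (euc d)" by (simp add: eball_def)
    obtain a where a: "a \<in> {1..k}" "u \<in> cell d k c a" using ex_cell[OF u] by blast
    show "err (c(j := m)) u \<le> err c u + indicator (cell d k c j) u * ((edist d u m)\<^sup>2 - (edist d u (c j))\<^sup>2)"
      using err_le[OF a(1), of "c(j := m)" u] err_cell[OF a(2,1)] cell_unique[OF a(2) _ a(1) j] a
      by (cases "a = j") (auto simp: indicator_def)
  qed
  also have "\<dots> = (\<Sum>l\<in>{1..d}. (c j l - m l) * (2 * cell_moment c j l - (m l + c j l) * p))"
    unfolding integral_sq_diff[OF sets_cell[OF cc j] m codebooks_point[OF cc j]] cell_moment_def p_def ..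
  also have "\<dots> = (\<Sum>l\<in>{1..d}. - p * (c j l - m l)\<^sup>2)"
  proof (rule sum.cong[OF refl])
    fix l assume "l \<in> {1..d}"
    then have "cell_moment c j l = p * m l" using cell_mean_mult[of c j l] p by (simp add: p_def m_def)
    then show "(c j l - m l) * (2 * cell_moment c j l - (m l + c j l) * p) = - p * (c j l - m l)\<^sup>2"
      by (simp add: power2_eq_square algebra_simps)
  qed
  also have "\<dots> = - p * (edist d (c j) m)\<^sup>2"
    unfolding edist_def power2_L2_set by (simp add: sum_distrib_left)
  finally have "edist d (c j) m = 0" using p by (auto simp: mult_le_0_iff)
  then show ?thesis using codebooks_point[OF cc j] m by (simp add: edist_eq_0_iff m_def)
qed

text \<open>
  Otherwise the measure lives on the origin at most, which cannot support more than
  \<open>k\<close> points.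
\<close>

lemma R_pos: "0 < R"
proof (rule ccontr)
  assume R: "\<not> 0 < R"
  obtain U \<delta> q where U: "finite U" "card U = k + 1" "U \<subseteq> space (euc d)" "0 < \<delta>" "0 < q"
    "\<And>x y. x \<in> U \<Longrightarrow> y \<in> U \<Longrightarrow> x \<noteq> y \<Longrightarrow> 4 * \<delta> \<le> edist d x y"
    "\<And>x. x \<in> U \<Longrightarrow> q \<le> measure \<mu> (eball d x (\<delta> / 2))"
    using ex_separated_support by blast
  have near: "edist d x (origin d) \<le> \<delta> / 2" if x: "x \<in> U" for x
  proof (rule ccontr)
    assume far: "\<not> edist d x (origin d) \<le> \<delta> / 2"
    have "AE u in \<mu>. u \<notin> eball d x (\<delta> / 2)"
      using AE_ball
    proof eventually_elim
      case (elim u)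
      then have "edist d u (origin d) = 0" using R by (simp add: eball_origin edist_origin antisym)
      then have "edist d x u = edist d x (origin d)"
        using edist_triangle[of d x u "origin d"] edist_triangle[of d x "origin d" u]
        by (simp add: edist_commute)
      then show ?case using far by (simp add: eball_def)
    qed
    then have "emeasure \<mu> (eball d x (\<delta> / 2)) = 0"
      by (subst (asm) AE_iff_measurable[OF _ refl])
         (use sets_eball[of x d "\<delta> / 2"] U(3) x sets.sets_into_space[of "eball d x (\<delta> / 2)" \<mu>]
           in \<open>auto simp: sets_\<mu> Int_absorb1 Collect_conj_eq\<close>)
    then show False using U(5) U(7)[OF x] by (simp add: measure_def)
  qed
  have "\<not> (\<forall>x\<in>U. \<forall>y\<in>U. x = y)" using U(1,2) k_ge_2 by (simp flip: card_le_Suc0_iff_eq)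
  then obtain x y where xy: "x \<in> U" "y \<in> U" "x \<noteq> y" by blast
  have "edist d x y \<le> \<delta>"
    using edist_triangle[of d x y "origin d"] near[OF xy(1)] near[OF xy(2)] by (simp add: edist_commute)
  then show False using U(6)[OF xy] U(4) by linarith
qed

lemma cell_moment_norm_le:
  assumes c: "c \<in> codebooks d k" and j: "j \<in> {1..k}"
  shows "L2_set (cell_moment c j) {1..d} \<le> R * measure \<mu> (cell d k c j)"
proof -
  have "L2_set (\<lambda>l. \<integral>u. indicator (cell d k c j) u * u l \<partial>\<mu>) {1..d} \<le> (\<integral>u. R * indicator (cell d k c j) u \<partial>\<mu>)"
  proof (rule L2_set_integral_le)
    show "AE u in \<mu>. L2_set (\<lambda>l. indicator (cell d k c j) u * u l) {1..d} \<le> R * indicator (cell d k c j) u"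
      using AE_ball by eventually_elim (auto simp: L2_set_cmult eball_origin indicator_def L2_set_0')
  qed (auto intro!: integrable_ball_bounded ball_bounded_intros sets_cell[OF c j])
  then show ?thesis using integral_indicator_eq[OF sets_cell[OF c j]] by (simp add: cell_moment_def[abs_def])
qed

lemma cell_mean_in_ball:
  assumes c: "c \<in> codebooks d k" and j: "j \<in> {1..k}" and p: "0 < measure \<mu> (cell d k c j)"
  shows "cell_mean c j \<in> eball d (origin d) R"
proof -
  have "L2_set (cell_mean c j) {1..d} = L2_set (\<lambda>l. (1 / measure \<mu> (cell d k c j)) * cell_moment c j l) {1..d}"
    by (rule L2_set_cong) (auto simp: cell_mean_def)
  also have "\<dots> = L2_set (cell_moment c j) {1..d} / measure \<mu> (cell d k c j)"
    using p by (subst L2_set_cmult) simp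
  also have "\<dots> \<le> R" using cell_moment_norm_le[OF c j] p by (simp add: divide_simps)
  finally show ?thesis by (auto simp: eball_origin cell_mean_def space_euc)
qed

lemma opt_in_ball:
  assumes c: "c \<in> opt_codebooks d k \<mu>" and j: "j \<in> {1..k}"
  shows "c j \<in> eball d (origin d) R"
  using cell_mean_in_ball[OF opt_codebooksD(1)[OF c] j opt_mass_pos[OF c j]] opt_centroid[OF c j] by simp

lemma ball_dist_le: "x \<in> eball d (origin d) R \<Longrightarrow> y \<in> eball d (origin d) R \<Longrightarrow> edist d x y \<le> 2 * R"
  using edist_le_of_ball[of x d R y R] by (simp add: eball_origin)

text \<open>
  The cost of handing cell \<open>j\<close> to \<open>c i\<close> is at most the mass of the
  cell times \<open>4 * R\<close> times the distance of the two code points, so a lower bound on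
  this cost bounds both factors from below.
\<close>

lemma opt_mass_sep_lower:
  obtains g where "0 < g"
    "\<And>c j. c \<in> opt_codebooks d k \<mu> \<Longrightarrow> j \<in> {1..k} \<Longrightarrow> g \<le> measure \<mu> (cell d k c j)"
    "\<And>c i j. c \<in> opt_codebooks d k \<mu> \<Longrightarrow> i \<in> {1..k} \<Longrightarrow> j \<in> {1..k} \<Longrightarrow> i \<noteq> j \<Longrightarrow> g \<le> edist d (c i) (c j)"
proof -
  obtain g where g: "0 < g" and gain: "\<And>c i j. c \<in> opt_codebooks d k \<mu> \<Longrightarrow> i \<in> {1..k} \<Longrightarrow> j \<in> {1..k} \<Longrightarrow> i \<noteq> j \<Longrightarrow>
    g \<le> (\<integral>u. indicator (cell d k c j) u * ((edist d u (c i))\<^sup>2 - (edist d u (c j))\<^sup>2) \<partial>\<mu>)"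
    using ex_reassignment_gain by blast
  have key: "g \<le> edist d (c i) (c j) * (4 * R) * measure \<mu> (cell d k c j)"
    if c: "c \<in> opt_codebooks d k \<mu>" and ij: "i \<in> {1..k}" "j \<in> {1..k}" "i \<noteq> j" for c i j
  proof -
    note cc = opt_codebooksD(1)[OF c]
    have "(\<integral>u. indicator (cell d k c j) u * ((edist d u (c i))\<^sup>2 - (edist d u (c j))\<^sup>2) \<partial>\<mu>)
      \<le> (\<integral>u. edist d (c i) (c j) * (4 * R) * indicator (cell d k c j) u \<partial>\<mu>)"
    proof (rule integral_mono_AE)
      show "AE u in \<mu>. indicator (cell d k c j) u * ((edist d u (c i))\<^sup>2 - (edist d u (c j))\<^sup>2)
        \<le> edist d (c i) (c j) * (4 * R) * indicator (cell d k c j) u"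
        using AE_ball
      proof eventually_elim
        case (elim u)
        have "edist d (c j) (c i) * (edist d u (c j) + edist d u (c i)) \<le> edist d (c j) (c i) * (4 * R)"
          using ball_dist_le[OF elim opt_in_ball[OF c ij(1)]] ball_dist_le[OF elim opt_in_ball[OF c ij(2)]]
          by (intro mult_left_mono) auto
        then have "(edist d u (c i))\<^sup>2 - (edist d u (c j))\<^sup>2 \<le> edist d (c i) (c j) * (4 * R)"
          using edist_sq_diff_le[of d u "c i" "c j"] by (simp add: edist_commute)
        then show ?case by (simp add: indicator_def)
      qed
    qed (intro integrable_ball_bounded ball_bounded_intros sets_cell[OF cc ij(2)] codebooks_point[OF cc] ij(1,2))+
    then show ?thesis using gain[OF c ij] integral_indicator_eq[OF sets_cell[OF cc ij(2)]] by simp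
  qed
  define A where "A = measure \<mu> (space \<mu>)"
  have A: "measure \<mu> S \<le> A" for S by (simp add: A_def bounded_measure)
  define g' where "g' = min (g / (8 * R\<^sup>2)) (g / (4 * R * (A + 1)))"
  have A0: "0 \<le> A" by (simp add: A_def)
  show ?thesis
  proof (rule that[of g'])
    show "0 < g'" using g R_pos A0 by (simp add: g'_def)
    fix c j assume c: "c \<in> opt_codebooks d k \<mu>" and j: "j \<in> {1..k}"
    obtain i where i: "i \<in> {1..k}" "i \<noteq> j"
      using j k_ge_2 by (cases "j = 1") (auto intro: that[of 1] that[of 2])
    have "g \<le> edist d (c i) (c j) * (4 * R) * measure \<mu> (cell d k c j)" by (rule key[OF c i(1) j i(2)])
    also have "\<dots> \<le> (2 * R) * (4 * R) * measure \<mu> (cell d k c j)"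
      using ball_dist_le[OF opt_in_ball[OF c i(1)] opt_in_ball[OF c j]] R_pos
      by (intro mult_right_mono) auto
    finally have "g / (8 * R\<^sup>2) \<le> measure \<mu> (cell d k c j)"
      using R_pos by (simp add: divide_simps power2_eq_square mult_ac)
    then show "g' \<le> measure \<mu> (cell d k c j)" by (simp add: g'_def)
  next
    fix c i j assume c: "c \<in> opt_codebooks d k \<mu>" and ij: "i \<in> {1..k}" "j \<in> {1..k}" "i \<noteq> j"
    have "g \<le> edist d (c i) (c j) * (4 * R) * measure \<mu> (cell d k c j)" by (rule key[OF c ij])
    also have "\<dots> \<le> edist d (c i) (c j) * (4 * R) * (A + 1)"
      using A[of "cell d k c j"] R_pos by (intro mult_left_mono) auto
    finally have "g \<le> edist d (c i) (c j) * (4 * R * (A + 1))" by (simp add: mult.assoc)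
    moreover have "0 < 4 * R * (A + 1)" using R_pos A0 by simp
    ultimately have "g / (4 * R * (A + 1)) \<le> edist d (c i) (c j)" by (simp only: pos_divide_le_eq)
    then show "g' \<le> edist d (c i) (c j)" by (simp add: g'_def)
  qed
qed

lemma p_min_le:
  assumes c: "c \<in> opt_codebooks d k \<mu>" and j: "j \<in> {1..k}"
  shows "p_min d k \<mu> \<le> measure \<mu> (cell d k c j)"
  unfolding p_min_def by (rule cInf_lower) (use c j in \<open>auto intro!: bdd_belowI[of _ 0]\<close>)

lemma min_sep_le:
  assumes c: "c \<in> opt_codebooks d k \<mu>" and ij: "i \<in> {1..k}" "j \<in> {1..k}" "i \<noteq> j"
  shows "min_sep d k \<mu> \<le> edist d (c i) (c j)"
  unfolding min_sep_def by (rule cInf_lower) (use c ij in \<open>auto intro!: bdd_belowI[of _ 0]\<close>)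

lemma p_min_min_sep_pos:
  assumes "c \<in> opt_codebooks d k \<mu>"
  shows "0 < p_min d k \<mu>" "0 < min_sep d k \<mu>"
proof -
  obtain g where g: "0 < g"
    "\<And>c j. c \<in> opt_codebooks d k \<mu> \<Longrightarrow> j \<in> {1..k} \<Longrightarrow> g \<le> measure \<mu> (cell d k c j)"
    "\<And>c i j. c \<in> opt_codebooks d k \<mu> \<Longrightarrow> i \<in> {1..k} \<Longrightarrow> j \<in> {1..k} \<Longrightarrow> i \<noteq> j \<Longrightarrow> g \<le> edist d (c i) (c j)"
    using opt_mass_sep_lower by blast
  have "1 \<in> {1..k}" "2 \<in> {1..k}" "(1::nat) \<noteq> 2" using k_ge_2 by auto
  note 12 = this
  have "g \<le> p_min d k \<mu>"
    unfolding p_min_def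
  proof (rule cInf_greatest)
    show "{measure \<mu> (cell d k c j) |c j. c \<in> opt_codebooks d k \<mu> \<and> j \<in> {1..k}} \<noteq> {}"
      using assms 12(1) by blast
  qed (use g(2) in blast)
  then show "0 < p_min d k \<mu>" using g(1) by linarith
  have "g \<le> min_sep d k \<mu>"
    unfolding min_sep_def
  proof (rule cInf_greatest)
    show "{edist d (c i) (c j) |c i j. c \<in> opt_codebooks d k \<mu> \<and> i \<in> {1..k} \<and> j \<in> {1..k} \<and> i \<noteq> j} \<noteq> {}"
      using assms 12 by blast
  qed (use g(3) in blast)
  then show "0 < min_sep d k \<mu>" using g(1) by linarith
qed

lemma sum_mass_cells:
  assumes c: "c \<in> codebooks d k"
  shows "(\<Sum>j\<in>{1..k}. measure \<mu> (cell d k c j)) = measure \<mu> (space \<mu>)"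
proof -
  have "(\<Sum>j\<in>{1..k}. measure \<mu> (cell d k c j)) = measure \<mu> (\<Union>j\<in>{1..k}. cell d k c j)"
  proof (rule finite_measure_finite_Union[symmetric])
    show "disjoint_family_on (cell d k c) {1..k}"
      unfolding disjoint_family_on_def using cell_unique by blast
  qed (use sets_cell[OF c] in \<open>auto simp: sets_\<mu>\<close>)
  also have "(\<Union>j\<in>{1..k}. cell d k c j) = space \<mu>"
    unfolding space_\<mu>
  proof (intro equalityI subsetI)
    fix u assume "u \<in> space (euc d)"
    then show "u \<in> (\<Union>j\<in>{1..k}. cell d k c j)" by (rule ex_cell[of u c]) auto
  qed (auto simp: cell_def)
  finally show ?thesis .
qed

lemma k_p_min_le:
  assumes "c \<in> opt_codebooks d k \<mu>"
  shows "real k * p_min d k \<mu> \<le> measure \<mu> (space \<mu>)"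
proof -
  have "(\<Sum>j\<in>{1..k}. p_min d k \<mu>) \<le> (\<Sum>j\<in>{1..k}. measure \<mu> (cell d k c j))"
    by (intro sum_mono p_min_le assms)
  then show ?thesis using sum_mass_cells[OF opt_codebooksD(1)[OF assms]] by simp
qed

lemma opt_distortion_eq:
  assumes c: "c \<in> opt_codebooks d k \<mu>"
  shows "opt_distortion d k \<mu> = distortion d k \<mu> c"
  unfolding opt_distortion_def
  by (rule cInf_eq_minimum) (use opt_codebooksD[OF c] in auto)

lemma opt_distortion_le:
  assumes c: "c \<in> opt_codebooks d k \<mu>" and c': "c' \<in> codebooks d k"
  shows "opt_distortion d k \<mu> \<le> distortion d k \<mu> c'"
  unfolding opt_distortion_eq[OF c] by (rule opt_codebooksD(2)[OF c c'])

text \<open>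
  Points are assigned as by the optimal codebook; since its code points are centroids, the cross
  terms vanish and the additional cost of cell \<open>j\<close> is its mass times the squared
  displacement of code point \<open>j\<close>.
\<close>

lemma excess_le:
  assumes c: "c \<in> opt_codebooks d k \<mu>" and c': "c' \<in> codebooks d k"
  shows "distortion d k \<mu> c' - opt_distortion d k \<mu> \<le> measure \<mu> (space \<mu>) * (cdist d k c c')\<^sup>2"
proof -
  note cc = opt_codebooksD(1)[OF c]
  define h where "h = (\<lambda>j u. indicator (cell d k c j) u * ((edist d u (c' j))\<^sup>2 - (edist d u (c j))\<^sup>2))"
  have h: "ball_bounded d R (h j)" if "j \<in> {1..k}" for j unfolding h_def
    using that by (intro ball_bounded_intros sets_cell[OF cc] codebooks_point[OF cc] codebooks_point[OF c']) auto
  have hs: "ball_bounded d R (\<lambda>u. \<Sum>j\<in>{1..k}. h j u)" using h by (rule ball_bounded_sum)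
  have "distortion d k \<mu> c' \<le> (\<integral>u. err c u + (\<Sum>j\<in>{1..k}. h j u) \<partial>\<mu>)"
  proof (rule distortion_le[OF c'])
    show "ball_bounded d R (\<lambda>u. err c u + (\<Sum>j\<in>{1..k}. h j u))"
      by (intro ball_bounded_add ball_bounded_err cc hs)
    fix u assume "u \<in> eball d (origin d) R"
    then have u: "u \<in> space (euc d)" by (simp add: eball_def)
    obtain a where a: "a \<in> {1..k}" "u \<in> cell d k c a" using ex_cell[OF u] by blast
    show "err c' u \<le> err c u + (\<Sum>j\<in>{1..k}. h j u)"
      using err_le[OF a(1), of c' u] err_cell[OF a(2,1)]
      unfolding h_def sum_indicator_cell[OF a(2,1), of "\<lambda>j. (edist d u (c' j))\<^sup>2 - (edist d u (c j))\<^sup>2"] by simp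
  qed
  also have "\<dots> = distortion d k \<mu> c + (\<integral>u. (\<Sum>j\<in>{1..k}. h j u) \<partial>\<mu>)"
    unfolding distortion_err
    by (rule Bochner_Integration.integral_add) (intro integrable_ball_bounded ball_bounded_err cc hs)+
  also have "(\<integral>u. (\<Sum>j\<in>{1..k}. h j u) \<partial>\<mu>) = (\<Sum>j\<in>{1..k}. \<integral>u. h j u \<partial>\<mu>)"
    by (rule Bochner_Integration.integral_sum) (rule integrable_ball_bounded[OF h])
  also have "(\<Sum>j\<in>{1..k}. \<integral>u. h j u \<partial>\<mu>) = (\<Sum>j\<in>{1..k}. measure \<mu> (cell d k c j) * (edist d (c j) (c' j))\<^sup>2)"
  proof (rule sum.cong[OF refl])
    fix j assume j: "j \<in> {1..k}"
    define p where "p = measure \<mu> (cell d k c j)"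
    have "(\<integral>u. h j u \<partial>\<mu>) = (\<Sum>l\<in>{1..d}. (c j l - c' j l) * (2 * cell_moment c j l - (c' j l + c j l) * p))"
      unfolding h_def integral_sq_diff[OF sets_cell[OF cc j] codebooks_point[OF c' j] codebooks_point[OF cc j]]
        cell_moment_def p_def ..
    also have "\<dots> = (\<Sum>l\<in>{1..d}. p * (c j l - c' j l)\<^sup>2)"
    proof (rule sum.cong[OF refl])
      fix l assume "l \<in> {1..d}"
      then have "cell_moment c j l = p * c j l"
        using cell_mean_mult[OF opt_mass_pos[OF c j], of l] fun_cong[OF opt_centroid[OF c j], of l] by (simp add: p_def)
      then show "(c j l - c' j l) * (2 * cell_moment c j l - (c' j l + c j l) * p) = p * (c j l - c' j l)\<^sup>2"
        by (simp add: power2_eq_square algebra_simps)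
    qed
    also have "\<dots> = p * (edist d (c j) (c' j))\<^sup>2"
      unfolding edist_def power2_L2_set by (simp add: sum_distrib_left)
    finally show "(\<integral>u. h j u \<partial>\<mu>) = measure \<mu> (cell d k c j) * (edist d (c j) (c' j))\<^sup>2" by (simp add: p_def)
  qed
  also have "\<dots> \<le> (\<Sum>j\<in>{1..k}. measure \<mu> (space \<mu>) * (edist d (c j) (c' j))\<^sup>2)"
    by (intro sum_mono mult_right_mono bounded_measure) auto
  also have "\<dots> = measure \<mu> (space \<mu>) * (cdist d k c c')\<^sup>2"
    unfolding cdist_def power2_L2_set by (simp add: sum_distrib_left)
  finally show ?thesis unfolding opt_distortion_eq[OF c] by simp
qed

end

section \<open>Consequences of the margin condition\<close>

locale margin_distribution = ball_distribution +
  fixes r0 :: real and cs :: codebook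
  assumes opt_cs: "cs \<in> opt_codebooks d k \<mu>"
    and margin: "margin_condition d k R \<mu> r0"
    and r0_pos: "0 < r0"
begin

abbreviation "sep \<equiv> min_sep d k \<mu>"
abbreviation "p \<equiv> p_min d k \<mu>"

definition R0 :: real where "R0 = sep * r0 / (16 * sqrt 2 * R)"

lemma cs: "cs \<in> codebooks d k" by (rule opt_codebooksD(1)[OF opt_cs])
lemmas cs_ball = opt_in_ball[OF opt_cs]
lemma p_pos: "0 < p" by (rule p_min_min_sep_pos[OF opt_cs])
lemma sep_pos: "0 < sep" by (rule p_min_min_sep_pos[OF opt_cs])

lemma sep_le: "sep \<le> 2 * R"
proof -
  have "1 \<in> {1..k}" "2 \<in> {1..k}" using k_ge_2 by auto
  then show ?thesis
    using min_sep_le[OF opt_cs, of 1 2] ball_dist_le[OF cs_ball[of 1] cs_ball[of 2]] by simp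
qed

lemma measure_tube_le:
  assumes t: "0 \<le> t" "t \<le> r0"
  shows "measure \<mu> (tube d k cs t) \<le> sep * p / (128 * R\<^sup>2) * t"
proof -
  have e: "(\<Union>u\<in>cell_boundary d k cs. eball d u t) = tube d k cs t"
    by (rule Union_eball_cell_boundary[OF cs k_ge_2 t(1)])
       (use min_sep_le[OF opt_cs] sep_pos in \<open>meson order_less_le_trans\<close>)
  have "emeasure \<mu> (tube d k cs t) \<le> (SUP c\<in>opt_codebooks d k \<mu>. emeasure \<mu> (\<Union>u\<in>cell_boundary d k c. eball d u t))"
    unfolding e[symmetric] by (rule SUP_upper[OF opt_cs])
  also have "\<dots> \<le> ennreal (sep * p / (128 * R\<^sup>2) * t)"
    using margin t by (simp add: margin_condition_def)
  finally show ?thesis using t p_pos sep_pos R_pos by (simp add: emeasure_eq_measure)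
qed

text \<open>
  A tube of width \<open>2 * R\<close> contains the whole ball, whose mass is at least \<open>2
  * p\<close>, while the margin condition would allow it a mass of at most \<open>p /
  32\<close>.
\<close>

lemma r0_le: "r0 \<le> 2 * R"
proof (rule ccontr)
  assume "\<not> r0 \<le> 2 * R"
  then have t: "2 * R \<le> r0" by simp
  have in_tube: "u \<in> tube d k cs (2 * R)" if u: "u \<in> eball d (origin d) R" for u
  proof -
    have us: "u \<in> space (euc d)" using u by (simp add: eball_def)
    obtain i where i: "i \<in> {1..k}" "u \<in> cell d k cs i" using ex_cell[OF us] by blast
    obtain j where j: "j \<in> {1..k}" "j \<noteq> i"
      using i k_ge_2 by (cases "i = 1") (auto intro: that[of 1] that[of 2])
    have "edist d (cs i) (cs j) * (edist d u (cs i) + edist d u (cs j)) \<le> edist d (cs i) (cs j) * (4 * R)"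
      using ball_dist_le[OF u cs_ball[OF i(1)]] ball_dist_le[OF u cs_ball[OF j(1)]] by (intro mult_left_mono) auto
    then have "(edist d u (cs j))\<^sup>2 - (edist d u (cs i))\<^sup>2 \<le> 2 * (2 * R) * edist d (cs i) (cs j)"
      using edist_sq_diff_le[of d u "cs j" "cs i"] by (simp add: mult.commute)
    then show ?thesis unfolding tube_def using us i j
      by (intro CollectI conjI bexI[of _ i] bexI[of _ j]) auto
  qed
  have "2 * p \<le> real k * p" using k_ge_2 p_pos by (intro mult_right_mono) auto
  also have "\<dots> \<le> measure \<mu> (space \<mu>)" by (rule k_p_min_le[OF opt_cs])
  also have "\<dots> \<le> measure \<mu> (tube d k cs (2 * R))"
    by (rule finite_measure_mono_AE) (use AE_ball in_tube sets_tube[OF cs] in \<open>auto simp: sets_\<mu>\<close>)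
  also have "\<dots> \<le> sep * p / (128 * R\<^sup>2) * (2 * R)"
    using R_pos t by (intro measure_tube_le) auto
  also have "\<dots> \<le> (2 * R) * p / (128 * R\<^sup>2) * (2 * R)"
    using sep_le p_pos R_pos by (intro mult_right_mono divide_right_mono) auto
  also have "\<dots> = p / 32" using R_pos by (simp add: power2_eq_square)
  finally show False using p_pos by simp
qed

lemma R0_pos: "0 < R0" using sep_pos r0_pos R_pos by (simp add: R0_def)

lemma R0_le: "R0 \<le> sep * r0 / (16 * R)" "R0 \<le> R / 5"
proof -
  \<comment> \<open>Without a lower bound on \<open>sqrt 2\<close> the second estimate would only
    be \<open>R / 4\<close>.\<close>
  have s: "14 / 10 \<le> sqrt 2" by (rule real_le_rsqrt) (simp add: power2_eq_square)
  define z where "z = sep * r0 / (16 * R)"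
  have z: "0 \<le> z" using sep_pos r0_pos R_pos by (simp add: z_def)
  have "R0 = z / sqrt 2" by (simp add: R0_def z_def)
  also have "\<dots> \<le> z / (14 / 10)" using s z by (intro divide_left_mono) auto
  finally have 1: "R0 \<le> z * (10 / 14)" by simp
  then show "R0 \<le> sep * r0 / (16 * R)" using z unfolding z_def[symmetric] by linarith
  have "sep * r0 \<le> (2 * R) * (2 * R)" using sep_le r0_le sep_pos r0_pos R_pos by (intro mult_mono) auto
  then have "z \<le> R / 4" using R_pos by (simp add: z_def divide_simps mult_ac)
  then show "R0 \<le> R / 5" using 1 R_pos by linarith
qed

lemma edist_le_cdist: "j \<in> {1..k} \<Longrightarrow> edist d (cs j) (c j) \<le> cdist d k cs c"
  unfolding cdist_def by (rule member_le_L2_set[of "{1..k}" j "\<lambda>j. edist d (cs j) (c j)"]) auto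

definition misclassified :: "codebook \<Rightarrow> pt set" where
  "misclassified c = (\<Union>i\<in>{1..k}. \<Union>j\<in>{1..k} - {i}. cell d k cs i \<inter> cell d k c j)"

lemma misclassifiedI:
  "u \<in> cell d k cs i \<Longrightarrow> u \<in> cell d k c j \<Longrightarrow> i \<in> {1..k} \<Longrightarrow> j \<in> {1..k} \<Longrightarrow> i \<noteq> j \<Longrightarrow> u \<in> misclassified c"
  unfolding misclassified_def by (rule UN_I, assumption, rule UN_I) auto

lemma misclassifiedE:
  assumes "u \<in> misclassified c"
  obtains i j where "i \<in> {1..k}" "j \<in> {1..k}" "i \<noteq> j" "u \<in> cell d k cs i" "u \<in> cell d k c j"
proof -
  from assms obtain i j where "i \<in> {1..k}" "j \<in> {1..k} - {i}" "u \<in> cell d k cs i \<inter> cell d k c j"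
    unfolding misclassified_def by blast
  then show thesis by (intro that[of i j]) auto
qed

context
  fixes c :: codebook
  assumes c: "c \<in> codebooks d k" and near: "cdist d k cs c \<le> R0"
begin

lemma sets_misclassified: "misclassified c \<in> sets (euc d)"
  unfolding misclassified_def by (intro sets.finite_UN sets.Int sets_cell cs c) auto

text \<open>
  A point of cell \<open>i\<close> of \<open>cs\<close> and of cell \<open>j\<close> of
  \<open>c\<close> is almost equidistant from \<open>cs i\<close> and \<open>cs j\<close>: the
  distances differ by at most twice the displacement of the codebook. Hence it lies in a tube of
  width proportional to this displacement.
\<close>

lemma measure_misclassified_le: "measure \<mu> (misclassified c) \<le> p * cdist d k cs c / (32 * R)"
proof -
  define \<Delta> where "\<Delta> = cdist d k cs c"
  have \<Delta>0: "0 \<le> \<Delta>" by (simp add: \<Delta>_def cdist_def)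
  \<comment> \<open>The width for which \<open>2 * t * sep\<close> equals the bound \<open>(2 *
    \<Delta>) * (4 * R)\<close> on the difference of squared distances.\<close>
  define t where "t = 4 * R * \<Delta> / sep"
  have "t \<le> 4 * R * R0 / sep" unfolding t_def \<Delta>_def
    using near sep_pos R_pos by (intro divide_right_mono mult_left_mono) auto
  also have "\<dots> \<le> 4 * R * (sep * r0 / (16 * R)) / sep"
    using R0_le(1) sep_pos R_pos by (intro divide_right_mono mult_left_mono) auto
  also have "\<dots> = r0 / 4" using sep_pos R_pos by simp
  finally have t: "0 \<le> t" "t \<le> r0" using r0_pos \<Delta>0 R_pos sep_pos by (auto simp: t_def)
  have in_tube: "u \<in> tube d k cs t" if u: "u \<in> eball d (origin d) R" "u \<in> misclassified c" for u
  proof -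
    have us: "u \<in> space (euc d)" using u by (simp add: eball_def)
    from u(2) obtain i j where ij: "i \<in> {1..k}" "j \<in> {1..k}" "i \<noteq> j" "u \<in> cell d k cs i" "u \<in> cell d k c j"
      by (rule misclassifiedE)
    have b: "edist d u (cs i) + edist d u (cs j) \<le> 4 * R"
      using ball_dist_le[OF u(1) cs_ball[OF ij(1)]] ball_dist_le[OF u(1) cs_ball[OF ij(2)]] by simp
    have d1: "edist d u (cs j) - edist d u (cs i) \<le> 2 * \<Delta>"
      using edist_triangle[of d u "cs j" "c j"] edist_triangle[of d u "c i" "cs i"]
        cell_dist_le[OF ij(5,1)] edist_le_cdist[OF ij(1), of c] edist_le_cdist[OF ij(2), of c]
      by (simp add: edist_commute \<Delta>_def)
    have "(edist d u (cs j))\<^sup>2 - (edist d u (cs i))\<^sup>2 =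
        (edist d u (cs j) - edist d u (cs i)) * (edist d u (cs i) + edist d u (cs j))"
      by (simp add: power2_eq_square algebra_simps)
    also have "\<dots> \<le> (2 * \<Delta>) * (4 * R)"
      using d1 b \<Delta>0 by (intro mult_mono) auto
    also have "\<dots> = 2 * t * sep" using sep_pos by (simp add: t_def)
    also have "\<dots> \<le> 2 * t * edist d (cs i) (cs j)"
      using min_sep_le[OF opt_cs ij(1-3)] t by (intro mult_left_mono) auto
    finally show ?thesis unfolding tube_def using us ij
      by (intro CollectI conjI bexI[of _ i] bexI[of _ j])
  qed
  have "measure \<mu> (misclassified c) \<le> measure \<mu> (tube d k cs t)"
    by (rule finite_measure_mono_AE) (use AE_ball in_tube sets_tube[OF cs] in \<open>auto simp: sets_\<mu>\<close>)
  also have "\<dots> \<le> sep * p / (128 * R\<^sup>2) * t" by (rule measure_tube_le[OF t])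
  also have "\<dots> = p * \<Delta> / (32 * R)" using sep_pos R_pos by (simp add: t_def power2_eq_square)
  finally show ?thesis by (simp add: \<Delta>_def)
qed

lemma mass_near_opt: "j \<in> {1..k} \<Longrightarrow> 99 / 100 * p \<le> measure \<mu> (cell d k c j)"
proof -
  assume j: "j \<in> {1..k}"
  have "cell d k cs j \<subseteq> cell d k c j \<union> misclassified c"
  proof
    fix u assume u: "u \<in> cell d k cs j"
    then have "u \<in> space (euc d)" by (simp add: cell_def)
    then obtain a where a: "a \<in> {1..k}" "u \<in> cell d k c a" using ex_cell by blast
    then show "u \<in> cell d k c j \<union> misclassified c"
      using misclassifiedI[OF u a(2) j a(1)] by (cases "a = j") auto
  qed
  then have "measure \<mu> (cell d k cs j) \<le> measure \<mu> (cell d k c j \<union> misclassified c)"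
    using sets_cell[OF c j] sets_misclassified by (intro finite_measure_mono) (auto simp: sets_\<mu>)
  also have "\<dots> \<le> measure \<mu> (cell d k c j) + measure \<mu> (misclassified c)"
    using sets_cell[OF c j] sets_misclassified by (intro measure_Un_le) (auto simp: sets_\<mu>)
  finally have "p \<le> measure \<mu> (cell d k c j) + p * cdist d k cs c / (32 * R)"
    using p_min_le[OF opt_cs j] measure_misclassified_le by linarith
  moreover have "p * cdist d k cs c / (32 * R) \<le> p * (R / 5) / (32 * R)"
    using near R0_le p_pos R_pos by (intro divide_right_mono mult_left_mono) auto
  moreover have "p * (R / 5) / (32 * R) \<le> p / 100" using R_pos p_pos by simp
  ultimately show ?thesis by linarith
qed

lemma mass_near_pos: "j \<in> {1..k} \<Longrightarrow> 0 < measure \<mu> (cell d k c j)"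
  using mass_near_opt[of j] p_pos by simp

text \<open>
  Code points of \<open>cs\<close> are means of their own cells, so the first moments of
  \<open>c\<close> about \<open>cs\<close> come from misclassified points only. The factor
  \<open>p\<close> in the bound on their mass pays for the division by the mass of a cell.
\<close>

lemma cell_mean_near_opt:
  "L2_set (\<lambda>(j, l). cs j l - cell_mean c j l) ({1..k} \<times> {1..d}) \<le> cdist d k cs c / 7"
proof -
  define I where "I = {1..k} \<times> {1..d}"
  define \<Delta> where "\<Delta> = cdist d k cs c"
  have \<Delta>0: "0 \<le> \<Delta>" by (simp add: \<Delta>_def cdist_def)
  \<comment> \<open>The integral of \<open>f (j, l)\<close> is coordinate \<open>l\<close> of the
    first moment of cell \<open>j\<close> of \<open>c\<close> about \<open>cs j\<close>, with a
    term of integral zero subtracted so that \<open>f\<close> vanishes off the misclassified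
    points.\<close>
  define f where "f = (\<lambda>(j, l) (u::pt). (indicator (cell d k c j) u - indicator (cell d k cs j) u) * (cs j l - u l))"
  have fb: "ball_bounded d R (f jl)" if "jl \<in> I" for jl
    using that unfolding f_def I_def
    by (cases jl) (auto intro!: ball_bounded_intros sets_cell cs c)
  have int: "(\<integral>u. f (j, l) u \<partial>\<mu>) = measure \<mu> (cell d k c j) * (cs j l - cell_mean c j l)" if jl: "j \<in> {1..k}" "l \<in> {1..d}" for j l
  proof -
    have *: "(\<integral>u. indicator (cell d k c' j) u * (cs j l - u l) \<partial>\<mu>) = cs j l * measure \<mu> (cell d k c' j) - cell_moment c' j l"
      if c': "c' \<in> codebooks d k" for c'
    proof -
      have "(\<integral>u. indicator (cell d k c' j) u * (cs j l - u l) \<partial>\<mu>) =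
        (\<integral>u. cs j l * indicator (cell d k c' j) u - indicator (cell d k c' j) u * u l \<partial>\<mu>)"
        by (simp add: algebra_simps)
      also have "\<dots> = (\<integral>u. cs j l * indicator (cell d k c' j) u \<partial>\<mu>) - (\<integral>u. indicator (cell d k c' j) u * u l \<partial>\<mu>)"
        by (rule Bochner_Integration.integral_diff)
           (intro integrable_ball_bounded ball_bounded_intros sets_cell[OF c' jl(1)] jl(2))+
      also have "\<dots> = cs j l * measure \<mu> (cell d k c' j) - cell_moment c' j l"
        using integral_indicator_eq[OF sets_cell[OF c' jl(1)]] by (simp add: cell_moment_def)
      finally show ?thesis .
    qed
    have "(\<integral>u. f (j, l) u \<partial>\<mu>) = (\<integral>u. indicator (cell d k c j) u * (cs j l - u l) - indicator (cell d k cs j) u * (cs j l - u l) \<partial>\<mu>)"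
      unfolding f_def by (simp add: algebra_simps)
    also have "\<dots> = (\<integral>u. indicator (cell d k c j) u * (cs j l - u l) \<partial>\<mu>) - (\<integral>u. indicator (cell d k cs j) u * (cs j l - u l) \<partial>\<mu>)"
      by (rule Bochner_Integration.integral_diff)
         (intro integrable_ball_bounded ball_bounded_intros sets_cell cs c jl)+
    also have "(\<integral>u. indicator (cell d k cs j) u * (cs j l - u l) \<partial>\<mu>) = 0"
      unfolding *[OF cs] using cell_mean_mult[OF opt_mass_pos[OF opt_cs jl(1)] jl(2)]
        fun_cong[OF opt_centroid[OF opt_cs jl(1)], of l] by simp
    finally show ?thesis
      unfolding *[OF c] using cell_mean_mult[OF mass_near_pos[OF jl(1)] jl(2)] by (simp add: algebra_simps)
  qed
  have "L2_set (\<lambda>jl. \<integral>u. f jl u \<partial>\<mu>) I \<le> (\<integral>u. 4 * R * indicator (misclassified c) u \<partial>\<mu>)"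
  proof (rule L2_set_integral_le)
    show "AE u in \<mu>. L2_set (\<lambda>jl. f jl u) I \<le> 4 * R * indicator (misclassified c) u"
      using AE_ball
    proof eventually_elim
      case (elim u)
      then have us: "u \<in> space (euc d)" by (simp add: eball_def)
      obtain a where a: "a \<in> {1..k}" "u \<in> cell d k c a" using ex_cell[OF us] by blast
      obtain b where b: "b \<in> {1..k}" "u \<in> cell d k cs b" using ex_cell[OF us] by blast
      show ?case
      proof (cases "u \<in> misclassified c")
        case False
        then have "a = b" using misclassifiedI[OF b(2) a(2) b(1) a(1)] by blast
        then have "indicator (cell d k c j) u = (indicator (cell d k cs j) u :: real)" if "j \<in> {1..k}" for j
          using cell_unique[OF a(2) _ a(1) that] cell_unique[OF b(2) _ b(1) that] a b by (auto simp: indicator_def)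
        then have "L2_set (\<lambda>jl. f jl u) I = 0" by (intro L2_set_0') (auto simp: f_def I_def)
        then show ?thesis using False by simp
      next
        case True
        have "L2_set (\<lambda>jl. f jl u) I = L2_set (\<lambda>j. L2_set (\<lambda>l. (indicator (cell d k c j) u - indicator (cell d k cs j) u) * (cs j l - u l)) {1..d}) {1..k}"
          unfolding I_def by (subst L2_set_Sigma) (auto simp: f_def case_prod_beta')
        also have "\<dots> \<le> (\<Sum>j\<in>{1..k}. L2_set (\<lambda>l. (indicator (cell d k c j) u - indicator (cell d k cs j) u) * (cs j l - u l)) {1..d})"
          by (rule L2_set_le_sum) simp
        also have "\<dots> \<le> (\<Sum>j\<in>{1..k}. indicator (cell d k c j) u * (2 * R) + indicator (cell d k cs j) u * (2 * R))"
        proof (rule sum_mono)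
          fix j assume j: "j \<in> {1..k}"
          have "L2_set (\<lambda>l. (indicator (cell d k c j) u - indicator (cell d k cs j) u) * (cs j l - u l)) {1..d}
            = \<bar>indicator (cell d k c j) u - indicator (cell d k cs j) u\<bar> * edist d (cs j) u"
            by (simp add: L2_set_cmult edist_def)
          also have "\<dots> \<le> (indicator (cell d k c j) u + indicator (cell d k cs j) u) * (2 * R)"
            using ball_dist_le[OF cs_ball[OF j] elim] R_pos by (intro mult_mono) (auto simp: indicator_def)
          finally show "L2_set (\<lambda>l. (indicator (cell d k c j) u - indicator (cell d k cs j) u) * (cs j l - u l)) {1..d}
            \<le> indicator (cell d k c j) u * (2 * R) + indicator (cell d k cs j) u * (2 * R)" by (simp add: algebra_simps)
        qed
        also have "\<dots> = 4 * R"
          unfolding sum.distrib sum_indicator_cell[OF a(2,1)] sum_indicator_cell[OF b(2,1)] by simp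
        finally show ?thesis using True by simp
      qed
    qed
  qed (auto simp: I_def intro!: integrable_ball_bounded fb ball_bounded_intros sets_misclassified)
  also have "\<dots> = 4 * R * measure \<mu> (misclassified c)"
    using integral_indicator_eq[OF sets_misclassified] by simp
  also have "\<dots> \<le> 4 * R * (p * \<Delta> / (32 * R))"
    using measure_misclassified_le R_pos unfolding \<Delta>_def by (intro mult_left_mono) auto
  also have "\<dots> = p * \<Delta> / 8" using R_pos by simp
  finally have e: "L2_set (\<lambda>jl. \<integral>u. f jl u \<partial>\<mu>) I \<le> p * \<Delta> / 8" .
  have "99 / 100 * p * L2_set (\<lambda>(j, l). cs j l - cell_mean c j l) I =
      L2_set (\<lambda>jl. 99 / 100 * p * (case jl of (j, l) \<Rightarrow> cs j l - cell_mean c j l)) I"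
    using p_pos by (subst L2_set_cmult) simp
  also have "\<dots> = L2_set (\<lambda>jl. \<bar>99 / 100 * p * (case jl of (j, l) \<Rightarrow> cs j l - cell_mean c j l)\<bar>) I"
    by (rule L2_set_abs[symmetric])
  also have "\<dots> \<le> L2_set (\<lambda>jl. \<bar>\<integral>u. f jl u \<partial>\<mu>\<bar>) I"
  proof (rule L2_set_mono)
    fix jl assume "jl \<in> I"
    then obtain j l where jl: "jl = (j, l)" "j \<in> {1..k}" "l \<in> {1..d}" by (auto simp: I_def)
    show "\<bar>99 / 100 * p * (case jl of (j, l) \<Rightarrow> cs j l - cell_mean c j l)\<bar> \<le> \<bar>\<integral>u. f jl u \<partial>\<mu>\<bar>"
      unfolding jl(1) int[OF jl(2,3)] using mult_right_mono[OF mass_near_opt[OF jl(2)], of "\<bar>cs j l - cell_mean c j l\<bar>"] p_pos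
      by (simp add: abs_mult)
  qed simp
  also have "\<dots> = L2_set (\<lambda>jl. \<integral>u. f jl u \<partial>\<mu>) I" by (rule L2_set_abs)
  finally have "99 / 100 * p * L2_set (\<lambda>(j, l). cs j l - cell_mean c j l) I \<le> p * \<Delta> / 8" using e by linarith
  then have "99 / 100 * L2_set (\<lambda>(j, l). cs j l - cell_mean c j l) I \<le> \<Delta> / 8"
    using p_pos by (simp add: mult.assoc mult.left_commute[of _ p])
  then show ?thesis unfolding I_def[symmetric] \<Delta>_def[symmetric] using \<Delta>0 by linarith
qed

end

end

section \<open>The update as a perturbed contraction\<close>

text \<open>
  Here \<open>v\<close> is the current error, \<open>e\<close> the displacement of the cell
  means, \<open>\<alpha>\<close> the ratio of two estimates of a cell mass, and \<open>N\<close>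
  the noise. Unperturbed, the squared norm would contract with linear term \<open>2 * s\<close>;
  the admitted perturbations leave \<open>8 / 5 * s\<close> of it, more than the stated \<open>3
  / 2 * s\<close>. The cross term with \<open>N\<close> is kept explicit because its expectation
  will vanish.
\<close>

lemma perturbed_contraction:
  fixes v e N \<alpha> :: "'i \<Rightarrow> real"
  assumes v: "L2_set v I \<le> r" and e: "L2_set e I \<le> L2_set v I / 7"
    and \<alpha>: "\<And>i. i \<in> I \<Longrightarrow> \<bar>\<alpha> i - 1\<bar> \<le> 1 / 20" and N: "L2_set N I \<le> r / 40"
    and s: "0 < s" "s \<le> 1"
  defines "w \<equiv> \<lambda>i. v i - s * (\<alpha> i * (v i + e i) + N i)"
  shows "L2_set w I \<le> r"
    and "(L2_set w I)\<^sup>2 \<le> max 0 (1 - 3 / 2 * s) * (L2_set v I)\<^sup>2 - 2 * s * (\<Sum>i\<in>I. v i * N i) + 4 * s\<^sup>2 * r\<^sup>2"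
proof -
  define \<Delta> where "\<Delta> = L2_set v I"
  have D: "0 \<le> \<Delta>" "\<Delta> \<le> r" using v by (auto simp: \<Delta>_def)
  have le_mono: "L2_set (\<lambda>i. b i * f i) I \<le> B * L2_set f I"
    if "\<And>i. i \<in> I \<Longrightarrow> \<bar>b i\<bar> \<le> B" "0 \<le> B" for b f :: "'i \<Rightarrow> real" and B
  proof -
    have "L2_set (\<lambda>i. b i * f i) I = L2_set (\<lambda>i. \<bar>b i * f i\<bar>) I" by (rule L2_set_abs[symmetric])
    also have "\<dots> \<le> L2_set (\<lambda>i. B * \<bar>f i\<bar>) I"
      by (rule L2_set_mono) (use that in \<open>auto simp: abs_mult intro!: mult_right_mono\<close>)
    also have "\<dots> = B * L2_set f I" using that(2) by (subst L2_set_cmult) (simp add: L2_set_abs)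
    finally show ?thesis .
  qed
  have ab: "\<bar>\<alpha> i\<bar> \<le> 21 / 20" if "i \<in> I" for i using \<alpha>[OF that] by linarith
  have ae: "L2_set (\<lambda>i. \<alpha> i * e i) I \<le> 21 / 20 * (\<Delta> / 7)"
  proof -
    have "L2_set (\<lambda>i. \<alpha> i * e i) I \<le> 21 / 20 * L2_set e I" by (rule le_mono) (use ab in auto)
    then show ?thesis using e by (simp add: \<Delta>_def)
  qed
  have v1: "L2_set (\<lambda>i. (1 - s * \<alpha> i) * v i) I \<le> (1 - s + s / 20) * \<Delta>"
    unfolding \<Delta>_def
  proof (rule le_mono)
    fix i assume i: "i \<in> I"
    have "1 - s * \<alpha> i = (1 - s) - s * (\<alpha> i - 1)" by (simp add: algebra_simps)
    then have "\<bar>1 - s * \<alpha> i\<bar> \<le> \<bar>1 - s\<bar> + \<bar>s * (\<alpha> i - 1)\<bar>" by (simp add: abs_triangle_ineq4)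
    also have "\<bar>s * (\<alpha> i - 1)\<bar> \<le> s * (1 / 20)" unfolding abs_mult using \<alpha>[OF i] s by (intro mult_mono) auto
    finally show "\<bar>1 - s * \<alpha> i\<bar> \<le> 1 - s + s / 20" using s by simp
  qed (use s in auto)
  have "L2_set w I = L2_set (\<lambda>i. (1 - s * \<alpha> i) * v i + (- s) * (\<alpha> i * e i + N i)) I"
    unfolding w_def by (simp add: algebra_simps)
  also have "\<dots> \<le> L2_set (\<lambda>i. (1 - s * \<alpha> i) * v i) I + L2_set (\<lambda>i. (- s) * (\<alpha> i * e i + N i)) I"
    by (rule L2_set_triangle_ineq)
  also have "L2_set (\<lambda>i. (- s) * (\<alpha> i * e i + N i)) I = s * L2_set (\<lambda>i. \<alpha> i * e i + N i) I"
    using s by (subst L2_set_cmult) simp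
  also have "s * L2_set (\<lambda>i. \<alpha> i * e i + N i) I \<le> s * (21 / 20 * (\<Delta> / 7) + r / 40)"
    using s ae N by (intro mult_left_mono order_trans[OF L2_set_triangle_ineq]) auto
  finally have "L2_set w I \<le> (1 - s + s / 20) * \<Delta> + s * (21 / 20 * (\<Delta> / 7) + r / 40)" using v1 by linarith
  also have "\<dots> \<le> (1 - s + s / 20) * r + s * (21 / 20 * (r / 7) + r / 40)"
    using D s by (intro add_mono mult_left_mono) auto
  also have "\<dots> = r - s * r * (31 / 40)" by (simp add: algebra_simps)
  also have "\<dots> \<le> r" using s D by simp
  finally show "L2_set w I \<le> r" .
  define g where "g = (\<lambda>i. \<alpha> i * (v i + e i) + N i)"
  have av: "L2_set (\<lambda>i. \<alpha> i * v i) I \<le> 21 / 20 * \<Delta>" unfolding \<Delta>_def by (rule le_mono) (use ab in auto)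
  have g: "L2_set g I \<le> 2 * r"
  proof -
    have "L2_set g I = L2_set (\<lambda>i. \<alpha> i * v i + (\<alpha> i * e i + N i)) I" by (simp add: g_def algebra_simps)
    also have "\<dots> \<le> L2_set (\<lambda>i. \<alpha> i * v i) I + L2_set (\<lambda>i. \<alpha> i * e i + N i) I" by (rule L2_set_triangle_ineq)
    also have "\<dots> \<le> 21 / 20 * \<Delta> + (21 / 20 * (\<Delta> / 7) + r / 40)"
      using av ae N by (intro add_mono order_trans[OF L2_set_triangle_ineq]) auto
    also have "\<dots> \<le> 2 * r" using D by linarith
    finally show ?thesis .
  qed
  have cross: "4 / 5 * \<Delta>\<^sup>2 \<le> (\<Sum>i\<in>I. v i * (\<alpha> i * (v i + e i)))"
  proof -
    have "(\<Sum>i\<in>I. 19 / 20 * (v i)\<^sup>2) \<le> (\<Sum>i\<in>I. \<alpha> i * (v i)\<^sup>2)"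
    proof (intro sum_mono mult_right_mono)
      fix i assume "i \<in> I"
      then show "19 / 20 \<le> \<alpha> i" using \<alpha>[of i] by linarith
    qed simp
    then have "19 / 20 * \<Delta>\<^sup>2 \<le> (\<Sum>i\<in>I. \<alpha> i * (v i)\<^sup>2)" by (simp add: \<Delta>_def power2_L2_set sum_distrib_left)
    moreover have "- (\<Delta> * (21 / 20 * (\<Delta> / 7))) \<le> (\<Sum>i\<in>I. v i * (\<alpha> i * e i))"
    proof -
      have "\<bar>\<Sum>i\<in>I. v i * (\<alpha> i * e i)\<bar> \<le> \<Delta> * L2_set (\<lambda>i. \<alpha> i * e i) I" unfolding \<Delta>_def by (rule abs_sum_mult_le_L2_set)
      also have "\<dots> \<le> \<Delta> * (21 / 20 * (\<Delta> / 7))" using ae D by (intro mult_left_mono) auto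
      finally show ?thesis by linarith
    qed
    moreover have "(\<Sum>i\<in>I. v i * (\<alpha> i * (v i + e i))) = (\<Sum>i\<in>I. \<alpha> i * (v i)\<^sup>2) + (\<Sum>i\<in>I. v i * (\<alpha> i * e i))"
      by (simp add: sum.distrib[symmetric] power2_eq_square algebra_simps)
    ultimately show ?thesis by (simp add: power2_eq_square)
  qed
  have "(L2_set w I)\<^sup>2 = (L2_set (\<lambda>i. v i + (- s) * g i) I)\<^sup>2" by (simp add: w_def g_def)
  also have "\<dots> = \<Delta>\<^sup>2 + 2 * (\<Sum>i\<in>I. v i * ((- s) * g i)) + (L2_set (\<lambda>i. (- s) * g i) I)\<^sup>2"
    unfolding L2_set_add_sq \<Delta>_def ..
  also have "(\<Sum>i\<in>I. v i * ((- s) * g i)) = - s * (\<Sum>i\<in>I. v i * (\<alpha> i * (v i + e i))) - s * (\<Sum>i\<in>I. v i * N i)"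
  proof -
    have "(\<Sum>i\<in>I. v i * ((- s) * g i)) = (\<Sum>i\<in>I. (- s) * (v i * (\<alpha> i * (v i + e i))) + (- s) * (v i * N i))"
      by (rule sum.cong) (auto simp: g_def algebra_simps)
    also have "\<dots> = (- s) * (\<Sum>i\<in>I. v i * (\<alpha> i * (v i + e i))) + (- s) * (\<Sum>i\<in>I. v i * N i)"
      by (simp only: sum.distrib sum_distrib_left)
    finally show ?thesis by simp
  qed
  also have "(L2_set (\<lambda>i. (- s) * g i) I)\<^sup>2 \<le> s\<^sup>2 * (2 * r)\<^sup>2"
  proof -
    have "(L2_set g I)\<^sup>2 \<le> (2 * r)\<^sup>2" using g by (intro power_mono) auto
    then have "s\<^sup>2 * (L2_set g I)\<^sup>2 \<le> s\<^sup>2 * (2 * r)\<^sup>2" by (intro mult_left_mono) auto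
    then show ?thesis by (simp only: L2_set_cmult power_mult_distrib abs_minus_cancel power2_abs)
  qed
  also have "\<Delta>\<^sup>2 + 2 * (- s * (\<Sum>i\<in>I. v i * (\<alpha> i * (v i + e i))) - s * (\<Sum>i\<in>I. v i * N i)) + s\<^sup>2 * (2 * r)\<^sup>2
      \<le> \<Delta>\<^sup>2 + 2 * (- s * (4 / 5 * \<Delta>\<^sup>2) - s * (\<Sum>i\<in>I. v i * N i)) + s\<^sup>2 * (2 * r)\<^sup>2"
    using mult_left_mono[OF cross, of s] s by simp
  also have "\<dots> = (1 - 8 / 5 * s) * \<Delta>\<^sup>2 - 2 * s * (\<Sum>i\<in>I. v i * N i) + 4 * s\<^sup>2 * r\<^sup>2"
    by (simp add: algebra_simps power2_eq_square)
  also have "\<dots> \<le> max 0 (1 - 3 / 2 * s) * \<Delta>\<^sup>2 - 2 * s * (\<Sum>i\<in>I. v i * N i) + 4 * s\<^sup>2 * r\<^sup>2"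
  proof -
    have "(1 - 8 / 5 * s) * \<Delta>\<^sup>2 \<le> max 0 (1 - 3 / 2 * s) * \<Delta>\<^sup>2" using s by (intro mult_right_mono) auto
    then show ?thesis by simp
  qed
  finally show "(L2_set w I)\<^sup>2 \<le> max 0 (1 - 3 / 2 * s) * (L2_set v I)\<^sup>2 - 2 * s * (\<Sum>i\<in>I. v i * N i) + 4 * s\<^sup>2 * r\<^sup>2"
    unfolding \<Delta>_def by simp
qed

definition avg :: "nat set \<Rightarrow> ('x \<Rightarrow> real) \<Rightarrow> (nat \<Rightarrow> 'x) \<Rightarrow> real" where
  "avg S f y = (\<Sum>i\<in>S. f (y i)) / real (card S)"

lemma avg_diff: "avg S (\<lambda>x. f x - g x) y = avg S f y - avg S g y"
  by (simp add: avg_def sum_subtractf diff_divide_distrib)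

lemma avg_cmult: "avg S (\<lambda>x. a * f x) y = a * avg S f y"
  by (simp add: avg_def sum_distrib_left)

lemma avg_const: "finite S \<Longrightarrow> S \<noteq> {} \<Longrightarrow> avg S (\<lambda>_. a) y = a"
  by (simp add: avg_def)

lemma L2_set_avg_le:
  assumes "finite S" "S \<noteq> {}" "\<And>i. i \<in> S \<Longrightarrow> L2_set (\<lambda>l. f l (y i)) L \<le> b (y i)"
  shows "L2_set (\<lambda>l. avg S (f l) y) L \<le> avg S b y"
proof -
  have sumle: "L2_set (\<lambda>l. \<Sum>i\<in>S. f l (y i)) L \<le> (\<Sum>i\<in>S. L2_set (\<lambda>l. f l (y i)) L)"
    using assms(1)
  proof (induction S)
    case (insert i S)
    then show ?case using L2_set_triangle_ineq[of "\<lambda>l. f l (y i)" "\<lambda>l. \<Sum>i\<in>S. f l (y i)" L] by simp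
  qed (simp add: L2_set_0')
  have "L2_set (\<lambda>l. avg S (f l) y) L = L2_set (\<lambda>l. (1 / real (card S)) * (\<Sum>i\<in>S. f l (y i))) L"
    by (simp add: avg_def)
  also have "\<dots> = L2_set (\<lambda>l. \<Sum>i\<in>S. f l (y i)) L / real (card S)" by (subst L2_set_cmult) simp
  also have "\<dots> \<le> avg S b y" unfolding avg_def
    by (intro divide_right_mono order_trans[OF sumle] sum_mono assms(3)) auto
  finally show ?thesis .
qed

definition mass :: "nat \<Rightarrow> nat \<Rightarrow> codebook \<Rightarrow> nat \<Rightarrow> pt measure \<Rightarrow> real" where
  "mass d k c j x = measure x (cell d k c j)"

definition moment :: "nat \<Rightarrow> nat \<Rightarrow> codebook \<Rightarrow> nat \<Rightarrow> nat \<Rightarrow> pt measure \<Rightarrow> real" where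
  "moment d k c j l x = (\<integral>u. indicator (cell d k c j) u * u l \<partial>x)"

text \<open>
  The map \<open>\<pi>\<close> is the projection onto the ball in the mini-batch algorithm and
  the identity in the centroid version, whose two batches \<open>S1\<close> and
  \<open>S2\<close> coincide.
\<close>

definition mb_step :: "nat \<Rightarrow> nat \<Rightarrow> (pt \<Rightarrow> pt) \<Rightarrow> nat \<Rightarrow> nat set \<Rightarrow> nat set \<Rightarrow> codebook \<Rightarrow> (nat \<Rightarrow> pt measure) \<Rightarrow> codebook" where
  "mb_step d k \<pi> t S1 S2 c xs = (\<lambda>j\<in>{1..k}.
     if measure (batch_mean d xs S1) (cell d k c j) = 0 then c j
     else \<pi> (raw_update d k xs S1 S2 t c j))"

lemma integral_indicator_ball_measures:
  "x \<in> space (ball_measures d R M) \<Longrightarrow> A \<in> sets (euc d) \<Longrightarrow> (\<integral>u. indicator A u \<partial>x) = measure x A"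
  using sets.sets_into_space[of A "euc d"] ball_measuresD(2)[of x d R M] by (simp add: Int_absorb2)

lemma integrable_ball_bounded_measures:
  "x \<in> space (ball_measures d R M) \<Longrightarrow> ball_bounded d R f \<Longrightarrow> integrable x f"
  unfolding ball_bounded_def using integrable_ball_measures by blast

lemma raw_update_eq:
  assumes y: "\<And>i. i \<in> S1 \<union> S2 \<Longrightarrow> y i \<in> space (ball_measures d R M)" and M: "0 \<le> M"
    and S: "finite S1" "S1 \<noteq> {}" "finite S2" "S2 \<noteq> {}"
    and c: "c \<in> codebooks d k" and j: "j \<in> {1..k}" and l: "l \<in> {1..d}"
  shows "raw_update d k y S1 S2 t c j l = c j l -
    (c j l * avg S2 (mass d k c j) y - avg S2 (moment d k c j l) y) / (real (t + 1) * avg S1 (mass d k c j) y)"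
proof -
  have bb: "ball_bounded d R (\<lambda>u. (c j l - u l) * indicator (cell d k c j) u)"
    by (intro ball_bounded_intros l sets_cell[OF c j])
  then obtain b where m: "(\<lambda>u. (c j l - u l) * indicator (cell d k c j) u) \<in> borel_measurable (euc d)"
    and b: "\<And>u. u \<in> eball d (origin d) R \<Longrightarrow> \<bar>(c j l - u l) * indicator (cell d k c j) u\<bar> \<le> b"
    unfolding ball_bounded_def by blast
  have "(\<integral>u. (c j l - u l) * indicator (cell d k c j) u \<partial>batch_mean d y S2) =
      (\<Sum>i\<in>S2. \<integral>u. (c j l - u l) * indicator (cell d k c j) u \<partial>y i) / real (card S2)"
    by (rule integral_batch_mean[OF S(3,4) _ M m b]) (use y in auto)
  also have "(\<Sum>i\<in>S2. \<integral>u. (c j l - u l) * indicator (cell d k c j) u \<partial>y i) =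
      (\<Sum>i\<in>S2. c j l * mass d k c j (y i) - moment d k c j l (y i))"
  proof (rule sum.cong[OF refl])
    fix i assume "i \<in> S2"
    then have yi: "y i \<in> space (ball_measures d R M)" using y by auto
    have "(\<integral>u. (c j l - u l) * indicator (cell d k c j) u \<partial>y i) =
      (\<integral>u. c j l * indicator (cell d k c j) u - indicator (cell d k c j) u * u l \<partial>y i)"
      by (simp add: algebra_simps)
    also have "\<dots> = (\<integral>u. c j l * indicator (cell d k c j) u \<partial>y i) - (\<integral>u. indicator (cell d k c j) u * u l \<partial>y i)"
      by (rule Bochner_Integration.integral_diff)
         (intro integrable_ball_bounded_measures[OF yi] ball_bounded_intros l sets_cell[OF c j])+
    finally show "(\<integral>u. (c j l - u l) * indicator (cell d k c j) u \<partial>y i) = c j l * mass d k c j (y i) - moment d k c j l (y i)"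
      using integral_indicator_ball_measures[OF yi sets_cell[OF c j]] by (simp add: mass_def moment_def)
  qed
  also have "\<dots> / real (card S2) = c j l * avg S2 (mass d k c j) y - avg S2 (moment d k c j l) y"
    using avg_diff[of S2 "\<lambda>x. c j l * mass d k c j x" "moment d k c j l" y] avg_cmult[of S2 "c j l"]
    by (simp add: avg_def)
  finally have 1: "(\<integral>u. (c j l - u l) * indicator (cell d k c j) u \<partial>batch_mean d y S2) =
    c j l * avg S2 (mass d k c j) y - avg S2 (moment d k c j l) y" .
  have 2: "measure (batch_mean d y S1) (cell d k c j) = avg S1 (mass d k c j) y"
    unfolding avg_def mass_def by (rule measure_batch_mean[OF S(1,2) _ M sets_cell[OF c j]]) (use y in auto)
  show ?thesis unfolding raw_update_def using l by (simp add: 1 2)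
qed

lemma mb_step_eq:
  assumes y: "\<And>i. i \<in> S1 \<Longrightarrow> y i \<in> space (ball_measures d R M)" and M: "0 \<le> M"
    and S: "finite S1" "S1 \<noteq> {}"
    and c: "c \<in> codebooks d k" and j: "j \<in> {1..k}"
  shows "mb_step d k \<pi> t S1 S2 c y j =
    (if avg S1 (mass d k c j) y = 0 then c j else \<pi> (raw_update d k y S1 S2 t c j))"
proof -
  have "measure (batch_mean d y S1) (cell d k c j) = avg S1 (mass d k c j) y"
    unfolding avg_def mass_def by (rule measure_batch_mean[OF S(1,2) _ M sets_cell[OF c j]]) (use y in auto)
  then show ?thesis using j by (simp add: mb_step_def)
qed

lemma measurable_mass:
  assumes [measurable]: "C \<in> Z \<rightarrow>\<^sub>M code_space d k" "K \<in> Z \<rightarrow>\<^sub>M ball_measures d R M" and M: "0 < M" and j: "j \<in> {1..k}"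
  shows "(\<lambda>z. mass d k (C z) j (K z)) \<in> borel_measurable Z"
proof -
  have [measurable]: "Measurable.pred (Z \<Otimes>\<^sub>M euc d) (\<lambda>w. snd w \<in> cell d k (C (fst w)) j)"
    by (rule measurable_pred_cell[OF _ _ j]) measurable
  have "(\<lambda>w. indicator {w. snd w \<in> cell d k (C (fst w)) j} w :: real) \<in> borel_measurable (Z \<Otimes>\<^sub>M euc d)"
    by measurable
  then have f: "(\<lambda>(z, u). indicator (cell d k (C z) j) u :: real) \<in> borel_measurable (Z \<Otimes>\<^sub>M euc d)"
    by (rule measurable_cong[THEN iffD1, rotated]) (auto simp: indicator_def)
  have "(\<lambda>z. \<integral>u. indicator (cell d k (C z) j) u \<partial>K z :: real) \<in> borel_measurable Z"
    by (rule borel_measurable_integral_ball_measures[where f = "\<lambda>z. indicator (cell d k (C z) j)",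
          OF assms(2) M f, where b = "\<lambda>_. 1"]) (auto simp: indicator_def)
  then show ?thesis
  proof (rule measurable_cong[THEN iffD1, rotated])
    fix z assume z: "z \<in> space Z"
    show "(\<integral>u. indicator (cell d k (C z) j) u \<partial>K z) = mass d k (C z) j (K z)"
      unfolding mass_def
      by (rule integral_indicator_ball_measures[OF measurable_space[OF assms(2) z]])
         (rule sets_cell[OF measurable_space[OF assms(1) z, unfolded space_code_space] j])
  qed
qed

lemma measurable_moment:
  assumes [measurable]: "C \<in> Z \<rightarrow>\<^sub>M code_space d k" "K \<in> Z \<rightarrow>\<^sub>M ball_measures d R M" and M: "0 < M" and j: "j \<in> {1..k}"
    and l: "l \<in> {1..d}"
  shows "(\<lambda>z. moment d k (C z) j l (K z)) \<in> borel_measurable Z"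
proof -
  have [measurable]: "Measurable.pred (Z \<Otimes>\<^sub>M euc d) (\<lambda>w. snd w \<in> cell d k (C (fst w)) j)"
    by (rule measurable_pred_cell[OF _ _ j]) measurable
  have [measurable]: "(\<lambda>w. snd w l) \<in> borel_measurable (Z \<Otimes>\<^sub>M euc d)"
    using l by (intro measurable_euc_component) auto
  have "(\<lambda>w. indicator {w. snd w \<in> cell d k (C (fst w)) j} w * snd w l :: real) \<in> borel_measurable (Z \<Otimes>\<^sub>M euc d)"
    by measurable
  then have f: "(\<lambda>(z, u). indicator (cell d k (C z) j) u * u l :: real) \<in> borel_measurable (Z \<Otimes>\<^sub>M euc d)"
    by (rule measurable_cong[THEN iffD1, rotated]) (auto simp: indicator_def)
  obtain b where b: "\<And>u. u \<in> eball d (origin d) R \<Longrightarrow> \<bar>u l\<bar> \<le> b"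
    using ball_bounded_coord[OF l, of R] unfolding ball_bounded_def by blast
  show ?thesis unfolding moment_def
    by (rule borel_measurable_integral_ball_measures[OF assms(2) M f, where b = "\<lambda>_. \<bar>b\<bar>"])
       (use b in \<open>force simp: indicator_def\<close>)
qed

lemma measurable_avg:
  assumes "\<And>i. i \<in> S \<Longrightarrow> (\<lambda>z. f z (Y z i)) \<in> borel_measurable Z"
  shows "(\<lambda>z. avg S (f z) (Y z)) \<in> borel_measurable Z"
  unfolding avg_def using assms by (intro borel_measurable_divide borel_measurable_sum) auto

lemma measurable_mb_step:
  assumes C: "C \<in> Z \<rightarrow>\<^sub>M code_space d k" and Y: "\<And>i. i \<in> S1 \<union> S2 \<Longrightarrow> (\<lambda>z. Y z i) \<in> Z \<rightarrow>\<^sub>M ball_measures d R M"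
    and M: "0 < M" and S: "finite S1" "S1 \<noteq> {}" "finite S2" "S2 \<noteq> {}" and \<pi>: "\<pi> \<in> euc d \<rightarrow>\<^sub>M euc d"
  shows "(\<lambda>z. mb_step d k \<pi> t S1 S2 (C z) (Y z)) \<in> Z \<rightarrow>\<^sub>M code_space d k"
  unfolding mb_step_def
proof (rule measurable_restrict)
  fix j assume j: "j \<in> {1..k}"
  have m: "(\<lambda>z. avg S (mass d k (C z) j) (Y z)) \<in> borel_measurable Z" if "S \<subseteq> S1 \<union> S2" for S
    by (rule measurable_avg[where f = "\<lambda>z. mass d k (C z) j"], rule measurable_mass[OF C Y M j]) (use that in auto)
  have q: "(\<lambda>z. avg S2 (moment d k (C z) j l) (Y z)) \<in> borel_measurable Z" if "l \<in> {1..d}" for l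
    by (rule measurable_avg[where f = "\<lambda>z. moment d k (C z) j l"], rule measurable_moment[OF C Y M j that]) auto
  have Cj: "(\<lambda>z. C z j) \<in> Z \<rightarrow>\<^sub>M euc d" by (rule measurable_compose[OF C measurable_component_singleton[OF j]])
  note [measurable] = m[of S1, simplified] m[of S2, simplified] q
  have c: "C z \<in> codebooks d k" if "z \<in> space Z" for z
    using measurable_space[OF C that] unfolding space_code_space .
  have y: "Y z i \<in> space (ball_measures d R M)" if "z \<in> space Z" "i \<in> S1 \<union> S2" for z i
    using measurable_space[OF Y[OF that(2)] that(1)] .
  have raw: "(\<lambda>z. raw_update d k (Y z) S1 S2 t (C z) j) \<in> Z \<rightarrow>\<^sub>M euc d"
  proof (rule measurable_eucI)
    fix l assume l: "l \<in> {1..d}"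
    have [measurable]: "(\<lambda>z. C z j l) \<in> borel_measurable Z" by (rule measurable_euc_component[OF Cj l])
    have [measurable]: "(\<lambda>z. avg S2 (moment d k (C z) j l) (Y z)) \<in> borel_measurable Z" by (rule q[OF l])
    have "(\<lambda>z. C z j l - (C z j l * avg S2 (mass d k (C z) j) (Y z) - avg S2 (moment d k (C z) j l) (Y z)) /
        (real (t + 1) * avg S1 (mass d k (C z) j) (Y z))) \<in> borel_measurable Z"
      by measurable
    then show "(\<lambda>z. raw_update d k (Y z) S1 S2 t (C z) j l) \<in> borel_measurable Z"
    proof (rule measurable_cong[THEN iffD1, rotated])
      fix z assume z: "z \<in> space Z"
      show "C z j l - (C z j l * avg S2 (mass d k (C z) j) (Y z) - avg S2 (moment d k (C z) j l) (Y z)) /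
        (real (t + 1) * avg S1 (mass d k (C z) j) (Y z)) = raw_update d k (Y z) S1 S2 t (C z) j l"
        by (rule raw_update_eq[OF y[OF z] less_imp_le[OF M] S c[OF z] j l, symmetric])
    qed
  qed (auto simp: raw_update_def space_euc)
  have "(\<lambda>z. if avg S1 (mass d k (C z) j) (Y z) = 0 then C z j else \<pi> (raw_update d k (Y z) S1 S2 t (C z) j)) \<in> Z \<rightarrow>\<^sub>M euc d"
  proof (rule measurable_If[OF Cj measurable_compose[OF raw \<pi>]])
    show "{z \<in> space Z. avg S1 (mass d k (C z) j) (Y z) = 0} \<in> sets Z"
      using m[of S1] by measurable
  qed
  then show "(\<lambda>z. if measure (batch_mean d (Y z) S1) (cell d k (C z) j) = 0 then C z j
      else \<pi> (raw_update d k (Y z) S1 S2 t (C z) j)) \<in> Z \<rightarrow>\<^sub>M euc d"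
  proof (rule measurable_cong[THEN iffD1, rotated])
    fix z assume z: "z \<in> space Z"
    have "measure (batch_mean d (Y z) S1) (cell d k (C z) j) = avg S1 (mass d k (C z) j) (Y z)"
      unfolding avg_def mass_def
      by (rule measure_batch_mean[OF S(1,2) _ less_imp_le[OF M] sets_cell[OF c[OF z] j]]) (use y[OF z] in auto)
    then show "(if avg S1 (mass d k (C z) j) (Y z) = 0 then C z j else \<pi> (raw_update d k (Y z) S1 S2 t (C z) j)) =
      (if measure (batch_mean d (Y z) S1) (cell d k (C z) j) = 0 then C z j else \<pi> (raw_update d k (Y z) S1 S2 t (C z) j))"
      by simp
  qed
qed

lemma measurable_cdist [measurable (raw)]:
  assumes C: "C \<in> Z \<rightarrow>\<^sub>M code_space d k" and C': "C' \<in> Z \<rightarrow>\<^sub>M code_space d k"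
  shows "(\<lambda>z. cdist d k (C z) (C' z)) \<in> borel_measurable Z"
proof -
  have "(\<lambda>z. (edist d (C z j) (C' z j))\<^sup>2) \<in> borel_measurable Z" if "j \<in> {1..k}" for j
    using measurable_compose[OF C measurable_component_singleton[OF that]]
      measurable_compose[OF C' measurable_component_singleton[OF that]]
    by (intro borel_measurable_power borel_measurable_edist)
  then show ?thesis unfolding cdist_def L2_set_def
    by (intro measurable_compose[OF borel_measurable_sum borel_measurable_sqrt]) auto
qed

lemma mass_nonneg: "0 \<le> mass d k c j x" by (simp add: mass_def)

lemma moment_norm_le:
  assumes x: "x \<in> space (ball_measures d R M)" and c: "c \<in> codebooks d k" and j: "j \<in> {1..k}"
  shows "L2_set (\<lambda>l. moment d k c j l x) {1..d} \<le> R * mass d k c j x"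
proof -
  have "L2_set (\<lambda>l. \<integral>u. indicator (cell d k c j) u * u l \<partial>x) {1..d} \<le> (\<integral>u. R * indicator (cell d k c j) u \<partial>x)"
  proof (rule L2_set_integral_le)
    show "AE u in x. L2_set (\<lambda>l. indicator (cell d k c j) u * u l) {1..d} \<le> R * indicator (cell d k c j) u"
      using ball_measuresD(4)[OF x] by eventually_elim (auto simp: L2_set_cmult eball_origin indicator_def L2_set_0')
  qed (auto intro!: integrable_ball_bounded_measures[OF x] ball_bounded_intros sets_cell[OF c j])
  then show ?thesis
    using integral_indicator_ball_measures[OF x sets_cell[OF c j]] by (simp add: moment_def mass_def)
qed

lemma sum_mass_le:
  assumes x: "x \<in> space (ball_measures d R M)" and M: "0 \<le> M" and c: "c \<in> codebooks d k"
  shows "(\<Sum>j\<in>{1..k}. mass d k c j x) \<le> M"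
proof -
  interpret finite_measure x by (rule ball_measuresD(3)[OF x])
  have "(\<Sum>j\<in>{1..k}. measure x (cell d k c j)) = measure x (\<Union>j\<in>{1..k}. cell d k c j)"
  proof (rule finite_measure_finite_Union[symmetric])
    show "disjoint_family_on (cell d k c) {1..k}"
      unfolding disjoint_family_on_def using cell_unique by blast
  qed (use sets_cell[OF c] in \<open>auto simp: ball_measuresD(1)[OF x]\<close>)
  also have "\<dots> \<le> M" by (rule ball_measuresD(6)[OF x M])
  finally show ?thesis by (simp add: mass_def)
qed

text \<open>
  Without projection, the new code point is a convex combination of the old one and of the mean
  of the batch over the cell, which lies in the ball.
\<close>

lemma mb_step_norm_le:
  assumes y: "\<And>i. i \<in> S1 \<union> S2 \<Longrightarrow> y i \<in> space (ball_measures d R M)" and M: "0 \<le> M"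
    and S: "finite S1" "S1 \<noteq> {}" "finite S2" "S2 \<noteq> {}" and c: "c \<in> codebooks d k"
    and \<pi>: "(\<forall>x\<in>space (euc d). \<pi> x \<in> eball d (origin d) R) \<or> (S1 = S2 \<and> \<pi> = (\<lambda>x. x))"
    and r: "R \<le> r" and b: "\<And>j. j \<in> {1..k} \<Longrightarrow> L2_set (c j) {1..d} \<le> r" and j: "j \<in> {1..k}"
  shows "L2_set (mb_step d k \<pi> t S1 S2 c y j) {1..d} \<le> r"
proof (cases "avg S1 (mass d k c j) y = 0")
  case True
  have y1: "\<And>i. i \<in> S1 \<Longrightarrow> y i \<in> space (ball_measures d R M)" using y by blast
  from True have "mb_step d k \<pi> t S1 S2 c y j = c j"
    using mb_step_eq[OF y1 M S(1,2) c j] by simp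
  then show ?thesis using b[OF j] by simp
next
  case False
  have y1: "\<And>i. i \<in> S1 \<Longrightarrow> y i \<in> space (ball_measures d R M)" using y by blast
  have eq: "mb_step d k \<pi> t S1 S2 c y j = \<pi> (raw_update d k y S1 S2 t c j)"
    using mb_step_eq[OF y1 M S(1,2) c j] False by simp
  from \<pi> show ?thesis
  proof
    assume pb: "\<forall>x\<in>space (euc d). \<pi> x \<in> eball d (origin d) R"
    have "raw_update d k y S1 S2 t c j \<in> space (euc d)" by (simp add: raw_update_def space_euc)
    then have "\<pi> (raw_update d k y S1 S2 t c j) \<in> eball d (origin d) R" using pb by blast
    then show ?thesis unfolding eq eball_origin using r by linarith
  next
    assume SS: "S1 = S2 \<and> \<pi> = (\<lambda>x. x)"
    define a where "a = avg S2 (mass d k c j) y"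
    have "0 \<le> a" unfolding a_def avg_def by (intro divide_nonneg_nonneg sum_nonneg mass_nonneg) simp
    moreover have "a \<noteq> 0" using False SS by (simp add: a_def)
    ultimately have a: "0 < a" by simp
    define s where "s = 1 / real (t + 1)"
    have s: "0 < s" "s \<le> 1" by (auto simp: s_def)
    have q: "L2_set (\<lambda>l. avg S2 (moment d k c j l) y) {1..d} \<le> R * a"
      unfolding a_def avg_cmult[symmetric]
      by (rule L2_set_avg_le[OF S(3,4)]) (rule moment_norm_le[OF _ c j], use y in auto)
    have "L2_set (mb_step d k \<pi> t S1 S2 c y j) {1..d} =
      L2_set (\<lambda>l. (1 - s) * c j l + (s / a) * avg S2 (moment d k c j l) y) {1..d}"
    proof (rule L2_set_cong[OF refl])
      fix l assume l: "l \<in> {1..d}"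
      show "mb_step d k \<pi> t S1 S2 c y j l = (1 - s) * c j l + (s / a) * avg S2 (moment d k c j l) y"
      proof -
        have "raw_update d k y S1 S2 t c j l = c j l -
          (c j l * avg S2 (mass d k c j) y - avg S2 (moment d k c j l) y) / (real (t + 1) * avg S1 (mass d k c j) y)"
          by (rule raw_update_eq[OF y M S c j l])
        also have "\<dots> = c j l - s * ((c j l * a - avg S2 (moment d k c j l) y) / a)"
          using SS by (simp add: a_def s_def)
        also have "\<dots> = (1 - s) * c j l + (s / a) * avg S2 (moment d k c j l) y"
          using a by (simp add: field_simps)
        finally show ?thesis unfolding eq using SS by simp
      qed
    qed
    also have "\<dots> \<le> L2_set (\<lambda>l. (1 - s) * c j l) {1..d} + L2_set (\<lambda>l. (s / a) * avg S2 (moment d k c j l) y) {1..d}"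
      by (rule L2_set_triangle_ineq)
    also have "\<dots> = (1 - s) * L2_set (c j) {1..d} + (s / a) * L2_set (\<lambda>l. avg S2 (moment d k c j l) y) {1..d}"
      unfolding L2_set_cmult using s a by simp
    also have "\<dots> \<le> (1 - s) * r + (s / a) * (R * a)"
      using s a q b[OF j] by (intro add_mono mult_left_mono) auto
    also have "\<dots> \<le> (1 - s) * r + s * r" using a s r by simp
    finally show ?thesis by (simp add: algebra_simps)
  qed
qed

text \<open>
  Integrating out coordinate \<open>i\<close> first leaves a multiple of the mean of
  \<open>f\<close>.
\<close>

lemma integral_PiM_eq_0:
  fixes h :: "(nat \<Rightarrow> 'x) \<Rightarrow> real"
  assumes \<nu>: "prob_space \<nu>" and J: "finite J" "i \<in> J"
    and hm: "h \<in> borel_measurable (Pi\<^sub>M J (\<lambda>_. \<nu>))" and hb: "\<And>y. y \<in> space (Pi\<^sub>M J (\<lambda>_. \<nu>)) \<Longrightarrow> \<bar>h y\<bar> \<le> b"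
    and f: "(\<integral>z. f z \<partial>\<nu>) = 0" "f \<in> borel_measurable \<nu>"
    and fac: "\<And>x. x \<in> space (Pi\<^sub>M (J - {i}) (\<lambda>_. \<nu>)) \<Longrightarrow> \<exists>g. AE z in \<nu>. h (x(i := z)) = f z * g"
  shows "(\<integral>y. h y \<partial>Pi\<^sub>M J (\<lambda>_. \<nu>)) = 0"
proof -
  interpret \<nu>: prob_space \<nu> by fact
  interpret product_prob_space "\<lambda>_. \<nu>" J by standard
  have ins: "insert i (J - {i}) = J" using J by auto
  have hm': "h \<in> borel_measurable (Pi\<^sub>M (insert i (J - {i})) (\<lambda>_. \<nu>))" unfolding ins by (rule hm)
  have int: "integrable (Pi\<^sub>M (insert i (J - {i})) (\<lambda>_. \<nu>)) h"
    unfolding ins by (rule P.integrable_const_bound[where B = b]) (use hb hm in auto)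
  have "(\<integral>y. h y \<partial>Pi\<^sub>M (insert i (J - {i})) (\<lambda>_. \<nu>)) =
      (\<integral>x. (\<integral>z. h (x(i := z)) \<partial>\<nu>) \<partial>Pi\<^sub>M (J - {i}) (\<lambda>_. \<nu>))"
    by (rule product_integral_insert) (use int J in auto)
  also have "\<dots> = (\<integral>x. 0 \<partial>Pi\<^sub>M (J - {i}) (\<lambda>_. \<nu>))"
  proof (rule Bochner_Integration.integral_cong[OF refl])
    fix x assume x: "x \<in> space (Pi\<^sub>M (J - {i}) (\<lambda>_. \<nu>))"
    from fac[OF x] obtain g where g: "AE z in \<nu>. h (x(i := z)) = f z * g" by blast
    have [measurable]: "(\<lambda>z. h (x(i := z))) \<in> borel_measurable \<nu>"
      using measurable_comp[OF measurable_component_update[OF x, of i] hm'] by (simp add: comp_def)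
    have "(\<integral>z. h (x(i := z)) \<partial>\<nu>) = (\<integral>z. f z * g \<partial>\<nu>)"
      by (rule integral_cong_AE) (use g f(2) in auto)
    then show "(\<integral>z. h (x(i := z)) \<partial>\<nu>) = 0" using f(1) by simp
  qed
  finally show ?thesis unfolding ins by simp
qed

section \<open>The law of one observation\<close>

text \<open>
  The measure \<open>\<nu>\<close> is the distribution of one random measure, and
  \<open>\<mu>\<close> is its mean measure.
\<close>

locale sample_law = margin_distribution d k R \<mu> r0 cs
  for d k :: nat and R :: real and \<mu> :: "pt measure" and r0 :: real and cs :: codebook +
  fixes M :: real and \<nu> :: "pt measure measure"
  assumes prob_\<nu>: "prob_space \<nu>"
    and sets_\<nu>: "sets \<nu> = sets (ball_measures d R M)"
    and mean_\<nu>: "\<And>A. A \<in> sets (euc d) \<Longrightarrow> emeasure \<mu> A = (\<integral>\<^sup>+ x. emeasure x A \<partial>\<nu>)"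
begin

sublocale \<nu>: prob_space \<nu> by (rule prob_\<nu>)

lemma space_\<nu>: "space \<nu> = space (ball_measures d R M)"
  by (rule sets_eq_imp_space_eq[OF sets_\<nu>])

lemma measure_\<mu>_le: "measure \<mu> (space \<mu>) \<le> M" and M_pos: "0 < M"
proof -
  have "emeasure \<mu> (space \<mu>) = (\<integral>\<^sup>+ x. emeasure x (space (euc d)) \<partial>\<nu>)"
    unfolding space_\<mu> by (rule mean_\<nu>) simp
  also have "\<dots> \<le> (\<integral>\<^sup>+ x. ennreal M \<partial>\<nu>)"
    by (rule nn_integral_mono) (use ball_measuresD(2,5) in \<open>force simp: space_\<nu>\<close>)
  also have "\<dots> = ennreal M" by (simp add: \<nu>.emeasure_space_1)
  finally have le: "ennreal (measure \<mu> (space \<mu>)) \<le> ennreal M" by (simp add: emeasure_eq_measure)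
  have "0 < real k * p" using k_ge_2 p_pos by simp
  also have "\<dots> \<le> measure \<mu> (space \<mu>)" by (rule k_p_min_le[OF opt_cs])
  finally have pos: "0 < measure \<mu> (space \<mu>)" .
  show "0 < M"
  proof (rule ccontr)
    assume "\<not> 0 < M"
    then have "ennreal M = 0" by (simp add: ennreal_eq_0_iff)
    then show False using le pos by simp
  qed
  then show "measure \<mu> (space \<mu>) \<le> M" using le by simp
qed

lemma M0: "0 \<le> M" using M_pos by simp

lemma k_p_le: "real k * p \<le> M"
  using k_p_min_le[OF opt_cs] measure_\<mu>_le by linarith

lemma p_le: "2 * p \<le> M"
proof -
  have "2 * p \<le> real k * p" using k_ge_2 p_pos by (intro mult_right_mono) auto
  then show ?thesis using k_p_le by linarith
qed

lemma id_measurable_\<nu>: "(\<lambda>x. x) \<in> \<nu> \<rightarrow>\<^sub>M ball_measures d R M"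
  by (simp add: measurable_cong_sets[OF sets_\<nu> refl])

lemma integral_\<nu>_integral:
  assumes "ball_bounded d R f"
  shows "integrable \<nu> (\<lambda>x. \<integral>u. f u \<partial>x)" "(\<integral>x. (\<integral>u. f u \<partial>x) \<partial>\<nu>) = (\<integral>u. f u \<partial>\<mu>)"
proof -
  from assms obtain b where m: "f \<in> borel_measurable (euc d)" and b: "\<And>u. u \<in> eball d (origin d) R \<Longrightarrow> \<bar>f u\<bar> \<le> b"
    unfolding ball_bounded_def by blast
  have em: "(\<lambda>x. emeasure x A) \<in> borel_measurable \<nu>" if "A \<in> sets (euc d)" for A
    using measurable_compose[OF id_measurable_\<nu> measurable_emeasure_ball_measures[OF that]] .
  have sp: "x \<in> space (ball_measures d R M)" if "x \<in> space \<nu>" for x using that by (simp add: space_\<nu>)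
  note mix = integral_mixture[OF sets_\<mu> mean_\<nu> sp em \<nu>.finite_measure_axioms M0 m b]
  show "integrable \<nu> (\<lambda>x. \<integral>u. f u \<partial>x)" by (rule mix(2))
  show "(\<integral>x. (\<integral>u. f u \<partial>x) \<partial>\<nu>) = (\<integral>u. f u \<partial>\<mu>)" by (rule mix(3)[symmetric])
qed

lemma mu_in_ball_measures: "\<mu> \<in> space (ball_measures d R M)"
proof -
  have "emeasure \<mu> (space \<mu> - eball d (origin d) R) = 0"
  proof -
    have "AE u in \<mu>. u \<notin> space \<mu> - eball d (origin d) R" using AE_ball by auto
    moreover have "space \<mu> - eball d (origin d) R \<in> sets \<mu>"
      unfolding sets_\<mu> space_\<mu> using sets_eball[OF space_euc_nonempty] by auto
    ultimately show ?thesis using AE_iff_null_sets by blast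
  qed
  then show ?thesis
    using measure_\<mu>_le by (simp add: space_ball_measures sets_\<mu> emeasure_eq_measure ennreal_leI)
qed

lemma measurable_distortion:
  assumes C: "C \<in> Z \<rightarrow>\<^sub>M code_space d k"
  shows "(\<lambda>z. distortion d k \<mu> (C z)) \<in> borel_measurable Z"
proof -
  have Cj: "(\<lambda>w. C (fst w) j) \<in> Z \<Otimes>\<^sub>M euc d \<rightarrow>\<^sub>M euc d" if "j \<in> {1..k}" for j
    using measurable_compose[OF measurable_compose[OF measurable_fst C] measurable_component_singleton[OF that]] .
  have m: "(\<lambda>w. MIN j\<in>{1..k}. (edist d (snd w) (C (fst w) j))\<^sup>2) \<in> borel_measurable (Z \<Otimes>\<^sub>M euc d)"
    by (rule borel_measurable_Min) (auto intro!: borel_measurable_power borel_measurable_edist Cj)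
  then have f: "(\<lambda>(z, u). err (C z) u) \<in> borel_measurable (Z \<Otimes>\<^sub>M euc d)"
    by (simp add: err_def case_prod_beta')
  have c: "C z \<in> codebooks d k" if "z \<in> space Z" for z
    using measurable_space[OF C that] unfolding space_code_space .
  have "\<exists>b. \<forall>z\<in>space Z. \<forall>u\<in>eball d (origin d) R. \<bar>err (C z) u\<bar> \<le> b z"
    using ball_bounded_err[OF c] unfolding ball_bounded_def by metis
  then obtain b where b: "\<And>z u. z \<in> space Z \<Longrightarrow> u \<in> eball d (origin d) R \<Longrightarrow> \<bar>err (C z) u\<bar> \<le> b z" by blast
  have K: "(\<lambda>_. \<mu>) \<in> Z \<rightarrow>\<^sub>M ball_measures d R M" using mu_in_ball_measures by simp
  show ?thesis unfolding distortion_err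
    by (rule borel_measurable_integral_ball_measures[OF K M_pos f b])
qed

text \<open>
  The contribution of one observation to the numerator of the update, recentred at the cell
  mean: the numerator equals \<open>(c j - cell_mean c j)\<close> times the estimated mass, plus
  the average of \<open>\<xi>\<close>.
\<close>

definition \<xi> :: "codebook \<Rightarrow> nat \<Rightarrow> nat \<Rightarrow> pt measure \<Rightarrow> real" where
  "\<xi> c j l x = cell_mean c j l * mass d k c j x - moment d k c j l x"

context
  fixes c :: codebook
  assumes c: "c \<in> codebooks d k" and near: "cdist d k cs c \<le> R0"
begin

lemma mass_integral:
  assumes j: "j \<in> {1..k}"
  shows "integrable \<nu> (mass d k c j)" "(\<integral>x. mass d k c j x \<partial>\<nu>) = measure \<mu> (cell d k c j)"
proof -
  note bb = ball_bounded_indicator[OF sets_cell[OF c j], of R]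
  have eq: "(\<integral>u. indicator (cell d k c j) u \<partial>x) = mass d k c j x" if "x \<in> space \<nu>" for x
    using integral_indicator_ball_measures[OF _ sets_cell[OF c j]] that by (simp add: mass_def space_\<nu>)
  show "integrable \<nu> (mass d k c j)"
    by (rule Bochner_Integration.integrable_cong[THEN iffD1, OF refl eq integral_\<nu>_integral(1)[OF bb]])
  have "(\<integral>x. mass d k c j x \<partial>\<nu>) = (\<integral>x. (\<integral>u. indicator (cell d k c j) u \<partial>x) \<partial>\<nu>)"
    by (rule Bochner_Integration.integral_cong[OF refl eq[symmetric]])
  also have "\<dots> = measure \<mu> (cell d k c j)"
    unfolding integral_\<nu>_integral(2)[OF bb] by (rule integral_indicator_eq[OF sets_cell[OF c j]])
  finally show "(\<integral>x. mass d k c j x \<partial>\<nu>) = measure \<mu> (cell d k c j)" .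
qed

lemma moment_integral:
  assumes j: "j \<in> {1..k}" and l: "l \<in> {1..d}"
  shows "integrable \<nu> (moment d k c j l)" "(\<integral>x. moment d k c j l x \<partial>\<nu>) = cell_moment c j l"
proof -
  have bb: "ball_bounded d R (\<lambda>u. indicator (cell d k c j) u * u l)"
    by (intro ball_bounded_intros sets_cell[OF c j] l)
  show "integrable \<nu> (moment d k c j l)" "(\<integral>x. moment d k c j l x \<partial>\<nu>) = cell_moment c j l"
    using integral_\<nu>_integral[OF bb] by (simp_all add: moment_def[abs_def] cell_moment_def)
qed

lemma \<xi>_integral:
  assumes j: "j \<in> {1..k}" and l: "l \<in> {1..d}"
  shows "integrable \<nu> (\<xi> c j l)" "(\<integral>x. \<xi> c j l x \<partial>\<nu>) = 0"
proof -
  show "integrable \<nu> (\<xi> c j l)"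
    unfolding \<xi>_def[abs_def] using mass_integral(1)[OF j] moment_integral(1)[OF j l] by auto
  have "(\<integral>x. \<xi> c j l x \<partial>\<nu>) = cell_mean c j l * measure \<mu> (cell d k c j) - cell_moment c j l"
    unfolding \<xi>_def using mass_integral[OF j] moment_integral[OF j l] by simp
  then show "(\<integral>x. \<xi> c j l x \<partial>\<nu>) = 0"
    using cell_mean_mult[OF mass_near_pos[OF c near j] l] by simp
qed

lemma \<xi>_norm_le:
  assumes x: "x \<in> space \<nu>" and j: "j \<in> {1..k}"
  shows "L2_set (\<lambda>l. \<xi> c j l x) {1..d} \<le> 2 * R * mass d k c j x"
proof -
  have x': "x \<in> space (ball_measures d R M)" using x by (simp add: space_\<nu>)
  note mb = cell_mean_in_ball[OF c j mass_near_pos[OF c near j]]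
  have "L2_set (\<lambda>l. \<xi> c j l x) {1..d} = L2_set (\<lambda>l. \<integral>u. indicator (cell d k c j) u * (cell_mean c j l - u l) \<partial>x) {1..d}"
  proof (rule L2_set_cong[OF refl])
    fix l assume l: "l \<in> {1..d}"
    have "(\<integral>u. indicator (cell d k c j) u * (cell_mean c j l - u l) \<partial>x) =
      (\<integral>u. cell_mean c j l * indicator (cell d k c j) u - indicator (cell d k c j) u * u l \<partial>x)"
      by (simp add: algebra_simps)
    also have "\<dots> = (\<integral>u. cell_mean c j l * indicator (cell d k c j) u \<partial>x) - (\<integral>u. indicator (cell d k c j) u * u l \<partial>x)"
      by (rule Bochner_Integration.integral_diff)
         (intro integrable_ball_bounded_measures[OF x'] ball_bounded_intros sets_cell[OF c j] l)+
    finally show "\<xi> c j l x = (\<integral>u. indicator (cell d k c j) u * (cell_mean c j l - u l) \<partial>x)"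
      using integral_indicator_ball_measures[OF x' sets_cell[OF c j]] by (simp add: \<xi>_def mass_def moment_def)
  qed
  also have "\<dots> \<le> (\<integral>u. 2 * R * indicator (cell d k c j) u \<partial>x)"
  proof (rule L2_set_integral_le)
    show "AE u in x. L2_set (\<lambda>l. indicator (cell d k c j) u * (cell_mean c j l - u l)) {1..d} \<le> 2 * R * indicator (cell d k c j) u"
      using ball_measuresD(4)[OF x']
    proof eventually_elim
      case (elim u)
      show ?case using ball_dist_le[OF mb elim] by (simp add: L2_set_cmult edist_def indicator_def)
    qed
  qed (auto intro!: integrable_ball_bounded_measures[OF x'] ball_bounded_intros sets_cell[OF c j])
  also have "\<dots> = 2 * R * mass d k c j x"
    using integral_indicator_ball_measures[OF x' sets_cell[OF c j]] by (simp add: mass_def)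
  finally show ?thesis .
qed

lemma \<xi>_norm_le_all:
  assumes x: "x \<in> space \<nu>"
  shows "L2_set (\<lambda>(j, l). \<xi> c j l x) ({1..k} \<times> {1..d}) \<le> 2 * R * M"
proof -
  have "L2_set (\<lambda>(j, l). \<xi> c j l x) ({1..k} \<times> {1..d}) = L2_set (\<lambda>j. L2_set (\<lambda>l. \<xi> c j l x) {1..d}) {1..k}"
    by (rule L2_set_Sigma[symmetric]) auto
  also have "\<dots> \<le> (\<Sum>j\<in>{1..k}. L2_set (\<lambda>l. \<xi> c j l x) {1..d})" by (rule L2_set_le_sum) simp
  also have "\<dots> \<le> (\<Sum>j\<in>{1..k}. 2 * R * mass d k c j x)" by (rule sum_mono) (rule \<xi>_norm_le[OF x])
  also have "\<dots> = 2 * R * (\<Sum>j\<in>{1..k}. mass d k c j x)" by (simp add: sum_distrib_left)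
  also have "\<dots> \<le> 2 * R * M"
    using sum_mass_le[OF _ M0 c, of x R] x R_pos by (intro mult_left_mono) (auto simp: space_\<nu>)
  finally show ?thesis .
qed

lemma mass_dev_norm_le:
  assumes x: "x \<in> space \<nu>"
  shows "L2_set (\<lambda>j. mass d k c j x - measure \<mu> (cell d k c j)) {1..k} \<le> 2 * M"
proof -
  have "L2_set (\<lambda>j. mass d k c j x) {1..k} \<le> (\<Sum>j\<in>{1..k}. mass d k c j x)"
    by (rule L2_set_le_sum) (simp add: mass_nonneg)
  also have "\<dots> \<le> M" using sum_mass_le[OF _ M0 c, of x R] x by (simp add: space_\<nu>)
  finally have 1: "L2_set (\<lambda>j. mass d k c j x) {1..k} \<le> M" .
  have "L2_set (\<lambda>j. measure \<mu> (cell d k c j)) {1..k} \<le> (\<Sum>j\<in>{1..k}. measure \<mu> (cell d k c j))"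
    by (rule L2_set_le_sum) simp
  also have "\<dots> \<le> M" unfolding sum_mass_cells[OF c] by (rule measure_\<mu>_le)
  finally show ?thesis
    using 1 L2_set_diff_triangle[of "\<lambda>j. mass d k c j x" "\<lambda>j. measure \<mu> (cell d k c j)" "{1..k}"] by linarith
qed

end

end

section \<open>One step on a random batch\<close>

lemma cdist_nonneg: "0 \<le> cdist d k c c'"
  by (simp add: cdist_def)

text \<open>
  The only property of a point mass that matters for the centroid version: its masses on the
  cells are determined by the cell it falls into.
\<close>

definition single_cell :: "nat \<Rightarrow> nat \<Rightarrow> codebook \<Rightarrow> pt measure \<Rightarrow> bool" where
  "single_cell d k c x \<longleftrightarrow> (\<exists>a\<in>{1..k}. \<forall>j\<in>{1..k}. mass d k c j x = (if j = a then 1 else 0))"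

text \<open>
  The codebook \<open>c\<close> is fixed, the batch is random. Batch \<open>S1\<close> serves
  for the denominators and \<open>S2\<close> for the numerators; \<open>\<epsilon>\<close>
  bounds the probability of an atypical batch. The radius \<open>6 / 5 * R\<close> accommodates
  an initial codebook that is close to an optimal one but not inside the ball.
\<close>

locale batch_step = sample_law d k R \<mu> r0 cs M \<nu>
  for d k :: nat and R :: real and \<mu> :: "pt measure" and r0 :: real and cs :: codebook
    and M :: real and \<nu> :: "pt measure measure" +
  fixes c :: codebook and J S1 S2 :: "nat set" and t :: nat and \<pi> :: "pt \<Rightarrow> pt" and \<epsilon> :: real
  assumes c: "c \<in> codebooks d k" and near: "cdist d k cs c \<le> R0"
    and c_bound: "\<And>j. j \<in> {1..k} \<Longrightarrow> L2_set (c j) {1..d} \<le> 6 / 5 * R"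
    and J: "finite J" and S1: "S1 \<subseteq> J" "S1 \<noteq> {}" and S2: "S2 \<subseteq> J" "S2 \<noteq> {}"
    and \<pi>_meas: "\<pi> \<in> euc d \<rightarrow>\<^sub>M euc d"
    and \<pi>_nonexp: "\<And>x z. x \<in> space (euc d) \<Longrightarrow> z \<in> eball d (origin d) R \<Longrightarrow> edist d (\<pi> x) z \<le> edist d x z"
    and \<pi>_ball: "(\<forall>x\<in>space (euc d). \<pi> x \<in> eball d (origin d) R) \<or> (S1 = S2 \<and> \<pi> = (\<lambda>x. x))"
    and batches: "S1 \<inter> S2 = {} \<or> (S1 = S2 \<and> (AE x in \<nu>. single_cell d k c x))"
    and \<epsilon>: "\<And>S. S \<in> {S1, S2} \<Longrightarrow> 6 * exp (- (R0 * p / 50)\<^sup>2 * real (card S) / (16 * R\<^sup>2 * M\<^sup>2)) \<le> \<epsilon>"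
begin

abbreviation "Q \<equiv> Pi\<^sub>M J (\<lambda>_. \<nu>)"
abbreviation "q \<equiv> \<lambda>j. measure \<mu> (cell d k c j)"
abbreviation "I \<equiv> {1..k} \<times> {1..d}"

sublocale QP: product_prob_space "\<lambda>_. \<nu>" J by standard

lemma finS: "finite S1" "finite S2" using S1 S2 J finite_subset by blast+

lemma spaceQ: "y \<in> space Q \<Longrightarrow> i \<in> J \<Longrightarrow> y i \<in> space \<nu>"
  by (auto simp: space_PiM)

lemma spaceQ': "y \<in> space Q \<Longrightarrow> i \<in> S1 \<union> S2 \<Longrightarrow> y i \<in> space (ball_measures d R M)"
  using spaceQ S1 S2 by (auto simp: space_\<nu>)

lemma measurable_avgQ:
  assumes f: "f \<in> borel_measurable \<nu>" and S: "S \<in> {S1, S2}"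
  shows "avg S f \<in> borel_measurable Q"
proof -
  have "(\<lambda>y. avg S f (\<lambda>i. y i)) \<in> borel_measurable Q"
  proof (rule measurable_avg)
    fix i assume "i \<in> S"
    then have "i \<in> J" using S S1 S2 by auto
    then have "(\<lambda>y. y i) \<in> Q \<rightarrow>\<^sub>M \<nu>" by (rule measurable_component_singleton)
    then show "(\<lambda>y. f (y i)) \<in> borel_measurable Q" by (rule measurable_compose[OF _ f])
  qed
  then show ?thesis by simp
qed

lemma measurable_mass_avg: "j \<in> {1..k} \<Longrightarrow> S \<in> {S1, S2} \<Longrightarrow> avg S (mass d k c j) \<in> borel_measurable Q"
  by (rule measurable_avgQ) (use mass_integral(1)[OF c near] in auto)

lemma measurable_\<xi>_avg: "j \<in> {1..k} \<Longrightarrow> l \<in> {1..d} \<Longrightarrow> avg S2 (\<xi> c j l) \<in> borel_measurable Q"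
  by (rule measurable_avgQ) (use \<xi>_integral(1)[OF c near] in auto)

definition good_mass :: "nat set \<Rightarrow> (nat \<Rightarrow> pt measure) \<Rightarrow> bool" where
  "good_mass S y \<longleftrightarrow> L2_set (\<lambda>j. avg S (mass d k c j) y - q j) {1..k} < p / 50"

definition good_noise :: "(nat \<Rightarrow> pt measure) \<Rightarrow> bool" where
  "good_noise y \<longleftrightarrow> L2_set (\<lambda>(j, l). avg S2 (\<xi> c j l) y) I < R0 * p / 50"

lemma pred_good_mass: "S \<in> {S1, S2} \<Longrightarrow> Measurable.pred Q (good_mass S)"
proof -
  assume S: "S \<in> {S1, S2}"
  have "(\<lambda>y. L2_set (\<lambda>j. avg S (mass d k c j) y - q j) {1..k}) \<in> borel_measurable Q"
    unfolding L2_set_def using measurable_mass_avg[OF _ S]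
    by (intro measurable_compose[OF borel_measurable_sum borel_measurable_sqrt] borel_measurable_power borel_measurable_diff) auto
  then show ?thesis unfolding good_mass_def by measurable
qed

lemma pred_good_noise: "Measurable.pred Q good_noise"
proof -
  have "(\<lambda>y. L2_set (\<lambda>jl. avg S2 (\<xi> c (fst jl) (snd jl)) y) I) \<in> borel_measurable Q"
    unfolding L2_set_def using measurable_\<xi>_avg
    by (intro measurable_compose[OF borel_measurable_sum borel_measurable_sqrt] borel_measurable_power) auto
  then show ?thesis unfolding good_noise_def case_prod_beta' by measurable
qed

lemma prob_bad_mass:
  assumes S: "S \<in> {S1, S2}"
  shows "measure Q {y \<in> space Q. \<not> good_mass S y} \<le> \<epsilon> / 3"
proof -
  have SJ: "S \<subseteq> J" "S \<noteq> {}" "finite S" using S S1 S2 finS by auto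
  have "measure Q {y \<in> space Q. p / 50 \<le> L2_set (\<lambda>j. (\<Sum>i\<in>S. mass d k c j (y i) - q j) / real (card S)) {1..k}}
      \<le> 2 * exp (- (p / 50)\<^sup>2 * real (card S) / (4 * (2 * M)\<^sup>2))"
  proof (rule L2_set_mean_concentration[OF prob_\<nu>, where f = "\<lambda>j x. mass d k c j x - q j"])
    fix j assume j: "j \<in> {1..k}"
    note [simp] = mass_integral[OF c near j]
    show "(\<integral>x. mass d k c j x - q j \<partial>\<nu>) = 0" by (simp add: \<nu>.prob_space)
    show "(\<lambda>x. mass d k c j x - q j) \<in> borel_measurable \<nu>"
      using borel_measurable_integrable[OF mass_integral(1)[OF c near j]] by measurable
  qed (use mass_dev_norm_le[OF c near] J SJ p_pos M_pos in auto)
  also have "\<dots> \<le> 2 * exp (- (R0 * p / 50)\<^sup>2 * real (card S) / (16 * R\<^sup>2 * M\<^sup>2))"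
  proof -
    have "(R0 * p / 50)\<^sup>2 * real (card S) / (16 * R\<^sup>2 * M\<^sup>2) = (R0 / R)\<^sup>2 * ((p / 50)\<^sup>2 * real (card S) / (4 * (2 * M)\<^sup>2))"
      using R_pos by (simp add: power_mult_distrib power_divide)
    also have "\<dots> \<le> 1 * ((p / 50)\<^sup>2 * real (card S) / (4 * (2 * M)\<^sup>2))"
      using R0_le(2) R0_pos R_pos by (intro mult_right_mono power_le_one) auto
    finally show ?thesis by simp
  qed
  also have "\<dots> \<le> \<epsilon> / 3" using \<epsilon>[OF S] by simp
  also have "(\<lambda>y. L2_set (\<lambda>j. (\<Sum>i\<in>S. mass d k c j (y i) - q j) / real (card S)) {1..k}) =
      (\<lambda>y. L2_set (\<lambda>j. avg S (mass d k c j) y - q j) {1..k})"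
    using SJ by (intro ext L2_set_cong) (auto simp: avg_def sum_subtractf diff_divide_distrib)
  finally show ?thesis by (simp add: good_mass_def not_less)
qed

lemma prob_bad_noise: "measure Q {y \<in> space Q. \<not> good_noise y} \<le> \<epsilon> / 3"
proof -
  have "measure Q {y \<in> space Q. R0 * p / 50 \<le> L2_set (\<lambda>jl. (\<Sum>i\<in>S2. (case jl of (j, l) \<Rightarrow> \<xi> c j l) (y i)) / real (card S2)) I}
      \<le> 2 * exp (- (R0 * p / 50)\<^sup>2 * real (card S2) / (4 * (2 * R * M)\<^sup>2))"
  proof (rule L2_set_mean_concentration[OF prob_\<nu>, where f = "\<lambda>jl. case jl of (j, l) \<Rightarrow> \<xi> c j l"])
    fix x assume "x \<in> space \<nu>"
    from \<xi>_norm_le_all[OF c near this]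
    show "L2_set (\<lambda>jl. (case jl of (j, l) \<Rightarrow> \<xi> c j l) x) I \<le> 2 * R * M" by (simp add: case_prod_beta')
  qed (use \<xi>_integral[OF c near] J S2 p_pos M_pos R_pos R0_pos in auto)
  also have "\<dots> = 2 * exp (- (R0 * p / 50)\<^sup>2 * real (card S2) / (16 * R\<^sup>2 * M\<^sup>2))"
    by (simp add: power_mult_distrib)
  also have "\<dots> \<le> \<epsilon> / 3" using \<epsilon>[of S2] by simp
  finally show ?thesis by (simp add: good_noise_def not_less avg_def case_prod_beta')
qed

definition good :: "(nat \<Rightarrow> pt measure) \<Rightarrow> bool" where
  "good y \<longleftrightarrow> good_mass S1 y \<and> good_mass S2 y \<and> good_noise y"

lemma pred_good: "Measurable.pred Q good"
  unfolding good_def using pred_good_mass[of S1] pred_good_mass[of S2] pred_good_noise by measurable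

lemma prob_bad: "measure Q {y \<in> space Q. \<not> good y} \<le> \<epsilon>"
proof -
  note [measurable] = pred_good_mass[of S1, simplified] pred_good_mass[of S2, simplified] pred_good_noise
  have "measure Q {y \<in> space Q. \<not> good y} \<le>
    measure Q ({y \<in> space Q. \<not> good_mass S1 y} \<union> {y \<in> space Q. \<not> good_mass S2 y} \<union> {y \<in> space Q. \<not> good_noise y})"
    by (rule QP.P.finite_measure_mono) (auto simp: good_def)
  also have "\<dots> \<le> measure Q {y \<in> space Q. \<not> good_mass S1 y} + measure Q {y \<in> space Q. \<not> good_mass S2 y} + measure Q {y \<in> space Q. \<not> good_noise y}"
    by (intro order_trans[OF measure_Un_le] add_mono order_refl) auto
  also have "\<dots> \<le> \<epsilon>" using prob_bad_mass[of S1] prob_bad_mass[of S2] prob_bad_noise by simp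
  finally show ?thesis .
qed

lemma good_mass_dev: "good_mass S y \<Longrightarrow> j \<in> {1..k} \<Longrightarrow> \<bar>avg S (mass d k c j) y - q j\<bar> \<le> p / 50"
proof -
  assume g: "good_mass S y" and j: "j \<in> {1..k}"
  have "\<bar>avg S (mass d k c j) y - q j\<bar> \<le> L2_set (\<lambda>j. \<bar>avg S (mass d k c j) y - q j\<bar>) {1..k}"
    by (rule member_le_L2_set[of "{1..k}" j "\<lambda>j. \<bar>avg S (mass d k c j) y - q j\<bar>"]) (use j in auto)
  then show ?thesis using g by (simp add: L2_set_abs good_mass_def)
qed

lemma good_mass_lower: "good_mass S y \<Longrightarrow> j \<in> {1..k} \<Longrightarrow> 97 / 100 * p \<le> avg S (mass d k c j) y"
  using good_mass_dev[of S y j] mass_near_opt[OF c near, of j] by linarith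

definition s :: real where "s = 1 / real (t + 1)"

lemma s_bounds: "0 < s" "s \<le> 1" by (auto simp: s_def)

definition drift :: "(nat \<Rightarrow> pt measure) \<Rightarrow> real" where
  "drift y = (\<Sum>(j, l)\<in>I. (c j l - cs j l) * (avg S2 (\<xi> c j l) y / avg S1 (mass d k c j) y))"

lemma cdist_eq: "cdist d k cs c' = L2_set (\<lambda>(j, l). c' j l - cs j l) I"
proof -
  have "cdist d k cs c' = L2_set (\<lambda>j. L2_set (\<lambda>l. c' j l - cs j l) {1..d}) {1..k}"
    unfolding cdist_def by (rule L2_set_cong) (auto simp: edist_def L2_set_def power2_commute)
  then show ?thesis by (simp add: L2_set_Sigma)
qed

lemma scaled_noise_le:
  assumes "good_mass S1 y"
  shows "97 / 100 * p * L2_set (\<lambda>(j, l). avg S2 (\<xi> c j l) y / avg S1 (mass d k c j) y) I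
    \<le> L2_set (\<lambda>(j, l). avg S2 (\<xi> c j l) y) I"
proof -
  define N where "N = (\<lambda>(j, l). avg S2 (\<xi> c j l) y / avg S1 (mass d k c j) y)"
  have "97 / 100 * p * L2_set N I = L2_set (\<lambda>i. 97 / 100 * p * N i) I" using p_pos by (subst L2_set_cmult) simp
  also have "\<dots> = L2_set (\<lambda>i. \<bar>97 / 100 * p * N i\<bar>) I" by (rule L2_set_abs[symmetric])
  also have "\<dots> \<le> L2_set (\<lambda>i. \<bar>case i of (j, l) \<Rightarrow> avg S2 (\<xi> c j l) y\<bar>) I"
  proof (rule L2_set_mono)
    fix i assume "i \<in> I"
    then obtain j l where jl: "i = (j, l)" "j \<in> {1..k}" by (cases i) auto
    note a1 = good_mass_lower[OF assms jl(2)]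
    have "97 / 100 * p * \<bar>avg S2 (\<xi> c j l) y\<bar> \<le> avg S1 (mass d k c j) y * \<bar>avg S2 (\<xi> c j l) y\<bar>"
      by (rule mult_right_mono[OF a1]) simp
    moreover have "0 < avg S1 (mass d k c j) y" using a1 p_pos by linarith
    ultimately show "\<bar>97 / 100 * p * N i\<bar> \<le> \<bar>case i of (j, l) \<Rightarrow> avg S2 (\<xi> c j l) y\<bar>"
      using p_pos by (simp add: N_def jl(1) abs_mult divide_simps mult_ac)
  qed simp
  also have "\<dots> = L2_set (\<lambda>(j, l). avg S2 (\<xi> c j l) y) I" by (rule L2_set_abs)
  finally show ?thesis unfolding N_def .
qed

text \<open>
  On a good batch all mass estimates are within \<open>p / 50\<close> of masses that are at
  least \<open>99 / 100 * p\<close>, so their ratios are within \<open>1 / 20\<close> of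
  \<open>1\<close>, and dividing the noise by them leaves at most \<open>R0 / 40\<close>.
\<close>

lemma good_step:
  assumes y: "y \<in> space Q" and g: "good y"
  shows "cdist d k cs (mb_step d k \<pi> t S1 S2 c y) \<le> R0"
    and "(cdist d k cs (mb_step d k \<pi> t S1 S2 c y))\<^sup>2 \<le>
      max 0 (1 - 3 / 2 * s) * (cdist d k cs c)\<^sup>2 - 2 * s * drift y + 4 * s\<^sup>2 * R0\<^sup>2"
proof -
  define a1 where "a1 = (\<lambda>j. avg S1 (mass d k c j) y)"
  define a2 where "a2 = (\<lambda>j. avg S2 (mass d k c j) y)"
  define v where "v = (\<lambda>(j, l). c j l - cs j l)"
  define e where "e = (\<lambda>(j, l). cs j l - cell_mean c j l)"
  define N where "N = (\<lambda>(j, l). avg S2 (\<xi> c j l) y / a1 j)"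
  define \<alpha> where "\<alpha> = (\<lambda>jl :: nat \<times> nat. a2 (fst jl) / a1 (fst jl))"
  define w where "w = (\<lambda>i. v i - s * (\<alpha> i * (v i + e i) + N i))"
  have gm: "good_mass S1 y" "good_mass S2 y" and gn: "good_noise y" using g by (auto simp: good_def)
  have a1: "97 / 100 * p \<le> a1 j" if "j \<in> {1..k}" for j unfolding a1_def by (rule good_mass_lower[OF gm(1) that])
  have a1_pos: "0 < a1 j" if "j \<in> {1..k}" for j using a1[OF that] p_pos by linarith
  have v: "L2_set v I = cdist d k cs c" by (simp add: cdist_eq v_def)
  have wR: "L2_set w I \<le> R0 \<and> (L2_set w I)\<^sup>2 \<le> max 0 (1 - 3 / 2 * s) * (L2_set v I)\<^sup>2 - 2 * s * (\<Sum>i\<in>I. v i * N i) + 4 * s\<^sup>2 * R0\<^sup>2"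
    unfolding w_def
  proof (rule conjI; rule perturbed_contraction[where e = e and \<alpha> = \<alpha> and N = N])
    show "L2_set v I \<le> R0" unfolding v by (rule near)
    show "L2_set v I \<le> R0" unfolding v by (rule near)
    show "L2_set e I \<le> L2_set v I / 7" unfolding v e_def by (rule cell_mean_near_opt[OF c near])
    show "L2_set e I \<le> L2_set v I / 7" unfolding v e_def by (rule cell_mean_near_opt[OF c near])
    have *: "\<bar>\<alpha> i - 1\<bar> \<le> 1 / 20" if i: "i \<in> I" for i
    proof -
      obtain j l where jl: "i = (j, l)" "j \<in> {1..k}" using i by (cases i) auto
      have "\<bar>a2 j - a1 j\<bar> \<le> p / 25"
        using good_mass_dev[OF gm(1) jl(2)] good_mass_dev[OF gm(2) jl(2)] unfolding a1_def a2_def by linarith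
      also have "\<dots> \<le> 1 / 20 * a1 j" using a1[OF jl(2)] p_pos by linarith
      finally have "\<bar>(a2 j - a1 j) / a1 j\<bar> \<le> 1 / 20" using a1_pos[OF jl(2)] by (simp add: abs_divide divide_simps)
      then show ?thesis using a1_pos[OF jl(2)] by (simp add: \<alpha>_def jl(1) diff_divide_distrib)
    qed
    show "\<bar>\<alpha> i - 1\<bar> \<le> 1 / 20" if "i \<in> I" for i by (rule *[OF that])
    show "\<bar>\<alpha> i - 1\<bar> \<le> 1 / 20" if "i \<in> I" for i by (rule *[OF that])
    have "97 / 100 * p * L2_set N I \<le> L2_set (\<lambda>(j, l). avg S2 (\<xi> c j l) y) I"
      unfolding N_def a1_def by (rule scaled_noise_le[OF gm(1)])
    also have "\<dots> \<le> R0 * p / 50" using gn by (simp add: good_noise_def)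
    also have "\<dots> = p * (R0 / 50)" by simp
    finally have "p * (97 / 100 * L2_set N I) \<le> p * (R0 / 50)" by (simp add: mult_ac)
    then have "97 / 100 * L2_set N I \<le> R0 / 50" using p_pos by simp
    then show "L2_set N I \<le> R0 / 40" using R0_pos by linarith
    then show "L2_set N I \<le> R0 / 40" .
  qed (rule s_bounds)+
  have dr: "(\<Sum>i\<in>I. v i * N i) = drift y"
    unfolding drift_def by (rule sum.cong) (auto simp: v_def N_def a1_def)
  have cd: "cdist d k cs (mb_step d k \<pi> t S1 S2 c y) \<le> L2_set w I"
  proof -
    have "cdist d k cs (mb_step d k \<pi> t S1 S2 c y) \<le> L2_set (\<lambda>j. L2_set (\<lambda>l. w (j, l)) {1..d}) {1..k}"
      unfolding cdist_def
    proof (rule L2_set_mono)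
      fix j assume j: "j \<in> {1..k}"
      have rs: "raw_update d k y S1 S2 t c j \<in> space (euc d)" by (simp add: raw_update_def space_euc)
      have "mb_step d k \<pi> t S1 S2 c y j = \<pi> (raw_update d k y S1 S2 t c j)"
        using mb_step_eq[OF spaceQ'[OF y, OF UnI1] M0 finS(1) S1(2) c j, where \<pi> = \<pi> and t = t and ?S2.0 = S2] a1_pos[OF j] by (simp add: a1_def)
      then have "edist d (cs j) (mb_step d k \<pi> t S1 S2 c y j) \<le> edist d (raw_update d k y S1 S2 t c j) (cs j)"
        using \<pi>_nonexp[OF rs cs_ball[OF j]] by (simp add: edist_commute)
      also have "\<dots> = L2_set (\<lambda>l. w (j, l)) {1..d}"
        unfolding edist_def
      proof (rule L2_set_cong[OF refl])
        fix l assume l: "l \<in> {1..d}"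
        have x: "avg S2 (\<xi> c j l) y = cell_mean c j l * a2 j - avg S2 (moment d k c j l) y"
          unfolding \<xi>_def[abs_def] avg_diff avg_cmult a2_def ..
        have "raw_update d k y S1 S2 t c j l = c j l - (c j l * a2 j - avg S2 (moment d k c j l) y) / (real (t + 1) * a1 j)"
          unfolding a1_def a2_def by (rule raw_update_eq[OF spaceQ'[OF y] M0 finS(1) S1(2) finS(2) S2(2) c j l])
        also have "c j l * a2 j - avg S2 (moment d k c j l) y = a2 j * (c j l - cell_mean c j l) + avg S2 (\<xi> c j l) y"
          unfolding x by (simp add: algebra_simps)
        also have "c j l - (a2 j * (c j l - cell_mean c j l) + avg S2 (\<xi> c j l) y) / (real (t + 1) * a1 j) =
            c j l - s * (a2 j / a1 j * (c j l - cell_mean c j l) + avg S2 (\<xi> c j l) y / a1 j)"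
          by (simp add: s_def add_divide_distrib mult.commute)
        finally show "raw_update d k y S1 S2 t c j l - cs j l = w (j, l)"
          by (simp add: w_def v_def e_def N_def \<alpha>_def)
      qed
      finally show "edist d (cs j) (mb_step d k \<pi> t S1 S2 c y j) \<le> L2_set (\<lambda>l. w (j, l)) {1..d}" .
    qed simp
    also have "\<dots> = L2_set w I" by (subst L2_set_Sigma) (auto simp: case_prod_beta')
    finally show ?thesis .
  qed
  then have "(cdist d k cs (mb_step d k \<pi> t S1 S2 c y))\<^sup>2 \<le> (L2_set w I)\<^sup>2"
    by (intro power_mono cdist_nonneg)
  then show "cdist d k cs (mb_step d k \<pi> t S1 S2 c y) \<le> R0"
    and "(cdist d k cs (mb_step d k \<pi> t S1 S2 c y))\<^sup>2 \<le>
      max 0 (1 - 3 / 2 * s) * (cdist d k cs c)\<^sup>2 - 2 * s * drift y + 4 * s\<^sup>2 * R0\<^sup>2"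
    using wR cd unfolding v dr by linarith+
qed

text \<open>
  The restriction to good denominators makes the reciprocal bounded and depends on the masses in
  the denominator batch only, which is what keeps the noise centred.
\<close>

definition weight :: "nat \<Rightarrow> (nat \<Rightarrow> pt measure) \<Rightarrow> real" where
  "weight j y = (if good_mass S1 y then 1 / avg S1 (mass d k c j) y else 0)"

lemma \<xi>_abs_le:
  assumes x: "x \<in> space \<nu>" and j: "j \<in> {1..k}" and l: "l \<in> {1..d}"
  shows "\<bar>\<xi> c j l x\<bar> \<le> 2 * R * mass d k c j x"
proof -
  have "\<bar>\<xi> c j l x\<bar> \<le> L2_set (\<lambda>l. \<bar>\<xi> c j l x\<bar>) {1..d}"
    by (rule member_le_L2_set[of "{1..d}" l "\<lambda>l. \<bar>\<xi> c j l x\<bar>"]) (use l in auto)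
  also have "\<dots> \<le> 2 * R * mass d k c j x" unfolding L2_set_abs by (rule \<xi>_norm_le[OF c near x j])
  finally show ?thesis .
qed

lemma mass_le: "x \<in> space \<nu> \<Longrightarrow> mass d k c j x \<le> M"
  using ball_measuresD(6)[OF _ M0] by (simp add: mass_def space_\<nu>)

lemma measurable_weight: "j \<in> {1..k} \<Longrightarrow> weight j \<in> borel_measurable Q"
  unfolding weight_def[abs_def] using measurable_mass_avg[of j S1] pred_good_mass[of S1] by measurable

lemma weight_bound: "j \<in> {1..k} \<Longrightarrow> \<bar>weight j y\<bar> \<le> 2 / p"
proof (cases "good_mass S1 y")
  case True
  assume "j \<in> {1..k}"
  from good_mass_lower[OF True this] have "p / 2 \<le> avg S1 (mass d k c j) y" using p_pos by linarith
  moreover from this have "0 < avg S1 (mass d k c j) y" using p_pos by linarith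
  ultimately show ?thesis using True p_pos by (simp add: weight_def divide_simps)
qed (use p_pos in \<open>simp add: weight_def\<close>)

text \<open>
  It suffices that, given all other observations, the weight is constant wherever
  \<open>\<xi>\<close> of observation \<open>i\<close> does not vanish. For disjoint batches the
  weight does not involve observation \<open>i\<close>. In the other case \<open>\<xi>\<close>
  vanishes unless observation \<open>i\<close> falls into cell \<open>j\<close>, and then its
  contribution to every cell mass is known.
\<close>

lemma noise_centered:
  assumes j: "j \<in> {1..k}" and l: "l \<in> {1..d}" and i: "i \<in> S2"
  shows "(\<integral>y. \<xi> c j l (y i) * weight j y \<partial>Q) = 0"
    and "integrable Q (\<lambda>y. \<xi> c j l (y i) * weight j y)"
proof -
  have iJ: "i \<in> J" using i S2 by auto
  note \<xi>m = borel_measurable_integrable[OF \<xi>_integral(1)[OF c near j l]]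
  have "(\<lambda>y. y i) \<in> Q \<rightarrow>\<^sub>M \<nu>" by (rule measurable_component_singleton[OF iJ])
  then have m: "(\<lambda>y. \<xi> c j l (y i) * weight j y) \<in> borel_measurable Q"
    by (intro borel_measurable_times measurable_weight[OF j] measurable_compose[OF _ \<xi>m])
  have b: "\<bar>\<xi> c j l (y i) * weight j y\<bar> \<le> (2 * R * M) * (2 / p)" if y: "y \<in> space Q" for y
  proof -
    have "\<bar>\<xi> c j l (y i)\<bar> \<le> 2 * R * M"
      using \<xi>_abs_le[OF spaceQ[OF y iJ] j l] mass_le[OF spaceQ[OF y iJ], of j] R_pos
      by (meson mult_left_mono order_trans less_imp_le mult_pos_pos zero_less_numeral)
    then show ?thesis unfolding abs_mult using weight_bound[OF j, of y] R_pos M_pos by (intro mult_mono) auto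
  qed
  show "integrable Q (\<lambda>y. \<xi> c j l (y i) * weight j y)"
    by (rule QP.P.integrable_const_bound[OF _ m]) (use b in auto)
  show "(\<integral>y. \<xi> c j l (y i) * weight j y \<partial>Q) = 0"
  proof (rule integral_PiM_eq_0[OF prob_\<nu> J iJ m b \<xi>_integral(2)[OF c near j l] \<xi>m])
    fix x assume x: "x \<in> space (Pi\<^sub>M (J - {i}) (\<lambda>_. \<nu>))"
    from batches show "\<exists>g. AE z in \<nu>. \<xi> c j l ((x(i := z)) i) * weight j (x(i := z)) = \<xi> c j l z * g"
    proof
      assume "S1 \<inter> S2 = {}"
      then have "i \<notin> S1" using i by auto
      then have "avg S1 f (x(i := z)) = avg S1 f x" for f :: "pt measure \<Rightarrow> real" and z
        unfolding avg_def by (intro arg_cong2[where f = "(/)"] sum.cong) auto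
      then have "weight j (x(i := z)) = weight j x" for z by (simp add: weight_def good_mass_def)
      then show ?thesis by (intro exI[of _ "weight j x"]) simp
    next
      assume SS: "S1 = S2 \<and> (AE x in \<nu>. single_cell d k c x)"
      \<comment> \<open>The masses of the denominator batch when observation \<open>i\<close>
        falls into cell \<open>j\<close>.\<close>
      define A where "A = (\<lambda>j'. ((\<Sum>i'\<in>S1 - {i}. mass d k c j' (x i')) + (if j' = j then 1 else 0)) / real (card S1))"
      define g where "g = (if L2_set (\<lambda>j'. A j' - q j') {1..k} < p / 50 then 1 / A j else 0)"
      have "AE z in \<nu>. z \<in> space \<nu>" by (rule AE_space)
      moreover have "AE z in \<nu>. single_cell d k c z" using SS by blast
      ultimately have "AE z in \<nu>. \<xi> c j l ((x(i := z)) i) * weight j (x(i := z)) = \<xi> c j l z * g"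
      proof eventually_elim
        case (elim z)
        then obtain a where mz: "\<And>j'. j' \<in> {1..k} \<Longrightarrow> mass d k c j' z = (if j' = a then 1 else 0)"
          unfolding single_cell_def by blast
        show ?case
        proof (cases "j = a")
          case False
          then have "\<xi> c j l z = 0" using \<xi>_abs_le[OF elim(1) j l] mz[OF j] by simp
          then show ?thesis by simp
        next
          case True
          have A: "avg S1 (mass d k c j') (x(i := z)) = A j'" if j': "j' \<in> {1..k}" for j'
          proof -
            have "(\<Sum>i'\<in>S1. mass d k c j' ((x(i := z)) i')) =
                mass d k c j' z + (\<Sum>i'\<in>S1 - {i}. mass d k c j' ((x(i := z)) i'))"
              using sum.remove[of S1 i "\<lambda>i'. mass d k c j' ((x(i := z)) i')"] finS(1) i SS by simp
            also have "mass d k c j' z = (if j' = j then 1 else 0)" using mz[OF j'] True by simp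
            also have "(\<Sum>i'\<in>S1 - {i}. mass d k c j' ((x(i := z)) i')) = (\<Sum>i'\<in>S1 - {i}. mass d k c j' (x i'))"
              by (rule sum.cong) auto
            finally show ?thesis by (simp add: A_def avg_def add.commute)
          qed
          have "L2_set (\<lambda>j'. avg S1 (mass d k c j') (x(i := z)) - q j') {1..k} = L2_set (\<lambda>j'. A j' - q j') {1..k}"
            by (rule L2_set_cong) (simp_all add: A)
          then have "weight j (x(i := z)) = g" by (simp add: weight_def good_mass_def g_def A[OF j])
          then show ?thesis by simp
        qed
      qed
      then show ?thesis by blast
    qed
  qed
qed

definition drift1 :: "(nat \<Rightarrow> pt measure) \<Rightarrow> real" where
  "drift1 y = (if good_mass S1 y then drift y else 0)"

lemma drift1_centered: "integrable Q drift1" "(\<integral>y. drift1 y \<partial>Q) = 0"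
proof -
  have eq: "drift1 y = (\<Sum>jl\<in>I. \<Sum>i\<in>S2. (c (fst jl) (snd jl) - cs (fst jl) (snd jl)) / real (card S2) *
      (\<xi> c (fst jl) (snd jl) (y i) * weight (fst jl) y))" for y
  proof -
    have "drift1 y = (\<Sum>jl\<in>I. (c (fst jl) (snd jl) - cs (fst jl) (snd jl)) *
        (avg S2 (\<xi> c (fst jl) (snd jl)) y * weight (fst jl) y))"
      by (simp add: drift1_def drift_def weight_def case_prod_beta')
    then show ?thesis by (simp add: avg_def sum_distrib_left sum_distrib_right sum_divide_distrib mult_ac)
  qed
  define T where "T = (\<lambda>jl i y. (c (fst jl) (snd jl) - cs (fst jl) (snd jl)) / real (card S2) *
      (\<xi> c (fst jl) (snd jl) (y i) * weight (fst jl) y))"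
  have d1: "drift1 = (\<lambda>y. \<Sum>jl\<in>I. \<Sum>i\<in>S2. T jl i y)" unfolding T_def using eq by blast
  have T: "integrable Q (T jl i)" "(\<integral>y. T jl i y \<partial>Q) = 0" if "jl \<in> I" "i \<in> S2" for jl i
  proof -
    have jl: "fst jl \<in> {1..k}" "snd jl \<in> {1..d}" using that(1) by auto
    show "integrable Q (T jl i)" unfolding T_def
      by (rule integrable_mult_right) (rule noise_centered(2)[OF jl that(2)])
    show "(\<integral>y. T jl i y \<partial>Q) = 0" unfolding T_def using noise_centered(1)[OF jl that(2)] by simp
  qed
  have T2: "integrable Q (\<lambda>y. \<Sum>i\<in>S2. T jl i y)" "(\<integral>y. (\<Sum>i\<in>S2. T jl i y) \<partial>Q) = 0" if "jl \<in> I" for jl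
  proof -
    show "integrable Q (\<lambda>y. \<Sum>i\<in>S2. T jl i y)" by (rule Bochner_Integration.integrable_sum) (rule T(1)[OF that])
    have "(\<integral>y. (\<Sum>i\<in>S2. T jl i y) \<partial>Q) = (\<Sum>i\<in>S2. \<integral>y. T jl i y \<partial>Q)"
      by (rule Bochner_Integration.integral_sum) (rule T(1)[OF that])
    then show "(\<integral>y. (\<Sum>i\<in>S2. T jl i y) \<partial>Q) = 0" using T(2)[OF that] by simp
  qed
  show "integrable Q drift1" unfolding d1 by (rule Bochner_Integration.integrable_sum) (rule T2(1))
  have "(\<integral>y. drift1 y \<partial>Q) = (\<Sum>jl\<in>I. \<integral>y. (\<Sum>i\<in>S2. T jl i y) \<partial>Q)"
    unfolding d1 by (rule Bochner_Integration.integral_sum) (rule T2(1))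
  then show "(\<integral>y. drift1 y \<partial>Q) = 0" using T2(2) by simp
qed

lemma drift_abs_le:
  assumes y: "y \<in> space Q" and g: "good_mass S1 y"
  shows "\<bar>drift y\<bar> \<le> 3 * R0 * R * M / p"
proof -
  define N where "N = (\<lambda>(j, l). avg S2 (\<xi> c j l) y / avg S1 (mass d k c j) y)"
  have "L2_set (\<lambda>jl. avg S2 (case jl of (j, l) \<Rightarrow> \<xi> c j l) y) I \<le> avg S2 (\<lambda>_. 2 * R * M) y"
  proof (rule L2_set_avg_le[OF finS(2) S2(2)])
    fix i assume "i \<in> S2"
    then have "y i \<in> space \<nu>" using spaceQ[OF y] S2 by auto
    from \<xi>_norm_le_all[OF c near this]
    show "L2_set (\<lambda>jl. (case jl of (j, l) \<Rightarrow> \<xi> c j l) (y i)) I \<le> 2 * R * M" by (simp add: case_prod_beta')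
  qed
  then have "L2_set (\<lambda>(j, l). avg S2 (\<xi> c j l) y) I \<le> 2 * R * M"
    by (simp add: case_prod_beta' avg_const[OF finS(2) S2(2)])
  then have "97 / 100 * p * L2_set N I \<le> 2 * R * M"
    using scaled_noise_le[OF g] unfolding N_def by linarith
  then have "L2_set N I * p * (97 / 100) \<le> 2 * (R * M)" by (simp add: mult_ac)
  moreover have "0 < R * M" using R_pos M_pos by simp
  ultimately have "L2_set N I * p \<le> 3 * (R * M)" by linarith
  then have N: "L2_set N I \<le> 3 * (R * M) / p" using p_pos by (simp add: divide_simps)
  have "drift y = (\<Sum>jl\<in>I. (case jl of (j, l) \<Rightarrow> c j l - cs j l) * N jl)"
    unfolding drift_def N_def by (rule sum.cong) auto
  then have "\<bar>drift y\<bar> \<le> L2_set (\<lambda>(j, l). c j l - cs j l) I * L2_set N I"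
    using abs_sum_mult_le_L2_set by simp
  also have "\<dots> \<le> R0 * (3 * (R * M) / p)"
    using near N R0_pos unfolding cdist_eq by (intro mult_mono) auto
  finally show ?thesis by (simp add: mult_ac)
qed

end

context margin_distribution
begin

text \<open>
  Far away from \<open>cs\<close> the squared distance is replaced by an upper bound for all
  codebooks that can occur, so that the potential dominates the squared distance everywhere.
\<close>

definition potential :: "codebook \<Rightarrow> real" where
  "potential c = (if cdist d k cs c \<le> R0 then (cdist d k cs c)\<^sup>2 else 5 * real k * R\<^sup>2)"

lemma cdist_sq_le:
  assumes "\<And>j. j \<in> {1..k} \<Longrightarrow> L2_set (c j) {1..d} \<le> 6 / 5 * R"
  shows "(cdist d k cs c)\<^sup>2 \<le> 5 * real k * R\<^sup>2"
proof -
  have "(cdist d k cs c)\<^sup>2 = (\<Sum>j\<in>{1..k}. (edist d (cs j) (c j))\<^sup>2)" by (simp add: cdist_def power2_L2_set)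
  also have "\<dots> \<le> (\<Sum>j\<in>{1..k}. (11 / 5 * R)\<^sup>2)"
  proof (intro sum_mono power_mono)
    fix j assume j: "j \<in> {1..k}"
    show "edist d (cs j) (c j) \<le> 11 / 5 * R"
      using edist_le_of_ball[of "cs j" d R "c j" "6 / 5 * R"] assms[OF j] cs_ball[OF j] by (simp add: eball_origin)
  qed simp
  also have "\<dots> = 121 / 25 * (real k * R\<^sup>2)" by (simp add: power2_eq_square)
  also have "\<dots> \<le> 5 * real k * R\<^sup>2" by simp
  finally show ?thesis .
qed

lemma R0_sq_le: "R0\<^sup>2 \<le> R\<^sup>2 / 25"
proof -
  have "R0\<^sup>2 \<le> (R / 5)\<^sup>2" using R0_le(2) R0_pos by (intro power_mono) auto
  then show ?thesis by (simp add: power2_eq_square)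
qed

lemma potential_bounds: "0 \<le> potential c" "potential c \<le> 5 * real k * R\<^sup>2"
proof -
  have "(cdist d k cs c)\<^sup>2 \<le> 5 * real k * R\<^sup>2" if "cdist d k cs c \<le> R0"
  proof -
    have "(cdist d k cs c)\<^sup>2 \<le> R0\<^sup>2" using that by (intro power_mono cdist_nonneg)
    also have "\<dots> \<le> 1 * R\<^sup>2" using R0_sq_le zero_le_power2[of R] by linarith
    also have "\<dots> \<le> (5 * real k) * R\<^sup>2" using k_ge_2 by (intro mult_right_mono) auto
    finally show ?thesis .
  qed
  then show "0 \<le> potential c" "potential c \<le> 5 * real k * R\<^sup>2" by (auto simp: potential_def)
qed

lemma cdist_sq_le_potential:
  "(\<And>j. j \<in> {1..k} \<Longrightarrow> L2_set (c j) {1..d} \<le> 6 / 5 * R) \<Longrightarrow> (cdist d k cs c)\<^sup>2 \<le> potential c"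
  using cdist_sq_le[of c] by (simp add: potential_def)

lemma measurable_potential:
  assumes C: "C \<in> Z \<rightarrow>\<^sub>M code_space d k"
  shows "(\<lambda>z. potential (C z)) \<in> borel_measurable Z" "Measurable.pred Z (\<lambda>z. cdist d k cs (C z) \<le> R0)"
proof -
  have "(\<lambda>_. cs) \<in> Z \<rightarrow>\<^sub>M code_space d k" by (rule measurable_const) (simp only: space_code_space cs)
  from measurable_cdist[OF this C] have [measurable]: "(\<lambda>z. cdist d k cs (C z)) \<in> borel_measurable Z" .
  show "(\<lambda>z. potential (C z)) \<in> borel_measurable Z" unfolding potential_def by measurable
  show "Measurable.pred Z (\<lambda>z. cdist d k cs (C z) \<le> R0)" by measurable
qed

end

context batch_step
begin

lemma measurable_step: "(\<lambda>y. mb_step d k \<pi> t S1 S2 c y) \<in> Q \<rightarrow>\<^sub>M code_space d k"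
proof (rule measurable_mb_step[where R = R and M = M])
  show "(\<lambda>_. c) \<in> Q \<rightarrow>\<^sub>M code_space d k" by (rule measurable_const) (simp only: space_code_space c)
  fix i assume "i \<in> S1 \<union> S2"
  then have "i \<in> J" using S1 S2 by auto
  then have "(\<lambda>y. y i) \<in> Q \<rightarrow>\<^sub>M \<nu>" by (rule measurable_component_singleton)
  then show "(\<lambda>y. y i) \<in> Q \<rightarrow>\<^sub>M ball_measures d R M" by (simp add: measurable_cong_sets[OF refl sets_\<nu>])
qed (use M_pos finS S1 S2 \<pi>_meas in auto)

lemma prob_step_far_le: "measure Q {y \<in> space Q. \<not> cdist d k cs (mb_step d k \<pi> t S1 S2 c y) \<le> R0} \<le> \<epsilon>"
proof -
  have "measure Q {y \<in> space Q. \<not> cdist d k cs (mb_step d k \<pi> t S1 S2 c y) \<le> R0} \<le> measure Q {y \<in> space Q. \<not> good y}"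
    by (rule QP.P.finite_measure_mono) (use good_step(1) pred_good in auto)
  also have "\<dots> \<le> \<epsilon>" by (rule prob_bad)
  finally show ?thesis .
qed

text \<open>
  On a good batch the recursion of \<open>perturbed_contraction\<close> holds. On a bad one the
  potential is at most its maximum, and extending the drift from good batches to all batches
  with good denominators costs at most \<open>6 * R0 * R * M / p\<close> on a bad one; after
  this extension its expectation is zero.
\<close>

lemma integral_potential_step_le:
  "(\<integral>y. potential (mb_step d k \<pi> t S1 S2 c y) \<partial>Q) \<le>
    max 0 (1 - 3 / 2 * s) * potential c + 4 * s\<^sup>2 * R0\<^sup>2 + (5 * real k * R\<^sup>2 + 6 * R0 * R * M / p) * \<epsilon>"
proof -
  define L where "L = 5 * real k * R\<^sup>2"
  define D where "D = 3 * R0 * R * M / p"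
  define K where "K = max 0 (1 - 3 / 2 * s) * (cdist d k cs c)\<^sup>2 + 4 * s\<^sup>2 * R0\<^sup>2"
  have D0: "0 \<le> D" using R0_pos R_pos M_pos p_pos by (simp add: D_def)
  have K0: "0 \<le> K" by (simp add: K_def)
  have L0: "0 \<le> L" by (simp add: L_def)
  define b :: "(nat \<Rightarrow> pt measure) \<Rightarrow> real" where "b = indicator {y \<in> space Q. \<not> good y}"
  have bset: "{y \<in> space Q. \<not> good y} \<in> sets Q" using pred_good by measurable
  have bint: "integrable Q b" "(\<integral>y. b y \<partial>Q) = measure Q {y \<in> space Q. \<not> good y}"
    unfolding b_def using bset by (simp_all add: QP.P.emeasure_eq_measure Int_absorb2)
  have pt: "potential (mb_step d k \<pi> t S1 S2 c y) \<le> K - 2 * s * drift1 y + (L + 2 * D) * b y" if y: "y \<in> space Q" for y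
  proof (cases "good y")
    case True
    then have "b y = 0" "drift1 y = drift y" by (auto simp: b_def drift1_def good_def)
    then show ?thesis using good_step[OF y True] by (simp add: potential_def K_def)
  next
    case False
    then have b: "b y = 1" using y by (simp add: b_def)
    have "\<bar>drift1 y\<bar> \<le> D" using drift_abs_le[OF y] D0 by (simp add: drift1_def D_def)
    then have "s * drift1 y \<le> s * D" using s_bounds by (intro mult_left_mono) auto
    also have "\<dots> \<le> 1 * D" using s_bounds D0 by (intro mult_right_mono) auto
    finally have "s * drift1 y \<le> D" by simp
    then have "2 * s * drift1 y \<le> 2 * D" by simp
    moreover have "potential (mb_step d k \<pi> t S1 S2 c y) \<le> L" unfolding L_def by (rule potential_bounds)
    ultimately show ?thesis using K0 by (simp add: b)
  qed
  have "(\<integral>y. potential (mb_step d k \<pi> t S1 S2 c y) \<partial>Q) \<le> (\<integral>y. K - 2 * s * drift1 y + (L + 2 * D) * b y \<partial>Q)"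
  proof (rule integral_mono)
    show "integrable Q (\<lambda>y. potential (mb_step d k \<pi> t S1 S2 c y))"
      by (rule QP.P.integrable_const_bound[where B = L])
         (use potential_bounds measurable_potential(1)[OF measurable_step] in \<open>auto simp: L_def\<close>)
    show "integrable Q (\<lambda>y. K - 2 * s * drift1 y + (L + 2 * D) * b y)"
      using drift1_centered(1) bint(1) by simp
  qed (rule pt)
  also have "\<dots> = K + (L + 2 * D) * measure Q {y \<in> space Q. \<not> good y}"
    using drift1_centered bint by (simp add: QP.P.prob_space)
  also have "\<dots> \<le> K + (L + 2 * D) * \<epsilon>"
    using prob_bad L0 D0 by (intro add_left_mono mult_left_mono) auto
  also have "2 * D = 6 * R0 * R * M / p" by (simp add: D_def)
  also have "K = max 0 (1 - 3 / 2 * s) * potential c + 4 * s\<^sup>2 * R0\<^sup>2"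
    using near by (simp add: K_def potential_def)
  finally show ?thesis unfolding L_def .
qed

end

section \<open>Iteration over independent batches\<close>

text \<open>
  Any factor larger than \<open>1\<close> in the place of \<open>3 / 2\<close> would give the
  rate \<open>1 / t\<close>. The maximum with \<open>0\<close> takes effect at the first step
  only, where the initial error is forgotten.
\<close>

lemma averaged_recursion:
  fixes a :: "nat \<Rightarrow> real"
  assumes rec: "\<And>t. t < T \<Longrightarrow> a (Suc t) \<le> max 0 (1 - 3 / 2 * (1 / real (t + 1))) * a t + V * (1 / real (t + 1))\<^sup>2"
    and V: "0 \<le> V" and t: "1 \<le> t" "t \<le> T"
  shows "a t \<le> 2 * V / real t"
  using t
proof (induction t rule: nat_induct_at_least)
  case base
  then show ?case using rec[of 0] V by simp
next
  case (Suc t)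
  define x where "x = real t"
  have x: "1 \<le> x" using Suc by (simp add: x_def)
  have "a (Suc t) \<le> max 0 (1 - 3 / 2 * (1 / (x + 1))) * a t + V * (1 / (x + 1))\<^sup>2"
    using rec[of t] Suc by (simp add: x_def add.commute)
  also have "max 0 (1 - 3 / 2 * (1 / (x + 1))) = (x - 1 / 2) / (x + 1)"
    using x by (simp add: field_simps)
  also have "(x - 1 / 2) / (x + 1) * a t \<le> (x - 1 / 2) / (x + 1) * (2 * V / x)"
    using Suc x by (intro mult_left_mono) (auto simp: x_def)
  also have "(x - 1 / 2) / (x + 1) * (2 * V / x) + V * (1 / (x + 1))\<^sup>2 \<le> 2 * V / (x + 1)"
  proof -
    have "V * (1 / (x + 1))\<^sup>2 \<le> V * (1 / (x * (x + 1)))"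
      using V x by (intro mult_left_mono) (auto simp: power2_eq_square divide_simps)
    moreover have "(x - 1 / 2) / (x + 1) * (2 * V / x) = 2 * V / (x + 1) - V * (1 / (x * (x + 1)))"
    proof -
      have "x \<noteq> 0" "x + 1 \<noteq> 0" using x by auto
      then show ?thesis by (simp add: divide_simps) (simp add: algebra_simps)
    qed
    ultimately show ?thesis by linarith
  qed
  finally show ?case by (simp add: x_def add.commute)
qed

text \<open>
  The conditional form in which independence of past and present batches is used: integrate over
  the present with the past fixed.
\<close>

lemma integral_PiM_Un_le:
  fixes f :: "(nat \<Rightarrow> 'x) \<Rightarrow> real"
  assumes \<nu>: "prob_space \<nu>" and KB: "finite K" "finite B" "K \<inter> B = {}"
    and f: "f \<in> borel_measurable (Pi\<^sub>M (K \<union> B) (\<lambda>_. \<nu>))" "\<And>y. \<bar>f y\<bar> \<le> b"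
    and g: "integrable (Pi\<^sub>M K (\<lambda>_. \<nu>)) g" "\<And>x. x \<in> space (Pi\<^sub>M K (\<lambda>_. \<nu>)) \<Longrightarrow> 0 \<le> g x"
    and le: "\<And>x. x \<in> space (Pi\<^sub>M K (\<lambda>_. \<nu>)) \<Longrightarrow> (\<integral>y. f (merge K B (x, y)) \<partial>Pi\<^sub>M B (\<lambda>_. \<nu>)) \<le> g x"
  shows "(\<integral>y. f y \<partial>Pi\<^sub>M (K \<union> B) (\<lambda>_. \<nu>)) \<le> (\<integral>x. g x \<partial>Pi\<^sub>M K (\<lambda>_. \<nu>))"
proof -
  interpret \<nu>: prob_space \<nu> by fact
  interpret product_prob_space "\<lambda>_. \<nu>" "K \<union> B" by standard
  have int: "integrable (Pi\<^sub>M (K \<union> B) (\<lambda>_. \<nu>)) f"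
    by (rule P.integrable_const_bound[where B = b]) (use f in auto)
  have "(\<integral>y. f y \<partial>Pi\<^sub>M (K \<union> B) (\<lambda>_. \<nu>)) = (\<integral>x. (\<integral>y. f (merge K B (x, y)) \<partial>Pi\<^sub>M B (\<lambda>_. \<nu>)) \<partial>Pi\<^sub>M K (\<lambda>_. \<nu>))"
    by (rule product_integral_fold) (use KB int in auto)
  also have "\<dots> \<le> (\<integral>x. g x \<partial>Pi\<^sub>M K (\<lambda>_. \<nu>))"
    by (rule integral_mono'[OF g(1) le g(2)])
  finally show ?thesis .
qed

primrec mb_iter :: "nat \<Rightarrow> nat \<Rightarrow> (pt \<Rightarrow> pt) \<Rightarrow> (nat \<Rightarrow> nat set) \<Rightarrow> (nat \<Rightarrow> nat set) \<Rightarrow> codebook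
    \<Rightarrow> (nat \<Rightarrow> pt measure) \<Rightarrow> nat \<Rightarrow> codebook" where
  "mb_iter d k \<pi> B1 B2 c0 xs 0 = c0"
| "mb_iter d k \<pi> B1 B2 c0 xs (Suc t) =
    mb_step d k \<pi> t (B1 (Suc t)) (B2 (Suc t)) (mb_iter d k \<pi> B1 B2 c0 xs t) xs"

lemma minibatch_eq_mb_iter:
  "minibatch d k R xs B1 B2 c0 t = mb_iter d k (eproj d (eball d (origin d) R)) B1 B2 c0 xs t"
  by (induction t) (simp_all add: mb_step_def Let_def)

lemma minibatch_centroid_eq_mb_iter:
  "minibatch_centroid d k xs B c0 t = mb_iter d k (\<lambda>x. x) B B c0 xs t"
  by (induction t) (simp_all add: mb_step_def Let_def)

lemma batch_mean_cong:
  assumes "\<And>i. i \<in> S \<Longrightarrow> xs i = ys i"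
  shows "batch_mean d xs S = batch_mean d ys S"
  using assms unfolding batch_mean_def by (simp cong: sum.cong)

lemma mb_step_cong:
  assumes "\<And>i. i \<in> S1 \<union> S2 \<Longrightarrow> xs i = ys i"
  shows "mb_step d k \<pi> t S1 S2 c xs = mb_step d k \<pi> t S1 S2 c ys"
proof -
  have "batch_mean d xs S1 = batch_mean d ys S1" "batch_mean d xs S2 = batch_mean d ys S2"
    using assms by (auto intro!: batch_mean_cong)
  moreover from this have "raw_update d k xs S1 S2 t c j = raw_update d k ys S1 S2 t c j" for j
    by (simp add: raw_update_def)
  ultimately show ?thesis by (simp add: mb_step_def cong: if_cong)
qed

lemma mb_iter_cong:
  assumes "\<And>s i. s \<in> {1..t} \<Longrightarrow> i \<in> B1 s \<union> B2 s \<Longrightarrow> xs i = ys i"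
  shows "mb_iter d k \<pi> B1 B2 c0 xs t = mb_iter d k \<pi> B1 B2 c0 ys t"
  using assms
proof (induction t)
  case (Suc t)
  have "mb_iter d k \<pi> B1 B2 c0 xs t = mb_iter d k \<pi> B1 B2 c0 ys t" by (rule Suc.IH) (use Suc.prems in force)
  moreover have "mb_step d k \<pi> t (B1 (Suc t)) (B2 (Suc t)) c xs = mb_step d k \<pi> t (B1 (Suc t)) (B2 (Suc t)) c ys" for c
    by (rule mb_step_cong) (use Suc.prems[of "Suc t"] in auto)
  ultimately show ?case by simp
qed simp

text \<open>
  The batches are pairwise disjoint, so the codebook computed from the first batches is
  independent of the next batch. In the centroid version the condition on cells is required for
  every codebook because the codebook at which it is used is random.
\<close>

locale mb_run = sample_law d k R \<mu> r0 cs M \<nu>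
  for d k :: nat and R :: real and \<mu> :: "pt measure" and r0 :: real and cs :: codebook
    and M :: real and \<nu> :: "pt measure measure" +
  fixes c0 :: codebook and B B1 B2 :: "nat \<Rightarrow> nat set" and T :: nat and \<pi> :: "pt \<Rightarrow> pt" and \<epsilon> :: real
  assumes c0: "c0 \<in> codebooks d k" and near0: "cdist d k cs c0 \<le> R0"
    and disj: "disjoint_family_on B {1..T}"
    and fin: "\<And>t. t \<in> {1..T} \<Longrightarrow> finite (B t)"
    and B1: "\<And>t. t \<in> {1..T} \<Longrightarrow> B1 t \<subseteq> B t \<and> B1 t \<noteq> {}"
    and B2: "\<And>t. t \<in> {1..T} \<Longrightarrow> B2 t \<subseteq> B t \<and> B2 t \<noteq> {}"
    and \<pi>_meas: "\<pi> \<in> euc d \<rightarrow>\<^sub>M euc d"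
    and \<pi>_nonexp: "\<And>x z. x \<in> space (euc d) \<Longrightarrow> z \<in> eball d (origin d) R \<Longrightarrow> edist d (\<pi> x) z \<le> edist d x z"
    and \<pi>_ball: "\<And>t. t \<in> {1..T} \<Longrightarrow>
      (\<forall>x\<in>space (euc d). \<pi> x \<in> eball d (origin d) R) \<or> (B1 t = B2 t \<and> \<pi> = (\<lambda>x. x))"
    and halves: "\<And>t. t \<in> {1..T} \<Longrightarrow>
      B1 t \<inter> B2 t = {} \<or> (B1 t = B2 t \<and> (\<forall>c\<in>codebooks d k. AE x in \<nu>. single_cell d k c x))"
    and \<epsilon>: "\<And>t S. t \<in> {1..T} \<Longrightarrow> S \<in> {B1 t, B2 t} \<Longrightarrow>
      6 * exp (- (R0 * p / 50)\<^sup>2 * real (card S) / (16 * R\<^sup>2 * M\<^sup>2)) \<le> \<epsilon>"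
    and \<epsilon>0: "0 \<le> \<epsilon>"
begin

text \<open>
  The observations that have been used after \<open>t\<close> steps.
\<close>

definition idx :: "nat \<Rightarrow> nat set" where "idx t = (\<Union>s\<in>{1..t}. B s)"

abbreviation "code \<equiv> \<lambda>y t. mb_iter d k \<pi> B1 B2 c0 y t"
abbreviation "law t \<equiv> Pi\<^sub>M (idx t) (\<lambda>_. \<nu>)"

lemma finite_idx: "t \<le> T \<Longrightarrow> finite (idx t)" unfolding idx_def using fin by auto

lemma idx_Suc: "idx (Suc t) = idx t \<union> B (Suc t)"
  unfolding idx_def by (auto simp: atLeastAtMostSuc_conv)

lemma idx_disj: "Suc t \<le> T \<Longrightarrow> idx t \<inter> B (Suc t) = {}"
proof -
  assume t: "Suc t \<le> T"
  have "B s \<inter> B (Suc t) = {}" if "s \<in> {1..t}" for s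
    by (rule disjoint_family_onD[OF disj]) (use t that in auto)
  then show ?thesis unfolding idx_def by blast
qed

lemma prob_law: "prob_space (law t)"
  by (rule prob_space_PiM) (rule prob_\<nu>)

lemma c0_bound: "j \<in> {1..k} \<Longrightarrow> L2_set (c0 j) {1..d} \<le> 6 / 5 * R"
proof -
  assume j: "j \<in> {1..k}"
  have "L2_set (c0 j) {1..d} \<le> edist d (c0 j) (cs j) + edist d (cs j) (origin d)"
    using edist_triangle[of d "c0 j" "origin d" "cs j"] by (simp add: edist_origin)
  also have "edist d (c0 j) (cs j) \<le> R0"
    using edist_le_cdist[OF j, of c0] near0 by (simp add: edist_commute)
  also have "edist d (cs j) (origin d) \<le> R" using cs_ball[OF j] by (simp add: edist_origin eball_origin)
  finally show ?thesis using R0_le(2) by linarith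
qed

lemma code_agree: "t \<le> T \<Longrightarrow> (\<And>i. i \<in> idx t \<Longrightarrow> y i = y' i) \<Longrightarrow> code y t = code y' t"
proof (rule mb_iter_cong)
  fix s i assume t: "t \<le> T" and eq: "\<And>i. i \<in> idx t \<Longrightarrow> y i = y' i" and s: "s \<in> {1..t}" "i \<in> B1 s \<union> B2 s"
  have "s \<in> {1..T}" using t s by simp
  then have "i \<in> B s" using B1[of s] B2[of s] s by blast
  then show "y i = y' i" using s by (intro eq) (auto simp: idx_def)
qed

lemma code_props:
  assumes "t \<le> T" "\<And>i. i \<in> idx t \<Longrightarrow> y i \<in> space \<nu>"
  shows "code y t \<in> codebooks d k \<and> (\<forall>j\<in>{1..k}. L2_set (code y t j) {1..d} \<le> 6 / 5 * R)"
  using assms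
proof (induction t)
  case 0
  then show ?case using c0 c0_bound by simp
next
  case (Suc t)
  then have t: "Suc t \<in> {1..T}" by simp
  have IH: "code y t \<in> codebooks d k" "\<And>j. j \<in> {1..k} \<Longrightarrow> L2_set (code y t j) {1..d} \<le> 6 / 5 * R"
    using Suc by (auto simp: idx_Suc)
  have y: "y i \<in> space (ball_measures d R M)" if "i \<in> B1 (Suc t) \<union> B2 (Suc t)" for i
    using Suc.prems(2)[of i] B1[OF t] B2[OF t] that by (auto simp: idx_Suc space_\<nu>)
  have f: "finite (B1 (Suc t))" "finite (B2 (Suc t))" using B1[OF t] B2[OF t] fin[OF t] finite_subset by blast+
  have "raw_update d k y (B1 (Suc t)) (B2 (Suc t)) t c j \<in> space (euc d)" for c j by (simp add: raw_update_def space_euc)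
  then have "code y (Suc t) \<in> codebooks d k"
    using measurable_space[OF \<pi>_meas] codebooks_point[OF IH(1)] by (auto simp: mb_step_def codebooks_def)
  moreover have "L2_set (code y (Suc t) j) {1..d} \<le> 6 / 5 * R" if "j \<in> {1..k}" for j
    unfolding mb_iter.simps
    by (rule mb_step_norm_le[OF y M0 f(1) _ f(2) _ IH(1) \<pi>_ball[OF t] _ IH(2) that]) (use B1[OF t] B2[OF t] R_pos in auto)
  ultimately show ?case by blast
qed

lemma measurable_code: "t \<le> T \<Longrightarrow> (\<lambda>y. code y t) \<in> law t \<rightarrow>\<^sub>M code_space d k"
proof (induction t)
  case 0
  then show ?case using c0 by (auto simp: space_code_space[symmetric] simp del: One_nat_def intro!: measurable_const)
next
  case (Suc t)
  then have t: "Suc t \<in> {1..T}" by simp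
  have f: "finite (B1 (Suc t))" "finite (B2 (Suc t))" using B1[OF t] B2[OF t] fin[OF t] finite_subset by blast+
  have "(\<lambda>y. code (restrict y (idx t)) t) \<in> law (Suc t) \<rightarrow>\<^sub>M code_space d k"
    by (rule measurable_compose[OF measurable_restrict_subset Suc.IH]) (use Suc in \<open>auto simp: idx_Suc\<close>)
  moreover have "code (restrict y (idx t)) t = code y t" for y
    by (rule code_agree) (use Suc in auto)
  ultimately have C: "(\<lambda>y. code y t) \<in> law (Suc t) \<rightarrow>\<^sub>M code_space d k" by simp
  show ?case unfolding mb_iter.simps
  proof (rule measurable_mb_step[where R = R and M = M, OF C])
    fix i assume "i \<in> B1 (Suc t) \<union> B2 (Suc t)"
    then have "i \<in> idx (Suc t)" using B1[OF t] B2[OF t] by (auto simp: idx_Suc)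
    then have "(\<lambda>y. y i) \<in> law (Suc t) \<rightarrow>\<^sub>M \<nu>" by (rule measurable_component_singleton)
    then show "(\<lambda>y. y i) \<in> law (Suc t) \<rightarrow>\<^sub>M ball_measures d R M" by (simp add: measurable_cong_sets[OF refl sets_\<nu>])
  qed (use M_pos f B1[OF t] B2[OF t] \<pi>_meas in auto)
qed

lemma code_merge:
  assumes t: "Suc t \<le> T"
  shows "code (merge (idx t) (B (Suc t)) (x, y)) (Suc t) =
    mb_step d k \<pi> t (B1 (Suc t)) (B2 (Suc t)) (code x t) y"
proof -
  have t': "Suc t \<in> {1..T}" using t by simp
  have "code (merge (idx t) (B (Suc t)) (x, y)) t = code x t"
    by (rule code_agree) (use t in \<open>auto simp: merge_def\<close>)
  moreover have "mb_step d k \<pi> t (B1 (Suc t)) (B2 (Suc t)) c (merge (idx t) (B (Suc t)) (x, y)) =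
      mb_step d k \<pi> t (B1 (Suc t)) (B2 (Suc t)) c y" for c
    by (rule mb_step_cong) (use B1[OF t'] B2[OF t'] idx_disj[OF t] in \<open>auto simp: merge_def\<close>)
  ultimately show ?thesis by simp
qed

lemma batch_step_at:
  assumes t: "Suc t \<le> T" and x: "x \<in> space (law t)" and near: "cdist d k cs (code x t) \<le> R0"
  shows "batch_step d k R \<mu> r0 cs M \<nu> (code x t) (B (Suc t)) (B1 (Suc t)) (B2 (Suc t)) \<pi> \<epsilon>"
proof
  have t': "Suc t \<in> {1..T}" using t by simp
  have xs: "x i \<in> space \<nu>" if "i \<in> idx t" for i using x that by (auto simp: space_PiM)
  note cp = code_props[of t x, OF Suc_leD[OF t] xs]
  show "code x t \<in> codebooks d k" "\<And>j. j \<in> {1..k} \<Longrightarrow> L2_set (code x t j) {1..d} \<le> 6 / 5 * R" using cp by auto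
  show "cdist d k cs (code x t) \<le> R0" by (rule near)
  show "finite (B (Suc t))" by (rule fin[OF t'])
  show "B1 (Suc t) \<subseteq> B (Suc t)" "B1 (Suc t) \<noteq> {}" "B2 (Suc t) \<subseteq> B (Suc t)" "B2 (Suc t) \<noteq> {}"
    using B1[OF t'] B2[OF t'] by auto
  show "\<pi> \<in> euc d \<rightarrow>\<^sub>M euc d" by (rule \<pi>_meas)
  show "\<And>x z. x \<in> space (euc d) \<Longrightarrow> z \<in> eball d (origin d) R \<Longrightarrow> edist d (\<pi> x) z \<le> edist d x z" by (rule \<pi>_nonexp)
  show "(\<forall>x\<in>space (euc d). \<pi> x \<in> eball d (origin d) R) \<or> (B1 (Suc t) = B2 (Suc t) \<and> \<pi> = (\<lambda>x. x))" by (rule \<pi>_ball[OF t'])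
  show "B1 (Suc t) \<inter> B2 (Suc t) = {} \<or> (B1 (Suc t) = B2 (Suc t) \<and> (AE y in \<nu>. single_cell d k (code x t) y))"
    using halves[OF t'] cp by blast
  show "\<And>S. S \<in> {B1 (Suc t), B2 (Suc t)} \<Longrightarrow> 6 * exp (- (R0 * p / 50)\<^sup>2 * real (card S) / (16 * R\<^sup>2 * M\<^sup>2)) \<le> \<epsilon>"
    by (rule \<epsilon>[OF t'])
qed

definition far :: "codebook \<Rightarrow> real" where
  "far c = (if cdist d k cs c \<le> R0 then 0 else 1)"

lemma measurable_far: "C \<in> Z \<rightarrow>\<^sub>M code_space d k \<Longrightarrow> (\<lambda>z. far (C z)) \<in> borel_measurable Z"
  unfolding far_def using measurable_potential(2)[of C Z] by measurable

lemma integrable_law: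
  assumes "f \<in> borel_measurable (law t)" "\<And>y. y \<in> space (law t) \<Longrightarrow> \<bar>f y\<bar> \<le> b"
  shows "integrable (law t) (f :: _ \<Rightarrow> real)"
proof -
  interpret prob_space "law t" by (rule prob_law)
  show ?thesis by (rule integrable_const_bound[where B = b]) (use assms in auto)
qed

text \<open>
  From a codebook near \<open>cs\<close> a step leaves the neighbourhood with probability at
  most \<open>\<epsilon>\<close>; the probabilities of the individual steps add up.
\<close>

lemma integral_far_le: "t \<le> T \<Longrightarrow> (\<integral>y. far (code y t) \<partial>law t) \<le> real t * \<epsilon>"
proof (induction t)
  case 0
  then show ?case using near0 by (simp add: far_def)
next
  case (Suc t)
  interpret L: prob_space "law t" by (rule prob_law)
  have t: "Suc t \<le> T" "t \<le> T" using Suc by auto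
  have fm: "(\<lambda>y. far (code y t)) \<in> borel_measurable (law t)" by (rule measurable_far[OF measurable_code[OF t(2)]])
  have fint: "integrable (law t) (\<lambda>y. far (code y t))" by (rule integrable_law[OF fm, of 1]) (simp add: far_def)
  have "(\<integral>y. far (code y (Suc t)) \<partial>Pi\<^sub>M (idx t \<union> B (Suc t)) (\<lambda>_. \<nu>)) \<le> (\<integral>x. far (code x t) + \<epsilon> \<partial>law t)"
  proof (rule integral_PiM_Un_le[OF prob_\<nu> finite_idx[OF t(2)] _ idx_disj[OF t(1)], where b = 1])
    show "finite (B (Suc t))" using fin t by simp
    show "(\<lambda>y. far (code y (Suc t))) \<in> borel_measurable (Pi\<^sub>M (idx t \<union> B (Suc t)) (\<lambda>_. \<nu>))"
      using measurable_far[OF measurable_code[OF t(1)]] by (simp only: idx_Suc)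
    show "integrable (law t) (\<lambda>x. far (code x t) + \<epsilon>)" using fint by simp
    fix x assume x: "x \<in> space (law t)"
    show "(\<integral>y. far (code (merge (idx t) (B (Suc t)) (x, y)) (Suc t)) \<partial>Pi\<^sub>M (B (Suc t)) (\<lambda>_. \<nu>)) \<le> far (code x t) + \<epsilon>"
      unfolding code_merge[OF t(1)]
    proof (cases "cdist d k cs (code x t) \<le> R0")
      case True
      interpret S: batch_step d k R \<mu> r0 cs M \<nu> "code x t" "B (Suc t)" "B1 (Suc t)" "B2 (Suc t)" t \<pi> \<epsilon>
        by (rule batch_step_at[OF t(1) x True])
      define A where "A = {y \<in> space S.Q. \<not> cdist d k cs (mb_step d k \<pi> t (B1 (Suc t)) (B2 (Suc t)) (code x t) y) \<le> R0}"
      have AQ: "A \<inter> space S.Q = A" unfolding A_def by blast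
      have "(\<integral>y. far (mb_step d k \<pi> t (B1 (Suc t)) (B2 (Suc t)) (code x t) y) \<partial>Pi\<^sub>M (B (Suc t)) (\<lambda>_. \<nu>)) =
        (\<integral>y. indicator A y \<partial>S.Q)"
        by (rule Bochner_Integration.integral_cong) (simp_all add: far_def A_def)
      also have "\<dots> = measure S.Q A" by (simp only: Bochner_Integration.integral_indicator AQ)
      also have "\<dots> \<le> \<epsilon>" unfolding A_def by (rule S.prob_step_far_le)
      finally show "(\<integral>y. far (mb_step d k \<pi> t (B1 (Suc t)) (B2 (Suc t)) (code x t) y) \<partial>Pi\<^sub>M (B (Suc t)) (\<lambda>_. \<nu>)) \<le> far (code x t) + \<epsilon>"
        by (simp add: far_def)
    next
      case False
      interpret PB: prob_space "Pi\<^sub>M (B (Suc t)) (\<lambda>_. \<nu>)" by (rule prob_space_PiM) (rule prob_\<nu>)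
      have "(\<integral>y. far (mb_step d k \<pi> t (B1 (Suc t)) (B2 (Suc t)) (code x t) y) \<partial>Pi\<^sub>M (B (Suc t)) (\<lambda>_. \<nu>))
        \<le> (\<integral>y. 1 \<partial>Pi\<^sub>M (B (Suc t)) (\<lambda>_. \<nu>))"
        by (rule integral_mono') (auto simp: far_def)
      then show "(\<integral>y. far (mb_step d k \<pi> t (B1 (Suc t)) (B2 (Suc t)) (code x t) y) \<partial>Pi\<^sub>M (B (Suc t)) (\<lambda>_. \<nu>)) \<le> far (code x t) + \<epsilon>"
        using False \<epsilon>0 by (simp add: far_def PB.prob_space)
    qed
  qed (use \<epsilon>0 in \<open>auto simp: far_def\<close>)
  also have "\<dots> = (\<integral>x. far (code x t) \<partial>law t) + \<epsilon>" using fint by (simp add: L.prob_space)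
  also have "\<dots> \<le> real (Suc t) * \<epsilon>" using Suc.IH[OF t(2)] by (simp add: algebra_simps)
  finally show ?case by (simp only: idx_Suc)
qed

lemma integrable_potential: "t \<le> T \<Longrightarrow> integrable (law t) (\<lambda>y. potential (code y t))"
  by (rule integrable_law[OF measurable_potential(1)[OF measurable_code], where b = "5 * real k * R\<^sup>2"])
     (use potential_bounds in auto)

text \<open>
  If the current codebook is near \<open>cs\<close>, the one-step bound applies; the remaining
  codebooks contribute at most the maximal potential, weighted by the small probability of
  having left the neighbourhood.
\<close>

lemma integral_potential_Suc_le:
  assumes t: "Suc t \<le> T"
  defines "s \<equiv> 1 / real (t + 1)"
  shows "(\<integral>y. potential (code y (Suc t)) \<partial>law (Suc t)) \<le>
    max 0 (1 - 3 / 2 * s) * (\<integral>y. potential (code y t) \<partial>law t) + 4 * s\<^sup>2 * R0\<^sup>2 +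
    (5 * real k * R\<^sup>2 * (real t + 1) + 6 * R0 * R * M / p) * \<epsilon>"
proof -
  interpret L: prob_space "law t" by (rule prob_law)
  have t': "t \<le> T" using t by simp
  define V where "V = 4 * s\<^sup>2 * R0\<^sup>2 + (5 * real k * R\<^sup>2 + 6 * R0 * R * M / p) * \<epsilon>"
  have V0: "0 \<le> V" unfolding V_def using R0_pos R_pos M_pos p_pos \<epsilon>0 by (intro add_nonneg_nonneg mult_nonneg_nonneg) auto
  define g where "g = (\<lambda>x. max 0 (1 - 3 / 2 * s) * potential (code x t) + V + 5 * real k * R\<^sup>2 * far (code x t))"
  have fint: "integrable (law t) (\<lambda>y. far (code y t))"
    by (rule integrable_law[OF measurable_far[OF measurable_code[OF t']], of 1]) (simp add: far_def)
  have "(\<integral>y. potential (code y (Suc t)) \<partial>Pi\<^sub>M (idx t \<union> B (Suc t)) (\<lambda>_. \<nu>)) \<le> (\<integral>x. g x \<partial>law t)"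
  proof (rule integral_PiM_Un_le[OF prob_\<nu> finite_idx[OF t'] _ idx_disj[OF t], where b = "5 * real k * R\<^sup>2"])
    show "finite (B (Suc t))" using fin t by simp
    show "(\<lambda>y. potential (code y (Suc t))) \<in> borel_measurable (Pi\<^sub>M (idx t \<union> B (Suc t)) (\<lambda>_. \<nu>))"
      using measurable_potential(1)[OF measurable_code[OF t]] by (simp only: idx_Suc)
    show "integrable (law t) g" unfolding g_def using fint integrable_potential[OF t'] by simp
    fix x assume x: "x \<in> space (law t)"
    show "0 \<le> g x" unfolding g_def using V0 potential_bounds by (intro add_nonneg_nonneg mult_nonneg_nonneg) (auto simp: far_def)
    show "(\<integral>y. potential (code (merge (idx t) (B (Suc t)) (x, y)) (Suc t)) \<partial>Pi\<^sub>M (B (Suc t)) (\<lambda>_. \<nu>)) \<le> g x"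
      unfolding code_merge[OF t]
    proof (cases "cdist d k cs (code x t) \<le> R0")
      case True
      interpret S: batch_step d k R \<mu> r0 cs M \<nu> "code x t" "B (Suc t)" "B1 (Suc t)" "B2 (Suc t)" t \<pi> \<epsilon>
        by (rule batch_step_at[OF t x True])
      show "(\<integral>y. potential (mb_step d k \<pi> t (B1 (Suc t)) (B2 (Suc t)) (code x t) y) \<partial>Pi\<^sub>M (B (Suc t)) (\<lambda>_. \<nu>)) \<le> g x"
        using S.integral_potential_step_le True unfolding S.s_def s_def[symmetric] by (simp add: g_def V_def far_def)
    next
      case False
      interpret PB: prob_space "Pi\<^sub>M (B (Suc t)) (\<lambda>_. \<nu>)" by (rule prob_space_PiM) (rule prob_\<nu>)
      have "(\<integral>y. potential (mb_step d k \<pi> t (B1 (Suc t)) (B2 (Suc t)) (code x t) y) \<partial>Pi\<^sub>M (B (Suc t)) (\<lambda>_. \<nu>))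
        \<le> (\<integral>y. 5 * real k * R\<^sup>2 \<partial>Pi\<^sub>M (B (Suc t)) (\<lambda>_. \<nu>))"
        by (rule integral_mono') (use potential_bounds in auto)
      also have "\<dots> = 5 * real k * R\<^sup>2 * far (code x t)" using False by (simp add: far_def PB.prob_space)
      also have "\<dots> \<le> g x"
        using V0 potential_bounds(1)[of "code x t"] by (simp add: g_def)
      finally show "(\<integral>y. potential (mb_step d k \<pi> t (B1 (Suc t)) (B2 (Suc t)) (code x t) y) \<partial>Pi\<^sub>M (B (Suc t)) (\<lambda>_. \<nu>)) \<le> g x" .
    qed
  qed (use potential_bounds in auto)
  also have "(\<integral>x. g x \<partial>law t) = max 0 (1 - 3 / 2 * s) * (\<integral>y. potential (code y t) \<partial>law t) + V + 5 * real k * R\<^sup>2 * (\<integral>x. far (code x t) \<partial>law t)"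
    unfolding g_def using fint integrable_potential[OF t'] by (simp add: L.prob_space)
  also have "5 * real k * R\<^sup>2 * (\<integral>x. far (code x t) \<partial>law t) \<le> 5 * real k * R\<^sup>2 * (real t * \<epsilon>)"
    by (intro mult_left_mono integral_far_le[OF t']) auto
  finally show ?thesis unfolding idx_Suc V_def by (simp add: algebra_simps)
qed

lemma integral_potential_le:
  assumes T: "1 \<le> T" and small: "real T ^ 3 * \<epsilon> \<le> 6"
  shows "(\<integral>y. potential (code y T) \<partial>law T) \<le> 80 * R\<^sup>2 * M / (p * real T)"
proof -
  \<comment> \<open>All terms of the recursion are compared with \<open>W\<close>; since \<open>k
    * p \<le> M\<close>, it dominates \<open>k * R\<^sup>2\<close>.\<close>
  define W where "W = R\<^sup>2 * M / p"
  have W0: "0 \<le> W" using M_pos p_pos by (simp add: W_def)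
  have kW: "real k * R\<^sup>2 \<le> W"
  proof -
    have "real k \<le> M / p" using k_p_le p_pos by (simp add: divide_simps mult.commute)
    then have "real k * R\<^sup>2 \<le> M / p * R\<^sup>2" by (intro mult_right_mono) auto
    then show ?thesis by (simp add: W_def mult.commute)
  qed
  have RW: "R\<^sup>2 \<le> W"
  proof -
    have "1 * R\<^sup>2 \<le> real k * R\<^sup>2" using k_ge_2 by (intro mult_right_mono) auto
    then show ?thesis using kW by simp
  qed
  have R0W: "6 * R0 * R * M / p \<le> 6 / 5 * W"
  proof -
    have "6 * R0 * (R * (M / p)) \<le> 6 * (R / 5) * (R * (M / p))"
      using R0_le(2) R_pos M_pos p_pos by (intro mult_right_mono mult_left_mono) auto
    then show ?thesis by (simp add: W_def power2_eq_square)
  qed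
  have "(\<integral>y. potential (code y T) \<partial>law T) \<le> 2 * (40 * W) / real T"
  proof (rule averaged_recursion[where T = T and a = "\<lambda>t. \<integral>y. potential (code y t) \<partial>law t"])
    fix t assume t: "t < T"
    define s where "s = 1 / real (t + 1)"
    have s: "0 < s" "s * (real t + 1) = 1" by (auto simp: s_def add.commute)
    have "(real t + 1) * \<epsilon> \<le> 6 * s\<^sup>2"
    proof -
      have "(real t + 1) ^ 3 * \<epsilon> \<le> real T ^ 3 * \<epsilon>"
        using t \<epsilon>0 by (intro mult_right_mono power_mono) auto
      then have "(real t + 1) ^ 3 * \<epsilon> \<le> 6" using small by simp
      then have "s\<^sup>2 * ((real t + 1) ^ 3 * \<epsilon>) \<le> s\<^sup>2 * 6" by (intro mult_left_mono) auto
      also have "s\<^sup>2 * ((real t + 1) ^ 3 * \<epsilon>) = (s * (real t + 1))\<^sup>2 * ((real t + 1) * \<epsilon>)"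
        by (simp add: power2_eq_square power3_eq_cube)
      finally show ?thesis using s by (simp add: mult.commute)
    qed
    note e = this
    have "(5 * real k * R\<^sup>2 * (real t + 1) + 6 * R0 * R * M / p) * \<epsilon> \<le> (31 / 5 * W * (real t + 1)) * \<epsilon>"
    proof (rule mult_right_mono[OF _ \<epsilon>0])
      have "5 * real k * R\<^sup>2 * (real t + 1) \<le> 5 * W * (real t + 1)" using kW by (intro mult_right_mono) auto
      moreover have "6 / 5 * W * 1 \<le> 6 / 5 * W * (real t + 1)" using W0 by (intro mult_left_mono) auto
      ultimately show "5 * real k * R\<^sup>2 * (real t + 1) + 6 * R0 * R * M / p \<le> 31 / 5 * W * (real t + 1)"
        using R0W by (simp add: algebra_simps)
    qed
    also have "\<dots> = 31 / 5 * W * ((real t + 1) * \<epsilon>)" by simp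
    also have "\<dots> \<le> 31 / 5 * W * (6 * s\<^sup>2)" using e W0 by (intro mult_left_mono) auto
    finally have 1: "(5 * real k * R\<^sup>2 * (real t + 1) + 6 * R0 * R * M / p) * \<epsilon> \<le> 186 / 5 * (W * s\<^sup>2)" by simp
    have "4 * s\<^sup>2 * R0\<^sup>2 \<le> 4 * s\<^sup>2 * (W / 25)" using R0_sq_le RW by (intro mult_left_mono) auto
    then have 2: "4 * s\<^sup>2 * R0\<^sup>2 \<le> 4 / 25 * (W * s\<^sup>2)" by simp
    have "0 \<le> W * s\<^sup>2" using W0 by simp
    then have "4 * s\<^sup>2 * R0\<^sup>2 + (5 * real k * R\<^sup>2 * (real t + 1) + 6 * R0 * R * M / p) * \<epsilon> \<le> 40 * (W * s\<^sup>2)"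
      using 1 2 by linarith
    then show "(\<integral>y. potential (code y (Suc t)) \<partial>law (Suc t)) \<le>
      max 0 (1 - 3 / 2 * (1 / real (t + 1))) * (\<integral>y. potential (code y t) \<partial>law t) + 40 * W * (1 / real (t + 1))\<^sup>2"
      using integral_potential_Suc_le[of t] t unfolding s_def[symmetric] by simp
  qed (use W0 T in auto)
  then show ?thesis by (simp add: W_def mult_ac)
qed

lemma expected_excess_le:
  assumes T: "1 \<le> T" and small: "real T ^ 3 * \<epsilon> \<le> 6"
  shows "integrable (law T) (\<lambda>y. distortion d k \<mu> (code y T) - opt_distortion d k \<mu>)"
    and "(\<integral>y. distortion d k \<mu> (code y T) - opt_distortion d k \<mu> \<partial>law T) \<le>
      measure \<mu> (space \<mu>) * (80 * R\<^sup>2 * M / (p * real T))"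
proof -
  define A where "A = measure \<mu> (space \<mu>)"
  have A0: "0 \<le> A" by (simp add: A_def)
  have cp: "code y T \<in> codebooks d k" "\<And>j. j \<in> {1..k} \<Longrightarrow> L2_set (code y T j) {1..d} \<le> 6 / 5 * R"
    if "y \<in> space (law T)" for y
  proof -
    have "y i \<in> space \<nu>" if "i \<in> idx T" for i using \<open>y \<in> space (law T)\<close> that by (auto simp: space_PiM)
    from code_props[OF order_refl this]
    show "code y T \<in> codebooks d k" "\<And>j. j \<in> {1..k} \<Longrightarrow> L2_set (code y T j) {1..d} \<le> 6 / 5 * R" by auto
  qed
  have ub: "distortion d k \<mu> (code y T) - opt_distortion d k \<mu> \<le> A * potential (code y T)" if y: "y \<in> space (law T)" for y
    using order_trans[OF excess_le[OF opt_cs cp(1)[OF y]] mult_left_mono[OF cdist_sq_le_potential[OF cp(2)[OF y]]]] A0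
    by (simp add: A_def)
  have lb: "0 \<le> distortion d k \<mu> (code y T) - opt_distortion d k \<mu>" if y: "y \<in> space (law T)" for y
    using opt_distortion_le[OF opt_cs cp(1)[OF y]] by simp
  show int: "integrable (law T) (\<lambda>y. distortion d k \<mu> (code y T) - opt_distortion d k \<mu>)"
  proof (rule integrable_law[where b = "A * (5 * real k * R\<^sup>2)"])
    show "(\<lambda>y. distortion d k \<mu> (code y T) - opt_distortion d k \<mu>) \<in> borel_measurable (law T)"
      using measurable_distortion[OF measurable_code[of T]] by simp
    fix y assume y: "y \<in> space (law T)"
    have "A * potential (code y T) \<le> A * (5 * real k * R\<^sup>2)" using A0 potential_bounds by (intro mult_left_mono) auto
    then show "\<bar>distortion d k \<mu> (code y T) - opt_distortion d k \<mu>\<bar> \<le> A * (5 * real k * R\<^sup>2)"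
      using lb[OF y] ub[OF y] by linarith
  qed
  have "(\<integral>y. distortion d k \<mu> (code y T) - opt_distortion d k \<mu> \<partial>law T) \<le> (\<integral>y. A * potential (code y T) \<partial>law T)"
    by (rule integral_mono[OF int]) (use integrable_potential ub in auto)
  also have "\<dots> = A * (\<integral>y. potential (code y T) \<partial>law T)" by simp
  also have "\<dots> \<le> A * (80 * R\<^sup>2 * M / (p * real T))"
    by (intro mult_left_mono integral_potential_le[OF T small] A0)
  finally show "(\<integral>y. distortion d k \<mu> (code y T) - opt_distortion d k \<mu> \<partial>law T) \<le>
      measure \<mu> (space \<mu>) * (80 * R\<^sup>2 * M / (p * real T))" by (simp add: A_def)
qed

end

section \<open>The risk bound for the sample\<close>

lemma iid_sample_restrict:
  assumes P: "prob_space P" and X: "X \<in> P \<rightarrow>\<^sub>M N" and iid: "iid_sample P N X n Xs"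
    and K: "K \<subseteq> {1..n}" "K \<noteq> {}"
  shows "(\<lambda>\<omega>. \<lambda>i\<in>K. Xs i \<omega>) \<in> P \<rightarrow>\<^sub>M Pi\<^sub>M K (\<lambda>_. distr P N X)"
    and "distr P (Pi\<^sub>M K (\<lambda>_. distr P N X)) (\<lambda>\<omega>. \<lambda>i\<in>K. Xs i \<omega>) = Pi\<^sub>M K (\<lambda>_. distr P N X)"
proof -
  interpret prob_space P by fact
  have ind: "indep_vars (\<lambda>_. N) Xs K"
    by (rule indep_vars_subset[OF _ K(1)]) (use iid in \<open>simp add: iid_sample_def\<close>)
  have d: "\<And>i. i \<in> K \<Longrightarrow> distr P N (Xs i) = distr P N X"
    using iid K by (auto simp: iid_sample_def)
  have rv: "Xs i \<in> P \<rightarrow>\<^sub>M N" if "i \<in> K" for i using ind that by (auto simp: indep_vars_def)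
  have s: "sets (Pi\<^sub>M K (\<lambda>_. distr P N X)) = sets (Pi\<^sub>M K (\<lambda>_. N))" by (rule sets_PiM_cong) auto
  show "(\<lambda>\<omega>. \<lambda>i\<in>K. Xs i \<omega>) \<in> P \<rightarrow>\<^sub>M Pi\<^sub>M K (\<lambda>_. distr P N X)"
    unfolding measurable_cong_sets[OF refl s] by (rule measurable_restrict) (rule rv)
  have "distr P (Pi\<^sub>M K (\<lambda>_. distr P N X)) (\<lambda>\<omega>. \<lambda>i\<in>K. Xs i \<omega>) = distr P (Pi\<^sub>M K (\<lambda>_. N)) (\<lambda>\<omega>. \<lambda>i\<in>K. Xs i \<omega>)"
    by (rule distr_cong[OF refl s]) simp
  also have "\<dots> = Pi\<^sub>M K (\<lambda>i. distr P N (Xs i))"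
    using indep_vars_iff_distr_eq_PiM'[OF K(2) rv] ind by simp
  also have "\<dots> = Pi\<^sub>M K (\<lambda>_. distr P N X)" by (rule PiM_cong) (use d in auto)
  finally show "distr P (Pi\<^sub>M K (\<lambda>_. distr P N X)) (\<lambda>\<omega>. \<lambda>i\<in>K. Xs i \<omega>) = Pi\<^sub>M K (\<lambda>_. distr P N X)" .
qed

lemma batches_card:
  assumes "batches n m T B"
  shows "T * m \<le> n" "n < (T + 1) * m" "\<And>t. t \<in> {1..T} \<Longrightarrow> finite (B t)" "(\<Union>t\<in>{1..T}. B t) \<subseteq> {1..n}"
proof -
  have dj: "disjoint_family_on B {1..T}" and B: "\<And>t. t \<in> {1..T} \<Longrightarrow> B t \<subseteq> {1..n} \<and> card (B t) = m"
    and lo: "card ({1..n} - (\<Union>t\<in>{1..T}. B t)) < m" using assms by (auto simp: batches_def)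
  show fin: "finite (B t)" if "t \<in> {1..T}" for t using B[OF that] finite_subset by blast
  show sub: "(\<Union>t\<in>{1..T}. B t) \<subseteq> {1..n}" using B by blast
  have card: "card (\<Union>t\<in>{1..T}. B t) = T * m"
  proof -
    have "card (\<Union>t\<in>{1..T}. B t) = (\<Sum>t\<in>{1..T}. card (B t))"
      by (rule card_UN_disjoint) (use fin dj in \<open>auto simp: disjoint_family_on_def\<close>)
    then show ?thesis using B by simp
  qed
  show 1: "T * m \<le> n" using card_mono[OF _ sub] card by simp
  have "card ({1..n} - (\<Union>t\<in>{1..T}. B t)) = n - T * m"
    using card_Diff_subset[OF finite_subset[OF sub] sub] card by simp
  then show "n < (T + 1) * m" using lo 1 by (simp add: algebra_simps)
qed

lemma halves_card:
  assumes "halves S S1 S2" "finite S"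
  shows "S1 \<subseteq> S" "S2 \<subseteq> S" "S1 \<inter> S2 = {}" "card S \<le> 2 * card S1 + 1" "card S \<le> 2 * card S2 + 1"
proof -
  have u: "S1 \<union> S2 = S" and d: "S1 \<inter> S2 = {}" and l: "card S1 \<le> card S2 + 1" "card S2 \<le> card S1 + 1"
    using assms by (auto simp: halves_def)
  show "S1 \<subseteq> S" "S2 \<subseteq> S" "S1 \<inter> S2 = {}" using u d by auto
  have "finite S1" "finite S2" using u assms(2) finite_subset by auto
  then have "card S = card S1 + card S2" using card_Un_disjoint[OF _ _ d] u by simp
  then show "card S \<le> 2 * card S1 + 1" "card S \<le> 2 * card S2 + 1" using l by auto
qed

lemma ball_distribution_mean_measure:
  assumes P: "prob_space P" and X: "X \<in> P \<rightarrow>\<^sub>M ball_measures d R M" and k: "2 \<le> k"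
    and supp: "supported_by_more_than d (mean_measure d P X) k"
  shows "ball_distribution d k R (mean_measure d P X)"
proof (rule ball_distribution.intro)
  interpret prob_space P by fact
  let ?\<mu> = "mean_measure d P X"
  have Xs: "X \<omega> \<in> space (ball_measures d R M)" if "\<omega> \<in> space P" for \<omega> using measurable_space[OF X that] .
  show s: "sets ?\<mu> = sets (euc d)" by (simp add: mean_measure_def)
  then have sp: "space ?\<mu> = space (euc d)" by (rule sets_eq_imp_space_eq)
  have "emeasure ?\<mu> (space ?\<mu>) = (\<integral>\<^sup>+ \<omega>. emeasure (X \<omega>) (space (euc d)) \<partial>P)"
    unfolding sp by (rule emeasure_mean_measure[OF X]) simp
  also have "\<dots> \<le> (\<integral>\<^sup>+ \<omega>. ennreal M \<partial>P)"
    by (rule nn_integral_mono) (use ball_measuresD(2,5)[OF Xs] in force)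
  also have "\<dots> < \<infinity>" by (simp add: emeasure_space_1)
  finally show "finite_measure ?\<mu>" by (intro finite_measureI) auto
  have A: "space (euc d) - eball d (origin d) R \<in> sets (euc d)"
    using sets_eball[OF space_euc_nonempty] by auto
  have "emeasure ?\<mu> (space (euc d) - eball d (origin d) R) = (\<integral>\<^sup>+ \<omega>. emeasure (X \<omega>) (space (euc d) - eball d (origin d) R) \<partial>P)"
    by (rule emeasure_mean_measure[OF X A])
  also have "\<dots> = (\<integral>\<^sup>+ \<omega>. 0 \<partial>P)"
  proof (rule nn_integral_cong)
    fix \<omega> assume "\<omega> \<in> space P"
    from Xs[OF this] show "emeasure (X \<omega>) (space (euc d) - eball d (origin d) R) = 0"
      using ball_measuresD(2)[OF Xs[OF \<open>\<omega> \<in> space P\<close>]] by (simp add: space_ball_measures)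
  qed
  finally have "emeasure ?\<mu> (space (euc d) - eball d (origin d) R) = 0" by simp
  then show "AE u in ?\<mu>. u \<in> eball d (origin d) R"
    by (intro AE_I[where N = "space (euc d) - eball d (origin d) R"]) (use A s sp in auto)
qed (fact k supp)+

text \<open>
  The number \<open>K\<close> is the prescribed batch length. Its factor \<open>240000\<close>
  makes the exponent in the concentration inequality at most \<open>- 3 * ln n\<close>, so that
  \<open>n\<close> steps with failure probability \<open>6 / n ^ 3\<close> are affordable. If
  there is no complete batch, then \<open>n < m\<close>, and the claimed bound exceeds the
  excess of any codebook within \<open>R0\<close> of \<open>cs\<close>.
\<close>

lemma (in sample_law) run_expected_excess:
  fixes n m T :: nat and c0 :: codebook and B B1 B2 :: "nat \<Rightarrow> nat set" and \<pi> :: "pt \<Rightarrow> pt"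
  defines "K \<equiv> 240000 * real k * M\<^sup>2 * ln (real n) / (R0 / R * p)\<^sup>2"
  assumes n: "2 \<le> n" and m: "\<bar>real m - K\<bar> \<le> 1" and B: "batches n m T B"
    and c0: "c0 \<in> codebooks d k" and near0: "cdist d k cs c0 \<le> R0"
    and \<pi>_meas: "\<pi> \<in> euc d \<rightarrow>\<^sub>M euc d"
    and \<pi>_nonexp: "\<And>x z. x \<in> space (euc d) \<Longrightarrow> z \<in> eball d (origin d) R \<Longrightarrow> edist d (\<pi> x) z \<le> edist d x z"
    and \<pi>_ball: "\<And>t. t \<in> {1..T} \<Longrightarrow>
      (\<forall>x\<in>space (euc d). \<pi> x \<in> eball d (origin d) R) \<or> (B1 t = B2 t \<and> \<pi> = (\<lambda>x. x))"
    and halves: "\<And>t. t \<in> {1..T} \<Longrightarrow>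
      B1 t \<inter> B2 t = {} \<or> (B1 t = B2 t \<and> (\<forall>c\<in>codebooks d k. AE x in \<nu>. single_cell d k c x))"
    and sub: "\<And>t. t \<in> {1..T} \<Longrightarrow> B1 t \<subseteq> B t \<and> B2 t \<subseteq> B t"
    and card: "\<And>t. t \<in> {1..T} \<Longrightarrow> m \<le> 2 * card (B1 t) + 1 \<and> m \<le> 2 * card (B2 t) + 1"
    and P: "prob_space P" and X: "X \<in> P \<rightarrow>\<^sub>M ball_measures d R M"
    and iid: "iid_sample P (ball_measures d R M) X n Xs" and \<nu>: "\<nu> = distr P (ball_measures d R M) X"
  defines "excess \<equiv> \<lambda>\<omega>. distortion d k \<mu> (mb_iter d k \<pi> B1 B2 c0 (\<lambda>i. Xs i \<omega>) T) - opt_distortion d k \<mu>"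
  shows "integrable P excess \<and> (\<integral>\<omega>. excess \<omega> \<partial>P) \<le> measure \<mu> (space \<mu>) *
    (76800000 * (real k)\<^sup>2 * M ^ 3 * R\<^sup>2 * (ln (real n) / (real n * (R0 / R)\<^sup>2 * p ^ 3)))"
proof -
  interpret P: prob_space P by fact
  define \<kappa> where "\<kappa> = R0 / R"
  have \<kappa>: "0 < \<kappa>" "\<kappa> \<le> 1 / 5" using R0_pos R0_le(2) R_pos by (auto simp: \<kappa>_def divide_simps)
  define l where "l = ln (real n)"
  have l: "2 / 3 \<le> l"
  proof -
    have "ln 2 \<le> l" unfolding l_def using n by simp
    then show ?thesis using ln2_ge_two_thirds by linarith
  qed
  define q where "q = M / p"
  have q: "2 \<le> q" using p_le p_pos by (simp add: q_def divide_simps)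
  have kq: "real k \<le> q" using k_p_le p_pos by (simp add: q_def divide_simps)
  define z where "z = real k * q\<^sup>2 * l / \<kappa>\<^sup>2"
  have K: "K = 240000 * z"
    using p_pos \<kappa> by (simp add: K_def z_def q_def l_def \<kappa>_def[symmetric] power_mult_distrib power_divide mult_ac)
  have z1: "1 \<le> z"
  proof -
    have "\<kappa>\<^sup>2 \<le> 1" using \<kappa> by (intro power_le_one) auto
    moreover have "2 * 2\<^sup>2 * (2 / 3) \<le> real k * q\<^sup>2 * l"
      using k_ge_2 q l by (intro mult_mono power_mono) auto
    ultimately show ?thesis using \<kappa> by (simp add: z_def divide_simps)
  qed
  have mK: "real m \<le> 480000 * z" "240000 * z - 1 \<le> real m" using m z1 unfolding K by auto
  have m1: "1 \<le> m" using mK(2) z1 by linarith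
  note bc = batches_card[OF B]
  define bnd where "bnd = 76800000 * (real k)\<^sup>2 * M ^ 3 * R\<^sup>2 * (ln (real n) / (real n * (R0 / R)\<^sup>2 * p ^ 3))"
  have bnd: "bnd = 76800000 * (R\<^sup>2 * q * real k * z / real n)"
    using p_pos \<kappa> n by (simp add: bnd_def z_def q_def l_def[symmetric] \<kappa>_def[symmetric] power2_eq_square power3_eq_cube field_simps)
  show ?thesis
  proof (cases "T = 0")
    case True
    have e: "excess \<omega> = distortion d k \<mu> c0 - opt_distortion d k \<mu>" for \<omega> using True by (simp add: excess_def)
    have "excess \<omega> \<le> measure \<mu> (space \<mu>) * bnd" for \<omega>
    proof -
      have "excess \<omega> \<le> measure \<mu> (space \<mu>) * (cdist d k cs c0)\<^sup>2" unfolding e by (rule excess_le[OF opt_cs c0])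
      also have "\<dots> \<le> measure \<mu> (space \<mu>) * R0\<^sup>2" using near0 by (intro mult_left_mono power_mono cdist_nonneg) auto
      also have "\<dots> \<le> measure \<mu> (space \<mu>) * bnd"
      proof (rule mult_left_mono)
        have "n < m" using bc(2) True by simp
        then have "1 \<le> real m / real n" using n by (simp add: divide_simps)
        also have "\<dots> \<le> 480000 * z / real n" using mK by (intro divide_right_mono) auto
        finally have 1: "1 \<le> 480000 * z / real n" .
        have "R0\<^sup>2 \<le> R\<^sup>2 * 1" using R0_sq_le zero_le_power2[of R] by linarith
        also have "\<dots> \<le> R\<^sup>2 * (480000 * z / real n)" using 1 by (intro mult_left_mono) auto
        also have "\<dots> \<le> (R\<^sup>2 * (q * real k)) * (480000 * z / real n)"
        proof (rule mult_right_mono)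
          have "1 * 1 \<le> q * real k" using q k_ge_2 by (intro mult_mono) auto
          then have "R\<^sup>2 * 1 \<le> R\<^sup>2 * (q * real k)" by (intro mult_left_mono) auto
          then show "R\<^sup>2 \<le> R\<^sup>2 * (q * real k)" by simp
        qed (use z1 in auto)
        also have "\<dots> = 480000 * (R\<^sup>2 * q * real k * z / real n)" by simp
        also have "\<dots> \<le> bnd" unfolding bnd using q z1 by (intro mult_right_mono) auto
        finally show "R0\<^sup>2 \<le> bnd" .
      qed simp
      finally show ?thesis .
    qed
    then show ?thesis unfolding bnd_def[symmetric] e by (simp add: P.prob_space)
  next
    case False
    then have T: "1 \<le> T" by simp
    define \<epsilon> where "\<epsilon> = 6 / real n ^ 3"
    have TB: "0 < card (B1 t)" "0 < card (B2 t)" if "t \<in> {1..T}" for t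
      using card[OF that] mK(2) z1 by linarith+
    interpret mb_run d k R \<mu> r0 cs M \<nu> c0 B B1 B2 T \<pi> \<epsilon>
    proof
      show "disjoint_family_on B {1..T}" using B by (simp add: batches_def)
      show "finite (B t)" if "t \<in> {1..T}" for t by (rule bc(3)[OF that])
      show "B1 t \<subseteq> B t \<and> B1 t \<noteq> {}" "B2 t \<subseteq> B t \<and> B2 t \<noteq> {}" if "t \<in> {1..T}" for t
        using sub[OF that] TB[OF that] by auto
      show "0 \<le> \<epsilon>" by (simp add: \<epsilon>_def)
      fix t S assume t: "t \<in> {1..T}" and S: "S \<in> {B1 t, B2 t}"
      have "real m \<le> 2 * real (card S) + 1" using card[OF t] S by auto
      then have cS: "60000 * z \<le> real (card S)" using mK(2) z1 by linarith
      have "3 * l \<le> 60000 * (real k * l) / 40000" using k_ge_2 l by simp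
      also have "\<dots> = \<kappa>\<^sup>2 / (40000 * q\<^sup>2) * (60000 * z)" using \<kappa> q by (simp add: z_def)
      also have "\<dots> \<le> \<kappa>\<^sup>2 / (40000 * q\<^sup>2) * real (card S)" using cS by (intro mult_left_mono) auto
      also have "\<dots> = (R0 * p / 50)\<^sup>2 * real (card S) / (16 * R\<^sup>2 * M\<^sup>2)"
        using R_pos M_pos p_pos by (simp add: \<kappa>_def q_def power_mult_distrib power_divide)
      finally have "exp (- (R0 * p / 50)\<^sup>2 * real (card S) / (16 * R\<^sup>2 * M\<^sup>2)) \<le> exp (- (3 * l))" by simp
      also have "\<dots> = 1 / real n ^ 3" using n by (simp add: l_def exp_minus exp_of_nat_mult[of 3, simplified] inverse_eq_divide)
      finally show "6 * exp (- (R0 * p / 50)\<^sup>2 * real (card S) / (16 * R\<^sup>2 * M\<^sup>2)) \<le> \<epsilon>" by (simp add: \<epsilon>_def)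
    qed (fact c0 near0 \<pi>_meas \<pi>_nonexp \<pi>_ball halves)+
    have "T \<le> T * m" using m1 by simp
    then have Tn: "T \<le> n" using bc(1) by linarith
    have small: "real T ^ 3 * \<epsilon> \<le> 6"
    proof -
      have "real T ^ 3 \<le> real n ^ 3" using Tn by (intro power_mono) auto
      then show ?thesis using n by (simp add: \<epsilon>_def divide_simps)
    qed
    have idx: "idx T \<subseteq> {1..n}" "idx T \<noteq> {}"
    proof -
      show "idx T \<subseteq> {1..n}" unfolding idx_def by (rule bc(4))
      have "1 \<in> {1..T}" using T by simp
      then have "B 1 \<subseteq> idx T" "B1 1 \<subseteq> B 1" "B1 1 \<noteq> {}" using B1[of 1] unfolding idx_def by blast+
      then show "idx T \<noteq> {}" by blast
    qed
    define E where "E = (\<lambda>y. distortion d k \<mu> (code y T) - opt_distortion d k \<mu>)"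
    define Z where "Z = (\<lambda>\<omega>. \<lambda>i\<in>idx T. Xs i \<omega>)"
    have Z: "Z \<in> P \<rightarrow>\<^sub>M law T" "distr P (law T) Z = law T"
      using iid_sample_restrict[OF P X iid idx] unfolding Z_def \<nu> by auto
    have eE: "excess \<omega> = E (Z \<omega>)" for \<omega>
    proof -
      have "code (\<lambda>i. Xs i \<omega>) T = code (Z \<omega>) T" by (rule code_agree) (auto simp: Z_def)
      then show ?thesis by (simp add: excess_def E_def)
    qed
    note ex = expected_excess_le[OF T small, folded E_def]
    have Em: "E \<in> borel_measurable (law T)" using ex(1) by (rule borel_measurable_integrable)
    have "integrable (distr P (law T) Z) E" unfolding Z(2) using ex(1) .
    then have int: "integrable P excess" unfolding eE using integrable_distr_eq[OF Z(1) Em] by simp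
    have "(\<integral>\<omega>. excess \<omega> \<partial>P) = (\<integral>y. E y \<partial>distr P (law T) Z)"
      unfolding eE by (rule integral_distr[OF Z(1) Em, symmetric])
    also have "\<dots> \<le> measure \<mu> (space \<mu>) * (80 * R\<^sup>2 * M / (p * real T))" unfolding Z(2) using ex(2) .
    also have "\<dots> \<le> measure \<mu> (space \<mu>) * bnd"
    proof (rule mult_left_mono)
      have "real n \<le> real ((T + 1) * m)" using bc(2) by (simp del: of_nat_mult of_nat_add)
      also have "\<dots> \<le> real (2 * T * m)" using T by (simp only: of_nat_le_iff) (intro mult_right_mono, auto)
      also have "\<dots> = 2 * real T * real m" by simp
      also have "\<dots> \<le> 2 * real T * (480000 * z)" using mK by (intro mult_left_mono) auto
      finally have "1 / real T \<le> 960000 * z / real n" using T n by (simp add: divide_simps mult_ac)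
      then have "80 * (R\<^sup>2 * q) * (1 / real T) \<le> 80 * (R\<^sup>2 * q) * (960000 * z / real n)"
        using q by (intro mult_left_mono) auto
      also have "\<dots> = 76800000 * (R\<^sup>2 * q * 1 * z / real n)" by simp
      also have "\<dots> \<le> bnd" unfolding bnd
        using k_ge_2 q z1 by (intro mult_left_mono divide_right_mono mult_right_mono) auto
      finally show "80 * R\<^sup>2 * M / (p * real T) \<le> bnd" by (simp add: q_def)
    qed simp
    finally show ?thesis using int unfolding bnd_def by simp
  qed
qed

lemma (in sample_law) sample_point_single_cell:
  assumes X: "X \<in> P \<rightarrow>\<^sub>M ball_measures d R M" and \<nu>: "\<nu> = distr P (ball_measures d R M) X"
    and sp: "sample_point d P X" and c: "c \<in> codebooks d k"
  shows "AE x in \<nu>. single_cell d k c x"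
proof -
  from sp obtain Y where Y: "Y \<in> P \<rightarrow>\<^sub>M euc d" and ae: "AE \<omega> in P. X \<omega> = return (euc d) (Y \<omega>)"
    unfolding sample_point_def by blast
  have [measurable]: "mass d k c j \<in> borel_measurable (ball_measures d R M)" if "j \<in> {1..k}" for j
    unfolding mass_def[abs_def] using measurable_emeasure_ball_measures[OF sets_cell[OF c that]]
    by (simp add: measure_def borel_measurable_enn2real)
  have m: "{x \<in> space (ball_measures d R M). single_cell d k c x} \<in> sets (ball_measures d R M)"
    unfolding single_cell_def by measurable
  show ?thesis unfolding \<nu>
  proof (subst AE_distr_iff[OF X m])
    show "AE \<omega> in P. single_cell d k c (X \<omega>)"
      using ae AE_space
    proof eventually_elim
      case (elim \<omega>)
      have u: "Y \<omega> \<in> space (euc d)" using measurable_space[OF Y elim(2)] .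
      obtain a where a: "a \<in> {1..k}" "Y \<omega> \<in> cell d k c a" using ex_cell[OF u] by blast
      have "mass d k c j (X \<omega>) = (if j = a then 1 else 0)" if j: "j \<in> {1..k}" for j
      proof -
        have "mass d k c j (X \<omega>) = indicator (cell d k c j) (Y \<omega>)"
          unfolding mass_def elim(1) by (rule measure_return[OF sets_cell[OF c j]])
        also have "\<dots> = (if j = a then 1 else 0)"
        proof (cases "j = a")
          case False
          then have "Y \<omega> \<notin> cell d k c j" using cell_unique[OF _ a(2) j a(1)] by blast
          then show ?thesis using False by simp
        qed (use a(2) in simp)
        finally show ?thesis .
      qed
      then show ?case unfolding single_cell_def using a(1) by blast
    qed
  qed
qed

theorem theorem10:
  shows "\<exists>c C :: real. c > 0 \<and> C > 0 \<and>
    (\<forall>(P :: 'w measure) (d::nat) (k::nat) (R::real) (M::real) (X :: 'w \<Rightarrow> pt measure)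
      (n::nat) (Xs :: nat \<Rightarrow> 'w \<Rightarrow> pt measure) (r0::real)
      (m::nat) (T::nat) (B :: nat \<Rightarrow> nat set) (B1 :: nat \<Rightarrow> nat set) (B2 :: nat \<Rightarrow> nat set)
      (c0 :: codebook).
      (let \<mu> = mean_measure d P X;
           p = p_min d k \<mu>;
           R0 = min_sep d k \<mu> * r0 / (16 * sqrt 2 * R);
           \<kappa>0 = R0 / R;
           bound = measure \<mu> (space \<mu>) *
             (C * (real k)\<^sup>2 * M ^ 3 * R\<^sup>2 * (ln (real n) / (real n * \<kappa>0\<^sup>2 * p ^ 3)));
           excess = (\<lambda>a. distortion d k \<mu> a - opt_distortion d k \<mu>)
       in
         prob_space P \<longrightarrow>
         X \<in> P \<rightarrow>\<^sub>M ball_measures d R M \<longrightarrow>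
         iid_sample P (ball_measures d R M) X n Xs \<longrightarrow>
         k \<ge> 2 \<longrightarrow>
         n \<ge> 2 \<longrightarrow>
         supported_by_more_than d \<mu> k \<longrightarrow>
         r0 > 0 \<longrightarrow>
         margin_condition d k R \<mu> r0 \<longrightarrow>
         \<bar>real m - c * real k * M\<^sup>2 * ln (real n) / (\<kappa>0 * p)\<^sup>2\<bar> \<le> 1 \<longrightarrow>
         batches n m T B \<longrightarrow>
         c0 \<in> near_opt d k \<mu> R0 \<longrightarrow>
         ((\<forall>t\<in>{1..T}. halves (B t) (B1 t) (B2 t)) \<longrightarrow>
           integrable P (\<lambda>\<omega>. excess (minibatch d k R (\<lambda>i. Xs i \<omega>) B1 B2 c0 T)) \<and>
           (\<integral>\<omega>. excess (minibatch d k R (\<lambda>i. Xs i \<omega>) B1 B2 c0 T) \<partial>P) \<le> bound) \<and>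
         (sample_point d P X \<longrightarrow>
           integrable P (\<lambda>\<omega>. excess (minibatch_centroid d k (\<lambda>i. Xs i \<omega>) B c0 T)) \<and>
           (\<integral>\<omega>. excess (minibatch_centroid d k (\<lambda>i. Xs i \<omega>) B c0 T) \<partial>P) \<le> bound)))"
proof (rule exI[of _ "240000 :: real"], rule exI[of _ "76800000 :: real"], intro conjI allI)
  fix P :: "'w measure" and d k :: nat and R M :: real and X :: "'w \<Rightarrow> pt measure" and n :: nat
    and Xs :: "nat \<Rightarrow> 'w \<Rightarrow> pt measure" and r0 :: real and m T :: nat and B B1 B2 :: "nat \<Rightarrow> nat set"
    and c0 :: codebook
  define \<mu> where "\<mu> = mean_measure d P X"
  define r where "r = min_sep d k \<mu> * r0 / (16 * sqrt 2 * R)"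
  define bound where "bound = measure \<mu> (space \<mu>) *
    (76800000 * (real k)\<^sup>2 * M ^ 3 * R\<^sup>2 * (ln (real n) / (real n * (r / R)\<^sup>2 * p_min d k \<mu> ^ 3)))"
  have main: "((\<forall>t\<in>{1..T}. halves (B t) (B1 t) (B2 t)) \<longrightarrow>
        integrable P (\<lambda>\<omega>. distortion d k \<mu> (minibatch d k R (\<lambda>i. Xs i \<omega>) B1 B2 c0 T) - opt_distortion d k \<mu>) \<and>
        (\<integral>\<omega>. distortion d k \<mu> (minibatch d k R (\<lambda>i. Xs i \<omega>) B1 B2 c0 T) - opt_distortion d k \<mu> \<partial>P) \<le> bound) \<and>
      (sample_point d P X \<longrightarrow>
        integrable P (\<lambda>\<omega>. distortion d k \<mu> (minibatch_centroid d k (\<lambda>i. Xs i \<omega>) B c0 T) - opt_distortion d k \<mu>) \<and>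
        (\<integral>\<omega>. distortion d k \<mu> (minibatch_centroid d k (\<lambda>i. Xs i \<omega>) B c0 T) - opt_distortion d k \<mu> \<partial>P) \<le> bound)"
    if P: "prob_space P" and X: "X \<in> P \<rightarrow>\<^sub>M ball_measures d R M"
      and iid: "iid_sample P (ball_measures d R M) X n Xs" and k: "2 \<le> k" and n: "2 \<le> n"
      and supp: "supported_by_more_than d \<mu> k" and r0: "0 < r0" and margin: "margin_condition d k R \<mu> r0"
      and m: "\<bar>real m - 240000 * real k * M\<^sup>2 * ln (real n) / (r / R * p_min d k \<mu>)\<^sup>2\<bar> \<le> 1"
      and B: "batches n m T B" and near: "c0 \<in> near_opt d k \<mu> r"
  proof -
    interpret bd: ball_distribution d k R \<mu>
      unfolding \<mu>_def by (rule ball_distribution_mean_measure[OF P X k supp[unfolded \<mu>_def]])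
    from near obtain cs where near_cs: "cs \<in> opt_codebooks d k \<mu>" "c0 \<in> codebooks d k" "cdist d k cs c0 \<le> r"
      unfolding near_opt_def by blast
    define \<nu> where "\<nu> = distr P (ball_measures d R M) X"
    interpret margin_distribution d k R \<mu> r0 cs
      by (intro margin_distribution.intro bd.ball_distribution_axioms margin_distribution_axioms.intro near_cs(1) margin r0)
    interpret sample_law d k R \<mu> r0 cs M \<nu>
    proof (intro sample_law.intro sample_law_axioms.intro margin_distribution_axioms)
      show "prob_space \<nu>" unfolding \<nu>_def by (rule prob_space.prob_space_distr[OF P X])
      show "sets \<nu> = sets (ball_measures d R M)" by (simp add: \<nu>_def)
      fix A assume A: "A \<in> sets (euc d)"
      show "emeasure \<mu> A = (\<integral>\<^sup>+ x. emeasure x A \<partial>\<nu>)"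
        unfolding \<mu>_def \<nu>_def emeasure_mean_measure[OF X A]
        by (rule nn_integral_distr[OF X, symmetric]) (use measurable_emeasure_ball_measures[OF A] in simp)
    qed
    have rR0: "r = R0" by (simp add: r_def R0_def)
    have R: "0 \<le> R" using bd.R_pos by simp
    show ?thesis
    proof (intro conjI[of "_ \<longrightarrow> _"] impI)
      assume h: "\<forall>t\<in>{1..T}. halves (B t) (B1 t) (B2 t)"
      have hc: "B1 t \<subseteq> B t" "B2 t \<subseteq> B t" "B1 t \<inter> B2 t = {}" "m \<le> 2 * card (B1 t) + 1" "m \<le> 2 * card (B2 t) + 1"
        if t: "t \<in> {1..T}" for t
        using halves_card[OF bspec[OF h t] batches_card(3)[OF B t]] B t by (auto simp: batches_def)
      show "integrable P (\<lambda>\<omega>. distortion d k \<mu> (minibatch d k R (\<lambda>i. Xs i \<omega>) B1 B2 c0 T) - opt_distortion d k \<mu>) \<and>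
        (\<integral>\<omega>. distortion d k \<mu> (minibatch d k R (\<lambda>i. Xs i \<omega>) B1 B2 c0 T) - opt_distortion d k \<mu> \<partial>P) \<le> bound"
        unfolding minibatch_eq_mb_iter bound_def rR0
        by (rule run_expected_excess[OF n m[unfolded rR0] B near_cs(2) near_cs(3)[unfolded rR0]
              measurable_eproj_eball[OF R] edist_eproj_eball_le[OF _ R] _ _ _ _ P X iid \<nu>_def])
           (use hc eproj_eball_in[OF _ R] in auto)
    next
      assume sp: "sample_point d P X"
      show "integrable P (\<lambda>\<omega>. distortion d k \<mu> (minibatch_centroid d k (\<lambda>i. Xs i \<omega>) B c0 T) - opt_distortion d k \<mu>) \<and>
        (\<integral>\<omega>. distortion d k \<mu> (minibatch_centroid d k (\<lambda>i. Xs i \<omega>) B c0 T) - opt_distortion d k \<mu> \<partial>P) \<le> bound"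
        unfolding minibatch_centroid_eq_mb_iter bound_def rR0
        by (rule run_expected_excess[OF n m[unfolded rR0] B near_cs(2) near_cs(3)[unfolded rR0]
              _ _ _ _ _ _ P X iid \<nu>_def])
           (use B sample_point_single_cell[OF X \<nu>_def sp] in \<open>auto simp: batches_def\<close>)
    qed
  qed
  show "let \<mu> = mean_measure d P X;
           p = p_min d k \<mu>;
           R0 = min_sep d k \<mu> * r0 / (16 * sqrt 2 * R);
           \<kappa>0 = R0 / R;
           bound = measure \<mu> (space \<mu>) *
             (76800000 * (real k)\<^sup>2 * M ^ 3 * R\<^sup>2 * (ln (real n) / (real n * \<kappa>0\<^sup>2 * p ^ 3)));
           excess = (\<lambda>a. distortion d k \<mu> a - opt_distortion d k \<mu>)
       in
         prob_space P \<longrightarrow>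
         X \<in> P \<rightarrow>\<^sub>M ball_measures d R M \<longrightarrow>
         iid_sample P (ball_measures d R M) X n Xs \<longrightarrow>
         k \<ge> 2 \<longrightarrow>
         n \<ge> 2 \<longrightarrow>
         supported_by_more_than d \<mu> k \<longrightarrow>
         r0 > 0 \<longrightarrow>
         margin_condition d k R \<mu> r0 \<longrightarrow>
         \<bar>real m - 240000 * real k * M\<^sup>2 * ln (real n) / (\<kappa>0 * p)\<^sup>2\<bar> \<le> 1 \<longrightarrow>
         batches n m T B \<longrightarrow>
         c0 \<in> near_opt d k \<mu> R0 \<longrightarrow>
         ((\<forall>t\<in>{1..T}. halves (B t) (B1 t) (B2 t)) \<longrightarrow>
           integrable P (\<lambda>\<omega>. excess (minibatch d k R (\<lambda>i. Xs i \<omega>) B1 B2 c0 T)) \<and>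
           (\<integral>\<omega>. excess (minibatch d k R (\<lambda>i. Xs i \<omega>) B1 B2 c0 T) \<partial>P) \<le> bound) \<and>
         (sample_point d P X \<longrightarrow>
           integrable P (\<lambda>\<omega>. excess (minibatch_centroid d k (\<lambda>i. Xs i \<omega>) B c0 T)) \<and>
           (\<integral>\<omega>. excess (minibatch_centroid d k (\<lambda>i. Xs i \<omega>) B c0 T) \<partial>P) \<le> bound)"
    unfolding Let_def \<mu>_def[symmetric] r_def[symmetric] bound_def[symmetric] by (intro impI main)
qed simp_all

end
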